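(* Let $\mathcal B=(B_g)_{g\in G}$ be a unital Fell bundle over a discrete group $G$. Assume that $C_r^*(\mathcal B)$ has the Hilbert $B_e$-module Haagerup property with respect to $E_e$. Then $\mathcal B$ has the Haagerup PD-approximation property.
   Context: **Fell bundles.** A Fell bundle $\mathcal B=(B_g)_{g\in G}$ over a discrete group $G$ (with unit $e$) is a family of Banach spaces (their disjoint union is also denoted $\mathcal B$) with an associative multiplication $\mathcal B\times\mathcal B\to\mathcal B$ such that $B_gB_h\subseteq B_{gh}$, bilinear on each $B_g\times B_h$, $\|ab\|\le\|a\|\|b\|$, and an involutive anti-multiplicative map $b\mapsto b^*$ which is conjugate-linear and isometric from $B_g$ onto $B_{g^{-1}}$, such that $\|b^*b\|=\|b\|^2$ and $b^*b\ge 0$ in the $C^*$-algebra $B_e$ for all $b\in\mathcal B$. $\mathcal B$ is unital if $B_e$ is unital. **Reduced cross-sectional algebra.** $C_c(\mathcal B)$ is the space of finitely supported sections of $\mathcal B$; $\ell^2(\mathcal B)$ is the right Hilbert $B_e$-module completion of $C_c(\mathcal B)$ for $\langle\xi,\eta\rangle_{B_e}=\sum_g\xi(g)^*\eta(g)$, $(\xi\cdot b)(g)=\xi(g)b$. For $b\in B_g$, $\lambda_g^{\mathcal B}(b)$ is the adjointable operator on $\ell^2(\mathcal B)$ with $(\lambda^{\mathcal B}_g(b)\xi)(h)=b\,\xi(g^{-1}h)$. $C_r^*(\mathcal B)$ is the $C^*$-algebra generated by all $\lambda_g^{\mathcal B}(b)$, $g\in G$, $b\in B_g$. $B_e$ is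 identified with $\lambda_e^{\mathcal B}(B_e)$, and $E_e:C_r^*(\mathcal B)\to B_e$ is the faithful conditional expectation satisfying $E_e(\lambda_g^{\mathcal B}(b))=b$ if $g=e$ and $=0$ if $g\ne e$. **Hilbert $B_e$-module Haagerup property.** $\mathcal H_{\mathcal B}$ is the right Hilbert $B_e$-module completion of $C_r^*(\mathcal B)$ for the inner product $\langle x,y\rangle_{E_e}=E_e(x^*y)$, with norm $\|x\|_{E_e}=\|E_e(x^*x)\|^{1/2}$. If $\Phi$ is a completely positive map on $C_r^*(\mathcal B)$ with $E_e\circ\Phi\le E_e$ (on positive elements), then $\Phi$ induces a bounded map $\tilde\Phi$ on $\mathcal H_{\mathcal B}$. A finite rank map on $\mathcal H_{\mathcal B}$ is a finite sum of maps $\theta_{\xi,\eta}(x)=\xi\langle\eta,x\rangle_{E_e}$, $\xi,\eta\in\mathcal H_{\mathcal B}$; a compact map on $\mathcal H_{\mathcal B}$ is a bounded map that is a norm limit of finite rank maps. $C_r^*(\mathcal B)$ has the Hilbert $B_e$-module Haagerup property with respect to $E_e$ if there is a net $\{\Phi_i\}_{i\in I}$ of completely positive $B_e$-bimodule maps on $C_r^*(\mathcal B)$ with: (a) $E_e\circ\Phi_i\le E_e$ for every $i$; (b) $\sup_i\|\tilde\Phi_i\|<\infty$; (c) each $\tilde\Phi_i$ is a compact map on $\mathcal H_{\mathcal B}$; (d) $\|\tilde\Phi_i(x)-x\|_{E_e}\to_i 0$ for all $x\in C_r^*(\mathcal B)$. **Haagerup PD-approximation property.** A $\mathcal B$-bundle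 map is a family $T=(T_g)_{g\in G}$ of bounded linear maps $T_g:B_g\to B_g$; it is positive definite if $\sum_{i,j=1}^n b_i\,T_{g_i^{-1}g_j}(a_i^*a_j)\,b_j^*\ge 0$ in $B_e$ for all $n\in\mathbb N$, $g_1,\dots,g_n\in G$ and $a_i,b_i\in B_{g_i}$. $\mathcal B$ has the Haagerup PD-approximation property if there is a net $\{T^i\}_{i\in I}$ of $\mathcal B$-bundle maps with: (i) each $T^i$ is positive definite and $g\mapsto\|T^i_g\|$ is in $C_0(G)$; (ii) $\sup_i\|T_e^i\|<\infty$; (iii) $\lim_i\|T^i_g(b)-b\|=0$ for all $g\in G$, $b\in B_g$. *)

theory Defs
  imports Complex_Main "HOL-Algebra.Module"
begin

section \<open>Normed spaces and star algebras over carrier sets\<close>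

definition complex_ring :: "complex ring" where
  "complex_ring = \<lparr>carrier = UNIV, mult = (*), one = 1, zero = 0, add = (+)\<rparr>"

text \<open>
  As everywhere in HOL-Algebra, the fields \<open>mult\<close> and \<open>one\<close> of a module record are
  irrelevant unless the module is explicitly used as an algebra.
\<close>

record 'v normed_module = "(complex, 'v) module" +
  nrm :: "'v \<Rightarrow> real"

record 'v star_algebra = "'v normed_module" +
  adj :: "'v \<Rightarrow> 'v"

locale normed_space = module complex_ring V for V :: "('v, 'm) normed_module_scheme" (structure) +
  assumes nrm_nonneg: "x \<in> carrier V \<Longrightarrow> 0 \<le> nrm V x"
    and nrm_eq_0: "x \<in> carrier V \<Longrightarrow> nrm V x = 0 \<longleftrightarrow> x = \<zero>\<^bsub>V\<^esub>"
    and nrm_smult: "x \<in> carrier V \<Longrightarrow> nrm V (c \<odot>\<^bsub>V\<^esub> x) = cmod c * nrm V x"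
    and nrm_triangle: "x \<in> carrier V \<Longrightarrow> y \<in> carrier V \<Longrightarrow> nrm V (x \<oplus>\<^bsub>V\<^esub> y) \<le> nrm V x + nrm V y"

definition converges_to :: "('v, 'm) normed_module_scheme \<Rightarrow> (nat \<Rightarrow> 'v) \<Rightarrow> 'v \<Rightarrow> bool" where
  "converges_to V s x \<longleftrightarrow>
     (\<forall>n. s n \<in> carrier V) \<and> x \<in> carrier V \<and> (\<lambda>n. nrm V (s n \<ominus>\<^bsub>V\<^esub> x)) \<longlonglongrightarrow> 0"

definition cauchy_seq :: "('v, 'm) normed_module_scheme \<Rightarrow> (nat \<Rightarrow> 'v) \<Rightarrow> bool" where
  "cauchy_seq V s \<longleftrightarrow>
     (\<forall>n. s n \<in> carrier V) \<and>
     (\<forall>\<epsilon>>0. \<exists>N. \<forall>m\<ge>N. \<forall>n\<ge>N. nrm V (s m \<ominus>\<^bsub>V\<^esub> s n) < \<epsilon>)"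

locale banach_space = normed_space +
  assumes complete: "cauchy_seq V s \<Longrightarrow> \<exists>x. converges_to V s x"

definition linear_map ::
  "('v, 'm) normed_module_scheme \<Rightarrow> ('w, 'n) normed_module_scheme \<Rightarrow> ('v \<Rightarrow> 'w) \<Rightarrow> bool" where
  "linear_map V W T \<longleftrightarrow>
     T \<in> carrier V \<rightarrow> carrier W \<and>
     (\<forall>x\<in>carrier V. \<forall>y\<in>carrier V. T (x \<oplus>\<^bsub>V\<^esub> y) = T x \<oplus>\<^bsub>W\<^esub> T y) \<and>
     (\<forall>c. \<forall>x\<in>carrier V. T (c \<odot>\<^bsub>V\<^esub> x) = c \<odot>\<^bsub>W\<^esub> T x)"

definition bounded_map ::
  "('v, 'm) normed_module_scheme \<Rightarrow> ('w, 'n) normed_module_scheme \<Rightarrow> ('v \<Rightarrow> 'w) \<Rightarrow> bool" where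
  "bounded_map V W T \<longleftrightarrow>
     linear_map V W T \<and> (\<exists>K. \<forall>x\<in>carrier V. nrm W (T x) \<le> K * nrm V x)"

definition op_norm ::
  "('v, 'm) normed_module_scheme \<Rightarrow> ('w, 'n) normed_module_scheme \<Rightarrow> ('v \<Rightarrow> 'w) \<Rightarrow> real" where
  "op_norm V W T = Sup {nrm W (T x) | x. x \<in> carrier V \<and> nrm V x \<le> 1}"

definition positive :: "('a, 'm) star_algebra_scheme \<Rightarrow> 'a \<Rightarrow> bool" where
  "positive A a \<longleftrightarrow> (\<exists>c\<in>carrier A. a = adj A c \<otimes>\<^bsub>A\<^esub> c)"

text \<open>
  Positivity of an \<open>n\<close> by \<open>n\<close> matrix in the star algebra of matrices over \<open>A\<close>:
  the matrix is of the form \<open>c\<^sup>* c\<close> with \<open>c\<close> an \<open>n\<close> by \<open>n\<close> matrix.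
\<close>

definition positive_matrix ::
  "('a, 'm) star_algebra_scheme \<Rightarrow> nat \<Rightarrow> (nat \<Rightarrow> nat \<Rightarrow> 'a) \<Rightarrow> bool" where
  "positive_matrix A n a \<longleftrightarrow>
     (\<exists>c. (\<forall>i<n. \<forall>j<n. c i j \<in> carrier A) \<and>
          (\<forall>i<n. \<forall>j<n. a i j = (\<Oplus>\<^bsub>A\<^esub>k\<in>{..<n}. adj A (c k i) \<otimes>\<^bsub>A\<^esub> c k j)))"

definition completely_positive :: "('a, 'm) star_algebra_scheme \<Rightarrow> ('a \<Rightarrow> 'a) \<Rightarrow> bool" where
  "completely_positive A \<Phi> \<longleftrightarrow>
     linear_map A A \<Phi> \<and>
     (\<forall>n a. positive_matrix A n a \<longrightarrow> positive_matrix A n (\<lambda>i j. \<Phi> (a i j)))"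

definition cstar_subalgebra :: "('a, 'm) star_algebra_scheme \<Rightarrow> 'a set \<Rightarrow> bool" where
  "cstar_subalgebra A C \<longleftrightarrow>
     C \<subseteq> carrier A \<and> \<zero>\<^bsub>A\<^esub> \<in> C \<and>
     (\<forall>x\<in>C. \<forall>y\<in>C. x \<oplus>\<^bsub>A\<^esub> y \<in> C \<and> x \<otimes>\<^bsub>A\<^esub> y \<in> C) \<and>
     (\<forall>c. \<forall>x\<in>C. c \<odot>\<^bsub>A\<^esub> x \<in> C) \<and>
     (\<forall>x\<in>C. adj A x \<in> C) \<and>
     (\<forall>s x. (\<forall>n. s n \<in> C) \<and> converges_to A s x \<longrightarrow> x \<in> C)"

definition cstar_generated :: "('a, 'm) star_algebra_scheme \<Rightarrow> 'a set \<Rightarrow> 'a set" where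
  "cstar_generated A S = \<Inter> {C. cstar_subalgebra A C \<and> S \<subseteq> C}"


section \<open>Hilbert modules\<close>

text \<open>
  Right modules over a star algebra with elements in \<open>'a\<close>; the inner product is conjugate-linear
  in the first argument.
\<close>

record ('a, 'v) hilbert_module = "'v normed_module" +
  ract :: "'v \<Rightarrow> 'a \<Rightarrow> 'v"
  inner :: "'v \<Rightarrow> 'v \<Rightarrow> 'a"

text \<open>
  The completion of a pre-Hilbert module consists of the Cauchy sequences modulo null sequences.
\<close>

definition null_rel :: "('v, 'm) normed_module_scheme \<Rightarrow> ((nat \<Rightarrow> 'v) \<times> (nat \<Rightarrow> 'v)) set" where
  "null_rel V =
     {(s, t). cauchy_seq V s \<and> cauchy_seq V t \<and> (\<lambda>n. nrm V (s n \<ominus>\<^bsub>V\<^esub> t n)) \<longlonglongrightarrow> 0}"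

definition seq_class :: "('v, 'm) normed_module_scheme \<Rightarrow> (nat \<Rightarrow> 'v) \<Rightarrow> (nat \<Rightarrow> 'v) set" where
  "seq_class V s = null_rel V `` {s}"

definition seq_rep :: "(nat \<Rightarrow> 'v) set \<Rightarrow> nat \<Rightarrow> 'v" where
  "seq_rep X = (SOME s. s \<in> X)"

definition completion ::
  "('a, 'm) normed_module_scheme \<Rightarrow> ('a, 'v) hilbert_module \<Rightarrow> ('a, (nat \<Rightarrow> 'v) set) hilbert_module"
  where
  "completion A V =
    \<lparr>carrier = {s. cauchy_seq V s} // null_rel V,
     mult = undefined,
     one = undefined,
     zero = seq_class V (\<lambda>n. \<zero>\<^bsub>V\<^esub>),
     add = (\<lambda>X Y. seq_class V (\<lambda>n. seq_rep X n \<oplus>\<^bsub>V\<^esub> seq_rep Y n)),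
     smult = (\<lambda>c X. seq_class V (\<lambda>n. c \<odot>\<^bsub>V\<^esub> seq_rep X n)),
     nrm = (\<lambda>X. lim (\<lambda>n. nrm V (seq_rep X n))),
     ract = (\<lambda>X a. seq_class V (\<lambda>n. ract V (seq_rep X n) a)),
     inner = (\<lambda>X Y. THE a. converges_to A (\<lambda>n. inner V (seq_rep X n) (seq_rep Y n)) a)\<rparr>"

definition embed :: "('a, 'v) hilbert_module \<Rightarrow> 'v \<Rightarrow> (nat \<Rightarrow> 'v) set" where
  "embed V x = seq_class V (\<lambda>n. x)"

definition is_adjoint ::
  "('a, 'v) hilbert_module \<Rightarrow> ('v \<Rightarrow> 'v) \<Rightarrow> ('v \<Rightarrow> 'v) \<Rightarrow> bool" where
  "is_adjoint L T S \<longleftrightarrow>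
     (\<forall>x\<in>carrier L. \<forall>y\<in>carrier L. inner L (T x) y = inner L x (S y))"

text \<open>
  Adjointable operators on a Hilbert module; boundedness is automatic but is stated
  explicitly.  Operators are extensional, so that equality of operators is equality of functions.
\<close>

definition adjointable_algebra :: "('a, 'v) hilbert_module \<Rightarrow> ('v \<Rightarrow> 'v) star_algebra" where
  "adjointable_algebra L =
    \<lparr>carrier = {T \<in> carrier L \<rightarrow>\<^sub>E carrier L.
        bounded_map L L T \<and> (\<exists>S \<in> carrier L \<rightarrow>\<^sub>E carrier L. is_adjoint L T S)},
     mult = (\<lambda>S T. \<lambda>x\<in>carrier L. S (T x)),
     one = (\<lambda>x\<in>carrier L. x),
     zero = (\<lambda>x\<in>carrier L. \<zero>\<^bsub>L\<^esub>),
     add = (\<lambda>S T. \<lambda>x\<in>carrier L. S x \<oplus>\<^bsub>L\<^esub> T x),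
     smult = (\<lambda>c T. \<lambda>x\<in>carrier L. c \<odot>\<^bsub>L\<^esub> T x),
     nrm = op_norm L L,
     adj = (\<lambda>T. THE S. S \<in> carrier L \<rightarrow>\<^sub>E carrier L \<and> is_adjoint L T S)\<rparr>"

definition finite_rank :: "('a, 'v) hilbert_module \<Rightarrow> ('v \<Rightarrow> 'v) \<Rightarrow> bool" where
  "finite_rank H F \<longleftrightarrow>
     (\<exists>n::nat. \<exists>\<xi> \<eta>. (\<forall>k<n. \<xi> k \<in> carrier H \<and> \<eta> k \<in> carrier H) \<and>
        (\<forall>x\<in>carrier H. F x = (\<Oplus>\<^bsub>H\<^esub>k\<in>{..<n}. ract H (\<xi> k) (inner H (\<eta> k) x))))"

definition compact_map :: "('a, 'v) hilbert_module \<Rightarrow> ('v \<Rightarrow> 'v) \<Rightarrow> bool" where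
  "compact_map H S \<longleftrightarrow>
     bounded_map H H S \<and>
     (\<exists>F. (\<forall>n. finite_rank H (F n)) \<and>
          (\<lambda>n. op_norm H H (\<lambda>x. S x \<ominus>\<^bsub>H\<^esub> F n x)) \<longlonglongrightarrow> 0)"


section \<open>Fell bundles\<close>

text \<open>
  Elements of the total space always come with their degree: \<open>bmult B g h\<close> is the multiplication
  \<open>B\<^sub>g \<times> B\<^sub>h \<rightarrow> B\<^sub>g\<^sub>h\<close> and \<open>bstar B g\<close> is the involution \<open>B\<^sub>g \<rightarrow> B\<^sub>g\<^sub>-\<^sub>1\<close>.  Hence the fibres
  need not be disjoint as subsets of the type \<open>'b\<close>.
\<close>

record ('g, 'b) bundle_data =
  fibre :: "'g \<Rightarrow> 'b normed_module"
  bmult :: "'g \<Rightarrow> 'g \<Rightarrow> 'b \<Rightarrow> 'b \<Rightarrow> 'b"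
  bstar :: "'g \<Rightarrow> 'b \<Rightarrow> 'b"

definition unit_algebra :: "'g monoid \<Rightarrow> ('g, 'b) bundle_data \<Rightarrow> 'b star_algebra" where
  "unit_algebra G B =
    (let e = \<one>\<^bsub>G\<^esub>; V = fibre B e in
     \<lparr>carrier = carrier V,
      mult = bmult B e e,
      one = (THE u. u \<in> carrier V \<and> (\<forall>a\<in>carrier V. bmult B e e u a = a \<and> bmult B e e a u = a)),
      zero = zero V,
      add = add V,
      smult = smult V,
      nrm = nrm V,
      adj = bstar B e\<rparr>)"

locale fell_bundle = group G for G :: "'g monoid" (structure) +
  fixes B :: "('g, 'b) bundle_data"
  assumes banach_fibre: "g \<in> carrier G \<Longrightarrow> banach_space (fibre B g)"
    and bmult_closed:
      "\<lbrakk>g \<in> carrier G; h \<in> carrier G; a \<in> carrier (fibre B g); b \<in> carrier (fibre B h)\<rbrakk>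
       \<Longrightarrow> bmult B g h a b \<in> carrier (fibre B (g \<otimes> h))"
    and bmult_linear_right:
      "\<lbrakk>g \<in> carrier G; h \<in> carrier G; a \<in> carrier (fibre B g)\<rbrakk>
       \<Longrightarrow> linear_map (fibre B h) (fibre B (g \<otimes> h)) (\<lambda>b. bmult B g h a b)"
    and bmult_linear_left:
      "\<lbrakk>g \<in> carrier G; h \<in> carrier G; b \<in> carrier (fibre B h)\<rbrakk>
       \<Longrightarrow> linear_map (fibre B g) (fibre B (g \<otimes> h)) (\<lambda>a. bmult B g h a b)"
    and bmult_assoc:
      "\<lbrakk>g \<in> carrier G; h \<in> carrier G; k \<in> carrier G;
        a \<in> carrier (fibre B g); b \<in> carrier (fibre B h); c \<in> carrier (fibre B k)\<rbrakk>
       \<Longrightarrow> bmult B (g \<otimes> h) k (bmult B g h a b) c = bmult B g (h \<otimes> k) a (bmult B h k b c)"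
    and nrm_bmult:
      "\<lbrakk>g \<in> carrier G; h \<in> carrier G; a \<in> carrier (fibre B g); b \<in> carrier (fibre B h)\<rbrakk>
       \<Longrightarrow> nrm (fibre B (g \<otimes> h)) (bmult B g h a b) \<le> nrm (fibre B g) a * nrm (fibre B h) b"
    and bstar_closed:
      "\<lbrakk>g \<in> carrier G; b \<in> carrier (fibre B g)\<rbrakk> \<Longrightarrow> bstar B g b \<in> carrier (fibre B (inv g))"
    and bstar_bstar:
      "\<lbrakk>g \<in> carrier G; b \<in> carrier (fibre B g)\<rbrakk> \<Longrightarrow> bstar B (inv g) (bstar B g b) = b"
    and bstar_add:
      "\<lbrakk>g \<in> carrier G; a \<in> carrier (fibre B g); b \<in> carrier (fibre B g)\<rbrakk>
       \<Longrightarrow> bstar B g (a \<oplus>\<^bsub>fibre B g\<^esub> b) = bstar B g a \<oplus>\<^bsub>fibre B (inv g)\<^esub> bstar B g b"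
    and bstar_smult:
      "\<lbrakk>g \<in> carrier G; b \<in> carrier (fibre B g)\<rbrakk>
       \<Longrightarrow> bstar B g (z \<odot>\<^bsub>fibre B g\<^esub> b) = cnj z \<odot>\<^bsub>fibre B (inv g)\<^esub> bstar B g b"
    and bstar_bmult:
      "\<lbrakk>g \<in> carrier G; h \<in> carrier G; a \<in> carrier (fibre B g); b \<in> carrier (fibre B h)\<rbrakk>
       \<Longrightarrow> bstar B (g \<otimes> h) (bmult B g h a b) = bmult B (inv h) (inv g) (bstar B h b) (bstar B g a)"
    and nrm_bstar:
      "\<lbrakk>g \<in> carrier G; b \<in> carrier (fibre B g)\<rbrakk>
       \<Longrightarrow> nrm (fibre B (inv g)) (bstar B g b) = nrm (fibre B g) b"
    and nrm_cstar:
      "\<lbrakk>g \<in> carrier G; b \<in> carrier (fibre B g)\<rbrakk>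
       \<Longrightarrow> nrm (fibre B \<one>) (bmult B (inv g) g (bstar B g b) b) = (nrm (fibre B g) b)\<^sup>2"
    and positive_cstar:
      "\<lbrakk>g \<in> carrier G; b \<in> carrier (fibre B g)\<rbrakk>
       \<Longrightarrow> positive (unit_algebra G B) (bmult B (inv g) g (bstar B g b) b)"

locale unital_fell_bundle = fell_bundle +
  assumes unital:
    "\<exists>u\<in>carrier (fibre B \<one>). \<forall>a\<in>carrier (fibre B \<one>).
       bmult B \<one> \<one> u a = a \<and> bmult B \<one> \<one> a u = a"


section \<open>The reduced cross-sectional algebra\<close>

definition fin_sections :: "'g monoid \<Rightarrow> ('g, 'b) bundle_data \<Rightarrow> ('b, 'g \<Rightarrow> 'b) hilbert_module" where
  "fin_sections G B =
    (let supp = (\<lambda>\<xi>. {g \<in> carrier G. \<xi> g \<noteq> \<zero>\<^bsub>fibre B g\<^esub>});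
         ip = (\<lambda>\<xi> \<eta>. \<Oplus>\<^bsub>fibre B \<one>\<^bsub>G\<^esub>\<^esub>g\<in>supp \<xi>. bmult B (inv\<^bsub>G\<^esub> g) g (bstar B g (\<xi> g)) (\<eta> g)) in
     \<lparr>carrier = {\<xi> \<in> (\<Pi>\<^sub>E g\<in>carrier G. carrier (fibre B g)). finite (supp \<xi>)},
      mult = undefined,
      one = undefined,
      zero = (\<lambda>g\<in>carrier G. \<zero>\<^bsub>fibre B g\<^esub>),
      add = (\<lambda>\<xi> \<eta>. \<lambda>g\<in>carrier G. \<xi> g \<oplus>\<^bsub>fibre B g\<^esub> \<eta> g),
      smult = (\<lambda>c \<xi>. \<lambda>g\<in>carrier G. c \<odot>\<^bsub>fibre B g\<^esub> \<xi> g),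
      nrm = (\<lambda>\<xi>. sqrt (nrm (fibre B \<one>\<^bsub>G\<^esub>) (ip \<xi> \<xi>))),
      ract = (\<lambda>\<xi> b. \<lambda>g\<in>carrier G. bmult B g \<one>\<^bsub>G\<^esub> (\<xi> g) b),
      inner = ip\<rparr>)"

type_synonym ('g, 'b) l2_elem = "(nat \<Rightarrow> 'g \<Rightarrow> 'b) set"

definition l2 :: "'g monoid \<Rightarrow> ('g, 'b) bundle_data \<Rightarrow> ('b, ('g, 'b) l2_elem) hilbert_module" where
  "l2 G B = completion (unit_algebra G B) (fin_sections G B)"

type_synonym ('g, 'b) l2_op = "('g, 'b) l2_elem \<Rightarrow> ('g, 'b) l2_elem"

text \<open>
  The defining formula of \<open>reg_rep G B g b\<close> is imposed on the dense subspace of finitely supported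
  sections, which determines an adjointable operator uniquely.
\<close>

definition reg_rep :: "'g monoid \<Rightarrow> ('g, 'b) bundle_data \<Rightarrow> 'g \<Rightarrow> 'b \<Rightarrow> ('g, 'b) l2_op" where
  "reg_rep G B g b =
    (THE T. T \<in> carrier (adjointable_algebra (l2 G B)) \<and>
       (\<forall>\<xi>\<in>carrier (fin_sections G B).
          T (embed (fin_sections G B) \<xi>) =
          embed (fin_sections G B)
            (\<lambda>h\<in>carrier G. bmult B g (inv\<^bsub>G\<^esub> g \<otimes>\<^bsub>G\<^esub> h) b (\<xi> (inv\<^bsub>G\<^esub> g \<otimes>\<^bsub>G\<^esub> h)))))"

definition reduced_algebra :: "'g monoid \<Rightarrow> ('g, 'b) bundle_data \<Rightarrow> ('g, 'b) l2_op star_algebra" where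
  "reduced_algebra G B =
    adjointable_algebra (l2 G B)
      \<lparr>carrier := cstar_generated (adjointable_algebra (l2 G B))
         {reg_rep G B g b | g b. g \<in> carrier G \<and> b \<in> carrier (fibre B g)}\<rparr>"

definition bimodule_map ::
  "'g monoid \<Rightarrow> ('g, 'b) bundle_data \<Rightarrow> (('g, 'b) l2_op \<Rightarrow> ('g, 'b) l2_op) \<Rightarrow> bool" where
  "bimodule_map G B \<Phi> \<longleftrightarrow>
    (let A = reduced_algebra G B; \<iota> = reg_rep G B \<one>\<^bsub>G\<^esub> in
     \<forall>a\<in>carrier (fibre B \<one>\<^bsub>G\<^esub>). \<forall>b\<in>carrier (fibre B \<one>\<^bsub>G\<^esub>). \<forall>x\<in>carrier A.
       \<Phi> (\<iota> a \<otimes>\<^bsub>A\<^esub> x \<otimes>\<^bsub>A\<^esub> \<iota> b) = \<iota> a \<otimes>\<^bsub>A\<^esub> \<Phi> x \<otimes>\<^bsub>A\<^esub> \<iota> b)"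

text \<open>
  Faithful conditional expectations of the reduced algebra onto the unit fibre, the latter being
  identified with its image under \<open>reg_rep G B \<one>\<^bsub>G\<^esub>\<close>.
\<close>

definition faithful_cond_exp ::
  "'g monoid \<Rightarrow> ('g, 'b) bundle_data \<Rightarrow> (('g, 'b) l2_op \<Rightarrow> 'b) \<Rightarrow> bool" where
  "faithful_cond_exp G B E \<longleftrightarrow>
    (let A = reduced_algebra G B; D = unit_algebra G B; \<iota> = reg_rep G B \<one>\<^bsub>G\<^esub> in
     linear_map A D E \<and>
     (\<forall>x\<in>carrier A. nrm D (E x) \<le> nrm A x) \<and>
     (\<forall>x\<in>carrier A. positive A x \<longrightarrow> positive D (E x)) \<and>
     (\<forall>b\<in>carrier D. E (\<iota> b) = b) \<and>
     (\<forall>a\<in>carrier D. \<forall>b\<in>carrier D. \<forall>x\<in>carrier A.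
        E (\<iota> a \<otimes>\<^bsub>A\<^esub> x \<otimes>\<^bsub>A\<^esub> \<iota> b) = a \<otimes>\<^bsub>D\<^esub> E x \<otimes>\<^bsub>D\<^esub> b) \<and>
     (\<forall>x\<in>carrier A. positive A x \<and> E x = \<zero>\<^bsub>D\<^esub> \<longrightarrow> x = \<zero>\<^bsub>A\<^esub>))"

definition cond_exp :: "'g monoid \<Rightarrow> ('g, 'b) bundle_data \<Rightarrow> ('g, 'b) l2_op \<Rightarrow> 'b" where
  "cond_exp G B =
    (THE E. E \<in> extensional (carrier (reduced_algebra G B)) \<and> faithful_cond_exp G B E \<and>
       (\<forall>g\<in>carrier G. \<forall>b\<in>carrier (fibre B g).
          E (reg_rep G B g b) = (if g = \<one>\<^bsub>G\<^esub> then b else \<zero>\<^bsub>fibre B \<one>\<^bsub>G\<^esub>\<^esub>)))"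


section \<open>The Hilbert module Haagerup property\<close>

definition exp_module ::
  "'g monoid \<Rightarrow> ('g, 'b) bundle_data \<Rightarrow> ('b, ('g, 'b) l2_op) hilbert_module" where
  "exp_module G B =
    (let A = reduced_algebra G B; ip = (\<lambda>x y. cond_exp G B (adj A x \<otimes>\<^bsub>A\<^esub> y)) in
     \<lparr>carrier = carrier A,
      mult = undefined,
      one = undefined,
      zero = zero A,
      add = add A,
      smult = smult A,
      nrm = (\<lambda>x. sqrt (nrm (fibre B \<one>\<^bsub>G\<^esub>) (ip x x))),
      ract = (\<lambda>x b. x \<otimes>\<^bsub>A\<^esub> reg_rep G B \<one>\<^bsub>G\<^esub> b),
      inner = ip\<rparr>)"

definition H_module ::
  "'g monoid \<Rightarrow> ('g, 'b) bundle_data \<Rightarrow> ('b, (nat \<Rightarrow> ('g, 'b) l2_op) set) hilbert_module" where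
  "H_module G B = completion (unit_algebra G B) (exp_module G B)"

text \<open>
  The map \<open>\<Phi>\<close> on the reduced algebra induces the bounded map \<open>S\<close> on the completion; \<open>S\<close> is
  unique on the carrier, by density.
\<close>

definition induces ::
  "'g monoid \<Rightarrow> ('g, 'b) bundle_data \<Rightarrow> (('g, 'b) l2_op \<Rightarrow> ('g, 'b) l2_op) \<Rightarrow>
   ((nat \<Rightarrow> ('g, 'b) l2_op) set \<Rightarrow> (nat \<Rightarrow> ('g, 'b) l2_op) set) \<Rightarrow> bool" where
  "induces G B \<Phi> S \<longleftrightarrow>
     bounded_map (H_module G B) (H_module G B) S \<and>
     (\<forall>x\<in>carrier (reduced_algebra G B). S (embed (exp_module G B) x) = embed (exp_module G B) (\<Phi> x))"

text \<open>
  A net indexed by a directed set \<open>(I, R)\<close> converges iff it converges along \<open>tail_filter I R\<close>.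
\<close>

definition directed_set :: "'i set \<Rightarrow> ('i \<Rightarrow> 'i \<Rightarrow> bool) \<Rightarrow> bool" where
  "directed_set I R \<longleftrightarrow>
     I \<noteq> {} \<and> (\<forall>i\<in>I. R i i) \<and>
     (\<forall>i\<in>I. \<forall>j\<in>I. \<forall>k\<in>I. R i j \<longrightarrow> R j k \<longrightarrow> R i k) \<and>
     (\<forall>i\<in>I. \<forall>j\<in>I. \<exists>k\<in>I. R i k \<and> R j k)"

definition tail_filter :: "'i set \<Rightarrow> ('i \<Rightarrow> 'i \<Rightarrow> bool) \<Rightarrow> 'i filter" where
  "tail_filter I R = (INF i\<in>I. principal {j\<in>I. R i j})"

text \<open>
  Since HOL cannot quantify over the type of indices inside a formula, both approximation properties
  carry that type as an argument.
\<close>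

definition module_haagerup :: "'i itself \<Rightarrow> 'g monoid \<Rightarrow> ('g, 'b) bundle_data \<Rightarrow> bool" where
  "module_haagerup ty G B \<longleftrightarrow>
    (let A = reduced_algebra G B; D = unit_algebra G B; E = cond_exp G B; H = H_module G B in
     \<exists>(I :: 'i set) R \<Phi> \<Phi>'.
       directed_set I R \<and>
       (\<forall>i\<in>I. completely_positive A (\<Phi> i) \<and> bimodule_map G B (\<Phi> i)) \<and>
       (\<forall>i\<in>I. \<forall>x\<in>carrier A. positive A x \<longrightarrow> positive D (E x \<ominus>\<^bsub>D\<^esub> E (\<Phi> i x))) \<and>
       (\<forall>i\<in>I. induces G B (\<Phi> i) (\<Phi>' i)) \<and>
       bdd_above ((\<lambda>i. op_norm H H (\<Phi>' i)) ` I) \<and>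
       (\<forall>i\<in>I. compact_map H (\<Phi>' i)) \<and>
       (\<forall>x\<in>carrier A.
          ((\<lambda>i. nrm H (\<Phi>' i (embed (exp_module G B) x) \<ominus>\<^bsub>H\<^esub> embed (exp_module G B) x)) \<longlongrightarrow> 0)
            (tail_filter I R)))"


section \<open>The Haagerup PD-approximation property\<close>

definition bundle_map :: "'g monoid \<Rightarrow> ('g, 'b) bundle_data \<Rightarrow> ('g \<Rightarrow> 'b \<Rightarrow> 'b) \<Rightarrow> bool" where
  "bundle_map G B T \<longleftrightarrow> (\<forall>g\<in>carrier G. bounded_map (fibre B g) (fibre B g) (T g))"

definition positive_definite :: "'g monoid \<Rightarrow> ('g, 'b) bundle_data \<Rightarrow> ('g \<Rightarrow> 'b \<Rightarrow> 'b) \<Rightarrow> bool" where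
  "positive_definite G B T \<longleftrightarrow>
    (\<forall>(n::nat) g a b.
       (\<forall>i<n. g i \<in> carrier G \<and> a i \<in> carrier (fibre B (g i)) \<and> b i \<in> carrier (fibre B (g i))) \<longrightarrow>
       positive (unit_algebra G B)
         (\<Oplus>\<^bsub>unit_algebra G B\<^esub>i\<in>{..<n}. \<Oplus>\<^bsub>unit_algebra G B\<^esub>j\<in>{..<n}.
            (let k = inv\<^bsub>G\<^esub> (g i) \<otimes>\<^bsub>G\<^esub> g j;
                 x = T k (bmult B (inv\<^bsub>G\<^esub> (g i)) (g j) (bstar B (g i) (a i)) (a j))
             in bmult B (g j) (inv\<^bsub>G\<^esub> (g j)) (bmult B (g i) k (b i) x) (bstar B (g j) (b j)))))"

text \<open>The group is discrete, so vanishing at infinity is relative to finite subsets.\<close>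

definition vanishes_at_infinity :: "'g monoid \<Rightarrow> ('g \<Rightarrow> real) \<Rightarrow> bool" where
  "vanishes_at_infinity G f \<longleftrightarrow> (\<forall>\<epsilon>>0. finite {g \<in> carrier G. \<epsilon> \<le> \<bar>f g\<bar>})"

definition haagerup_PD :: "'i itself \<Rightarrow> 'g monoid \<Rightarrow> ('g, 'b) bundle_data \<Rightarrow> bool" where
  "haagerup_PD ty G B \<longleftrightarrow>
    (\<exists>(I :: 'i set) R T.
       directed_set I R \<and>
       (\<forall>i\<in>I. bundle_map G B (T i)) \<and>
       (\<forall>i\<in>I. positive_definite G B (T i) \<and>
              vanishes_at_infinity G (\<lambda>g. op_norm (fibre B g) (fibre B g) (T i g))) \<and>
       bdd_above ((\<lambda>i. op_norm (fibre B \<one>\<^bsub>G\<^esub>) (fibre B \<one>\<^bsub>G\<^esub>) (T i \<one>\<^bsub>G\<^esub>)) ` I) \<and>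
       (\<forall>g\<in>carrier G. \<forall>b\<in>carrier (fibre B g).
          ((\<lambda>i. nrm (fibre B g) (T i g b \<ominus>\<^bsub>fibre B g\<^esub> b)) \<longlongrightarrow> 0) (tail_filter I R)))"

end

theory Submission
  imports Defs
begin

text \<open>
  Write \<open>\<lambda>\<close> for \<open>reg_rep G B\<close>, \<open>\<Omega>\<close> for the unit section (value \<open>1\<close> at the unit of the group) in \<open>l2 G B\<close>, and
  \<open>X(g) \<in> B\<^sub>g\<close> for the coefficient at \<open>g\<close> of a vector \<open>X\<close> of \<open>l2 G B\<close>. A completely positive map \<open>\<Phi>\<close>
  of the reduced algebra yields the bundle map \<open>T\<^sub>g(b) = (\<Phi>(\<lambda>\<^sub>g(b)) \<Omega>)(g)\<close>, and the maps obtained from a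
  net witnessing the module Haagerup property witness the PD-approximation property. Three
  observations carry the proof.

  The conditional expectation is \<open>E(x) = \<langle>\<Omega>, x \<Omega>\<rangle>\<close> (\<open>cond_exp_eq\<close>), so \<open>x \<mapsto> x \<Omega>\<close> is isometric from the
  module norm of the reduced algebra to \<open>l2 G B\<close>, and taking coefficients is contractive. Hence
  \<open>\<parallel>T\<^sub>g(b)\<parallel>\<close> and \<open>\<parallel>T\<^sub>g(b) - b\<parallel>\<close> are at most the module norms of \<open>\<Phi>(\<lambda>\<^sub>g(b))\<close> and of
  \<open>\<Phi>(\<lambda>\<^sub>g(b)) - \<lambda>\<^sub>g(b)\<close>. This bounds \<open>T\<^sub>e\<close> uniformly and gives pointwise convergence
  (\<open>nrm_multiplier_le\<close>, \<open>nrm_multiplier_diff_le\<close>).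

  For \<open>x\<close> in the reduced algebra, \<open>a \<in> B\<^sub>g\<close> and \<open>c \<in> B\<^sub>h\<close>, the matrix coefficient of \<open>x\<close> between the
  sections with values \<open>a\<close> at \<open>g\<close> and \<open>c\<close> at \<open>h\<close> is \<open>a\<^sup>* (x \<Omega>)(g h\<^sup>-\<^sup>1) c\<close> (\<open>matrix_coeff\<close>). So the sum
  defining positive definiteness of \<open>T\<close> is \<open>\<Sum>\<^sub>i\<^sub>j \<langle>\<eta>\<^sub>i, \<Phi>(\<lambda>(a\<^sub>i)\<^sup>* \<lambda>(a\<^sub>j)) \<eta>\<^sub>j\<rangle>\<close> for suitable vectors
  \<open>\<eta>\<^sub>i\<close>, and the matrix of the operators \<open>\<Phi>(\<lambda>(a\<^sub>i)\<^sup>* \<lambda>(a\<^sub>j))\<close> is positive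
  (\<open>positive_definite_multiplier\<close>). The same formula shows that \<open>\<Omega>\<close> is separating for the reduced
  algebra, which makes \<open>E\<close> faithful (\<open>vac_separating\<close>).

  Finally, \<open>\<langle>\<eta>, \<lambda>\<^sub>g(b)\<rangle>\<close> is small relative to \<open>\<parallel>b\<parallel>\<close> for all but finitely many \<open>g\<close>, for each fixed
  vector \<open>\<eta>\<close>, because \<open>\<eta>\<close> is a limit of finitely supported sections. Thus finite rank maps, and then
  compact ones, are small on \<open>\<lambda>\<^sub>g(b)\<close> for \<open>g\<close> outside a finite set, and \<open>\<parallel>T\<^sub>g\<parallel>\<close> vanishes at infinity
  (\<open>vanishes_multiplier\<close>).

  Inequalities and sums in the unit fibre need that elements \<open>c\<^sup>* c\<close> of a C*-algebra are closed under
  sums and limits. This is proved without spectral theory: for a self-adjoint contraction \<open>a\<close>, an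
  explicit iteration converges to a square root of \<open>1 - a\<close> (\<open>sqrt_one_minus\<close>), and algebraic
  identities and norm estimates show that \<open>c\<^sup>* c\<close> is self-adjoint and within distance \<open>r\<close> of some
  number \<open>r \<ge> 0\<close> (\<open>pos_adj_mult\<close>), a condition which is evidently preserved by sums.
\<close>

section \<open>Normed spaces\<close>

lemma complex_ring_simps [simp]:
  "carrier complex_ring = UNIV" "mult complex_ring = (*)" "one complex_ring = 1"
  "zero complex_ring = 0" "add complex_ring = (+)"
  by (simp_all add: complex_ring_def)

lemma cring_complex_ring: "cring complex_ring"
proof (rule cringI)
  show "abelian_group complex_ring"
    by (rule abelian_groupI) (auto simp: algebra_simps intro: exI[of _ "- x" for x])
  show "comm_monoid complex_ring"
    by (rule comm_monoidI) (auto simp: algebra_simps)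
qed (auto simp: algebra_simps)

lemma normed_spaceI:
  fixes V :: "('v, 'm) normed_module_scheme" (structure)
  assumes add: "\<And>x y. x \<in> carrier V \<Longrightarrow> y \<in> carrier V \<Longrightarrow> x \<oplus> y \<in> carrier V"
    and zero: "\<zero> \<in> carrier V"
    and assoc: "\<And>x y z. x \<in> carrier V \<Longrightarrow> y \<in> carrier V \<Longrightarrow> z \<in> carrier V \<Longrightarrow> (x \<oplus> y) \<oplus> z = x \<oplus> (y \<oplus> z)"
    and comm: "\<And>x y. x \<in> carrier V \<Longrightarrow> y \<in> carrier V \<Longrightarrow> x \<oplus> y = y \<oplus> x"
    and l_zero: "\<And>x. x \<in> carrier V \<Longrightarrow> \<zero> \<oplus> x = x"
    and smult: "\<And>c x. x \<in> carrier V \<Longrightarrow> c \<odot> x \<in> carrier V"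
    and l_distr: "\<And>c d x. x \<in> carrier V \<Longrightarrow> (c + d) \<odot> x = c \<odot> x \<oplus> d \<odot> x"
    and r_distr: "\<And>c x y. x \<in> carrier V \<Longrightarrow> y \<in> carrier V \<Longrightarrow> c \<odot> (x \<oplus> y) = c \<odot> x \<oplus> c \<odot> y"
    and smult_assoc: "\<And>c d x. x \<in> carrier V \<Longrightarrow> (c * d) \<odot> x = c \<odot> (d \<odot> x)"
    and smult_one: "\<And>x. x \<in> carrier V \<Longrightarrow> 1 \<odot> x = x"
    and smult_zero: "\<And>x. x \<in> carrier V \<Longrightarrow> 0 \<odot> x = \<zero>"
    and nonneg: "\<And>x. x \<in> carrier V \<Longrightarrow> 0 \<le> nrm V x"
    and eq_0: "\<And>x. x \<in> carrier V \<Longrightarrow> nrm V x = 0 \<Longrightarrow> x = \<zero>"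
    and nrm_smult: "\<And>c x. x \<in> carrier V \<Longrightarrow> nrm V (c \<odot> x) = cmod c * nrm V x"
    and triangle: "\<And>x y. x \<in> carrier V \<Longrightarrow> y \<in> carrier V \<Longrightarrow> nrm V (x \<oplus> y) \<le> nrm V x + nrm V y"
  shows "normed_space V"
proof -
  have inv: "\<exists>y\<in>carrier V. y \<oplus> x = \<zero>" if "x \<in> carrier V" for x
  proof
    show "(- 1) \<odot> x \<oplus> x = \<zero>"
      using l_distr[of x "-1" 1] that by (simp add: smult_one smult_zero)
  qed (simp add: smult that)
  have "abelian_group V"
    by (rule abelian_groupI; (rule add zero assoc comm l_zero inv; assumption))
  then have "module complex_ring V"
    by (rule moduleI[OF cring_complex_ring])
      (simp_all add: smult l_distr r_distr smult_assoc smult_one)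
  moreover have "nrm V \<zero> = 0"
    using nrm_smult[of \<zero> 0] zero by (simp add: smult_zero)
  ultimately show ?thesis
    by (intro normed_space.intro normed_space_axioms.intro) (auto simp: nonneg eq_0 nrm_smult triangle)
qed

context normed_space
begin

lemma abelian_group_V: "abelian_group V" ..

lemma scale_closed [simp, intro]: "x \<in> carrier V \<Longrightarrow> c \<odot> x \<in> carrier V"
  by (rule smult_closed) auto

lemma scale_add_left: "x \<in> carrier V \<Longrightarrow> (c + d) \<odot> x = c \<odot> x \<oplus> d \<odot> x"
  using smult_l_distr[of c d x] by simp

lemma scale_add_right: "x \<in> carrier V \<Longrightarrow> y \<in> carrier V \<Longrightarrow> c \<odot> (x \<oplus> y) = c \<odot> x \<oplus> c \<odot> y"
  using smult_r_distr[of c x y] by simp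

lemma scale_scale [simp]: "x \<in> carrier V \<Longrightarrow> c \<odot> (d \<odot> x) = (c * d) \<odot> x"
  using smult_assoc1[of c d x] by simp

lemma scale_one [simp]: "x \<in> carrier V \<Longrightarrow> 1 \<odot> x = x"
  using smult_one[of x] by simp

lemma scale_0_left [simp]: "x \<in> carrier V \<Longrightarrow> 0 \<odot> x = \<zero>"
  using smult_l_null[of x] by simp

lemma scale_0_right [simp]: "c \<odot> \<zero> = \<zero>"
  using smult_r_null[of c] by simp

lemma neg_eq_scale: "x \<in> carrier V \<Longrightarrow> \<ominus> x = (- 1) \<odot> x"
proof -
  assume x: "x \<in> carrier V"
  have "(- 1) \<odot> x \<oplus> x = \<zero>"
    using scale_add_left[of x "-1" 1] x by simp
  then show ?thesis
    using x by (metis M.minus_equality scale_closed)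
qed

lemma scale_neg: "x \<in> carrier V \<Longrightarrow> c \<odot> (\<ominus> x) = \<ominus> (c \<odot> x)"
  by (simp add: neg_eq_scale)

lemma scale_diff: "x \<in> carrier V \<Longrightarrow> y \<in> carrier V \<Longrightarrow> c \<odot> (x \<ominus> y) = c \<odot> x \<ominus> c \<odot> y"
  by (simp add: a_minus_def scale_add_right scale_neg)

lemma scale_two: "x \<in> carrier V \<Longrightarrow> 2 \<odot> x = x \<oplus> x"
  using scale_add_left[of x 1 1] by simp

lemma minus_self [simp]: "x \<in> carrier V \<Longrightarrow> x \<ominus> x = \<zero>"
  by (simp add: a_minus_def M.r_neg)

lemma minus_zero_right [simp]: "x \<in> carrier V \<Longrightarrow> x \<ominus> \<zero> = x"
  by (simp add: a_minus_def neg_eq_scale)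

lemma diff_eq_zeroD: "x \<ominus> y = \<zero> \<Longrightarrow> x \<in> carrier V \<Longrightarrow> y \<in> carrier V \<Longrightarrow> x = y"
  by (simp add: a_minus_def M.minus_equality M.minus_minus M.add.inv_solve_right')

lemma diff_add_diff:
  "\<lbrakk>x \<in> carrier V; y \<in> carrier V; z \<in> carrier V\<rbrakk> \<Longrightarrow> (x \<ominus> y) \<oplus> (y \<ominus> z) = x \<ominus> z"
  by (simp add: a_minus_def M.a_ac M.r_neg1 M.r_neg2)

lemma minus_add_cancel: "\<lbrakk>x \<in> carrier V; y \<in> carrier V\<rbrakk> \<Longrightarrow> (x \<ominus> y) \<oplus> y = x"
  by (simp add: a_minus_def M.a_ac M.l_neg M.r_neg)

lemma add_minus_cancel: "\<lbrakk>x \<in> carrier V; y \<in> carrier V\<rbrakk> \<Longrightarrow> (x \<oplus> y) \<ominus> y = x"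
  by (simp add: a_minus_def M.a_assoc M.r_neg)

lemma add_diff_add:
  "\<lbrakk>x \<in> carrier V; y \<in> carrier V; z \<in> carrier V; w \<in> carrier V\<rbrakk>
    \<Longrightarrow> (x \<oplus> y) \<ominus> (z \<oplus> w) = (x \<ominus> z) \<oplus> (y \<ominus> w)"
  by (simp add: a_minus_def M.a_ac M.minus_add)

lemma neg_diff: "\<lbrakk>x \<in> carrier V; y \<in> carrier V\<rbrakk> \<Longrightarrow> \<ominus> (x \<ominus> y) = y \<ominus> x"
  by (simp add: a_minus_def M.a_ac M.minus_add M.minus_minus)

lemma minus_minus_cancel: "\<lbrakk>x \<in> carrier V; y \<in> carrier V\<rbrakk> \<Longrightarrow> x \<ominus> (x \<ominus> y) = y"
  by (simp add: a_minus_def M.minus_add M.minus_minus M.r_neg2)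

lemma nrm_zero [simp]: "nrm V \<zero> = 0"
  by (simp add: nrm_eq_0)

lemma nrm_neg [simp]: "x \<in> carrier V \<Longrightarrow> nrm V (\<ominus> x) = nrm V x"
  by (simp add: neg_eq_scale nrm_smult)

lemma nrm_diff_commute: "x \<in> carrier V \<Longrightarrow> y \<in> carrier V \<Longrightarrow> nrm V (x \<ominus> y) = nrm V (y \<ominus> x)"
  using nrm_neg[of "x \<ominus> y"] by (simp add: neg_diff)

lemma nrm_diff_le: "x \<in> carrier V \<Longrightarrow> y \<in> carrier V \<Longrightarrow> nrm V (x \<ominus> y) \<le> nrm V x + nrm V y"
  using nrm_triangle[of x "\<ominus> y"] by (simp add: a_minus_def)

lemma nrm_diff_triangle:
  "\<lbrakk>x \<in> carrier V; y \<in> carrier V; z \<in> carrier V\<rbrakk>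
    \<Longrightarrow> nrm V (x \<ominus> z) \<le> nrm V (x \<ominus> y) + nrm V (y \<ominus> z)"
  using nrm_triangle[of "x \<ominus> y" "y \<ominus> z"] by (simp add: diff_add_diff)

lemma nrm_diff_add_le:
  "\<lbrakk>x \<in> carrier V; y \<in> carrier V; z \<in> carrier V; w \<in> carrier V\<rbrakk>
    \<Longrightarrow> nrm V ((x \<oplus> y) \<ominus> (z \<oplus> w)) \<le> nrm V (x \<ominus> z) + nrm V (y \<ominus> w)"
  by (simp add: add_diff_add nrm_triangle)

lemma nrm_le_diff_add: "x \<in> carrier V \<Longrightarrow> y \<in> carrier V \<Longrightarrow> nrm V x \<le> nrm V (x \<ominus> y) + nrm V y"
  using nrm_triangle[of "x \<ominus> y" y] by (simp add: minus_add_cancel)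

lemma abs_nrm_diff_le:
  "x \<in> carrier V \<Longrightarrow> y \<in> carrier V \<Longrightarrow> \<bar>nrm V x - nrm V y\<bar> \<le> nrm V (x \<ominus> y)"
  using nrm_le_diff_add[of x y] nrm_le_diff_add[of y x] by (simp add: nrm_diff_commute)

lemma eq_by_nrm: "nrm V (x \<ominus> y) \<le> 0 \<Longrightarrow> x \<in> carrier V \<Longrightarrow> y \<in> carrier V \<Longrightarrow> x = y"
  using nrm_nonneg[of "x \<ominus> y"] nrm_eq_0[of "x \<ominus> y"] diff_eq_zeroD[of x y] by simp

lemma nrm_finsum_le:
  "finite S \<Longrightarrow> f \<in> S \<rightarrow> carrier V \<Longrightarrow> nrm V (\<Oplus>k\<in>S. f k) \<le> (\<Sum>k\<in>S. nrm V (f k))"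
proof (induction S rule: finite_induct)
  case (insert k S)
  then show ?case
    using nrm_triangle[of "f k" "\<Oplus>k\<in>S. f k"] by (force simp: M.finsum_insert)
qed simp

lemma converges_to_unique:
  assumes "converges_to V s x" "converges_to V s y"
  shows "x = y"
proof (rule eq_by_nrm)
  have c: "\<And>n. s n \<in> carrier V" "x \<in> carrier V" "y \<in> carrier V"
    using assms by (auto simp: converges_to_def)
  have "(\<lambda>n. nrm V (s n \<ominus> x) + nrm V (s n \<ominus> y)) \<longlonglongrightarrow> 0 + 0"
    using assms by (intro tendsto_add) (auto simp: converges_to_def)
  moreover have "nrm V (x \<ominus> y) \<le> nrm V (s n \<ominus> x) + nrm V (s n \<ominus> y)" for n
    using nrm_diff_triangle[of x "s n" y] nrm_diff_commute[of x "s n"] c by simp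
  ultimately show "nrm V (x \<ominus> y) \<le> 0"
    by (intro LIMSEQ_le_const) auto
qed (use assms in \<open>auto simp: converges_to_def\<close>)

lemma converges_to_squeeze:
  assumes "\<And>n. s n \<in> carrier V" "x \<in> carrier V" "\<And>n. nrm V (s n \<ominus> x) \<le> b n" "b \<longlonglongrightarrow> 0"
  shows "converges_to V s x"
  unfolding converges_to_def
proof (intro conjI allI)
  show "(\<lambda>n. nrm V (s n \<ominus> x)) \<longlonglongrightarrow> 0"
    by (rule tendsto_sandwich[OF _ _ tendsto_const assms(4)])
      (use assms nrm_nonneg in \<open>auto intro!: always_eventually\<close>)
qed (use assms in auto)

lemma converges_to_const: "x \<in> carrier V \<Longrightarrow> converges_to V (\<lambda>n. x) x"
  by (simp add: converges_to_def)

lemma converges_to_add: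
  assumes "converges_to V s x" "converges_to V t y"
  shows "converges_to V (\<lambda>n. s n \<oplus> t n) (x \<oplus> y)"
proof (rule converges_to_squeeze)
  show "(\<lambda>n. nrm V (s n \<ominus> x) + nrm V (t n \<ominus> y)) \<longlonglongrightarrow> 0"
    using assms tendsto_add[of "\<lambda>n. nrm V (s n \<ominus> x)" 0 sequentially "\<lambda>n. nrm V (t n \<ominus> y)" 0]
    by (auto simp: converges_to_def)
qed (use assms in \<open>auto simp: converges_to_def intro!: nrm_diff_add_le\<close>)

lemma converges_to_scale:
  assumes "converges_to V s x"
  shows "converges_to V (\<lambda>n. c \<odot> s n) (c \<odot> x)"
proof (rule converges_to_squeeze)
  show "(\<lambda>n. cmod c * nrm V (s n \<ominus> x)) \<longlonglongrightarrow> 0"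
    using assms by (auto simp: converges_to_def intro: tendsto_mult_right_zero)
  fix n
  have "s n \<in> carrier V" "x \<in> carrier V"
    using assms by (auto simp: converges_to_def)
  then show "nrm V (c \<odot> s n \<ominus> c \<odot> x) \<le> cmod c * nrm V (s n \<ominus> x)"
    by (simp flip: scale_diff add: nrm_smult)
qed (use assms in \<open>auto simp: converges_to_def\<close>)

lemma tendsto_nrm:
  assumes "converges_to V s x"
  shows "(\<lambda>n. nrm V (s n)) \<longlonglongrightarrow> nrm V x"
proof -
  have "(\<lambda>n. \<bar>nrm V (s n) - nrm V x\<bar>) \<longlonglongrightarrow> 0"
    by (rule tendsto_sandwich[of "\<lambda>n. 0" _ _ "\<lambda>n. nrm V (s n \<ominus> x)"])
      (use assms abs_nrm_diff_le in \<open>auto simp: converges_to_def\<close>)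
  then have "(\<lambda>n. nrm V (s n) - nrm V x) \<longlonglongrightarrow> 0"
    by (rule tendsto_rabs_zero_cancel)
  then show ?thesis
    by (simp add: LIM_zero_iff)
qed

end

section \<open>Linear maps and operator norms\<close>

lemma op_norm_upper_unit:
  assumes "\<And>x. x \<in> carrier V \<Longrightarrow> nrm W (T x) \<le> K * nrm V x" "x \<in> carrier V" "nrm V x \<le> 1"
    and nonneg: "\<And>x. x \<in> carrier V \<Longrightarrow> 0 \<le> nrm V x"
  shows "nrm W (T x) \<le> op_norm V W T"
  unfolding op_norm_def
proof (rule cSup_upper)
  have "nrm W (T y) \<le> \<bar>K\<bar>" if "y \<in> carrier V" "nrm V y \<le> 1" for y
  proof -
    have "nrm W (T y) \<le> K * nrm V y" by (rule assms(1)[OF that(1)])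
    also have "\<dots> \<le> \<bar>K\<bar> * 1"
      using that nonneg[OF that(1)] by (intro mult_mono) auto
    finally show ?thesis by simp
  qed
  then show "bdd_above {nrm W (T x) |x. x \<in> carrier V \<and> nrm V x \<le> 1}"
    by (auto intro!: bdd_aboveI[of _ "\<bar>K\<bar>"])
qed (use assms in auto)

lemma linear_mapD:
  assumes "linear_map V W T"
  shows "x \<in> carrier V \<Longrightarrow> T x \<in> carrier W"
    and "x \<in> carrier V \<Longrightarrow> y \<in> carrier V \<Longrightarrow> T (x \<oplus>\<^bsub>V\<^esub> y) = T x \<oplus>\<^bsub>W\<^esub> T y"
    and "x \<in> carrier V \<Longrightarrow> T (c \<odot>\<^bsub>V\<^esub> x) = c \<odot>\<^bsub>W\<^esub> T x"
  using assms by (auto simp: linear_map_def)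

lemma op_norm_bound:
  assumes V: "normed_space V" and W: "normed_space W" and T: "bounded_map V W T" and x: "x \<in> carrier V"
  shows "nrm W (T x) \<le> op_norm V W T * nrm V x"
proof -
  interpret V: normed_space V by (rule V)
  interpret W: normed_space W by (rule W)
  obtain K where K: "\<And>x. x \<in> carrier V \<Longrightarrow> nrm W (T x) \<le> K * nrm V x"
    using T by (auto simp: bounded_map_def)
  have lin: "linear_map V W T"
    using T by (simp add: bounded_map_def)
  note Tc = linear_mapD(1)[OF lin x] and Ts = linear_mapD(3)[OF lin x]
  show ?thesis
  proof (cases "nrm V x = 0")
    case True
    then show ?thesis using K[OF x] by simp
  next
    case False
    then have N: "nrm V x > 0" using V.nrm_nonneg[OF x] by simp
    let ?c = "complex_of_real (1 / nrm V x)"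
    have "nrm W (T (?c \<odot>\<^bsub>V\<^esub> x)) \<le> op_norm V W T"
      by (rule op_norm_upper_unit[OF K]) (use x N V.nrm_nonneg in \<open>auto simp: V.nrm_smult norm_divide\<close>)
    then show ?thesis
      using N Tc by (simp add: Ts W.nrm_smult norm_divide field_simps)
  qed
qed

lemma op_norm_least:
  assumes "normed_space V" "\<And>x. x \<in> carrier V \<Longrightarrow> nrm V x \<le> 1 \<Longrightarrow> nrm W (T x) \<le> K"
  shows "op_norm V W T \<le> K"
proof -
  interpret V: normed_space V by fact
  have "\<exists>x. x \<in> carrier V \<and> nrm V x \<le> 1"
    by (rule exI[of _ "\<zero>\<^bsub>V\<^esub>"]) simp
  then show ?thesis
    unfolding op_norm_def using assms(2) by (intro cSup_least) auto
qed

lemma op_norm_nonneg: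
  assumes V: "normed_space V" and W: "normed_space W" and T: "bounded_map V W T"
  shows "0 \<le> op_norm V W T"
proof -
  interpret V: normed_space V by (rule V)
  interpret W: normed_space W by (rule W)
  have "nrm W (T \<zero>\<^bsub>V\<^esub>) \<le> op_norm V W T"
    using T by (auto simp: bounded_map_def intro: op_norm_upper_unit[OF _ _ _ V.nrm_nonneg])
  moreover have "T \<zero>\<^bsub>V\<^esub> \<in> carrier W"
    using T V.zero_closed by (auto simp: bounded_map_def linear_map_def)
  ultimately show ?thesis
    using W.nrm_nonneg[of "T \<zero>\<^bsub>V\<^esub>"] by linarith
qed

lemma linear_map_diff:
  assumes "normed_space V" "normed_space W" "linear_map V W T" "x \<in> carrier V" "y \<in> carrier V"
  shows "T (x \<ominus>\<^bsub>V\<^esub> y) = T x \<ominus>\<^bsub>W\<^esub> T y"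
proof -
  interpret V: normed_space V by fact
  interpret W: normed_space W by fact
  show ?thesis
    using assms(4,5) by (simp add: a_minus_def V.neg_eq_scale W.neg_eq_scale linear_mapD[OF assms(3)])
qed

lemma linear_map_minus:
  assumes "normed_space W" "linear_map V W f" "linear_map V W h"
  shows "linear_map V W (\<lambda>x. f x \<ominus>\<^bsub>W\<^esub> h x)"
proof -
  interpret W: normed_space W by fact
  show ?thesis
    unfolding linear_map_def
    using linear_mapD[OF assms(2)] linear_mapD[OF assms(3)] by (auto simp: W.add_diff_add W.scale_diff)
qed

lemma linear_map_comp:
  "linear_map U V f \<Longrightarrow> linear_map V W h \<Longrightarrow> linear_map U W (\<lambda>x. h (f x))"
  unfolding linear_map_def by (auto simp: Pi_def)

lemma converges_to_linear_map:
  assumes V: "normed_space V" and W: "normed_space W" and T: "linear_map V W T"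
    and K: "\<And>x. x \<in> carrier V \<Longrightarrow> nrm W (T x) \<le> K * nrm V x" and s: "converges_to V s x"
  shows "converges_to W (\<lambda>n. T (s n)) (T x)"
proof -
  interpret V: normed_space V by (rule V)
  interpret W: normed_space W by (rule W)
  have c: "\<And>n. s n \<in> carrier V" "x \<in> carrier V"
    using s by (auto simp: converges_to_def)
  show ?thesis
  proof (rule W.converges_to_squeeze)
    show "nrm W (T (s n) \<ominus>\<^bsub>W\<^esub> T x) \<le> K * nrm V (s n \<ominus>\<^bsub>V\<^esub> x)" for n
      using K[of "s n \<ominus>\<^bsub>V\<^esub> x"] c by (simp add: linear_map_diff[OF V W T])
    show "(\<lambda>n. K * nrm V (s n \<ominus>\<^bsub>V\<^esub> x)) \<longlonglongrightarrow> 0"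
      using s by (intro tendsto_mult_right_zero) (simp add: converges_to_def)
  qed (use c linear_mapD(1)[OF T] in auto)
qed

section \<open>Positive elements of a unital C*-algebra\<close>

text \<open>
  A unital C*-algebra over a carrier set. The zero algebra is not excluded, so \<open>1\<close> has norm \<open>0\<close> or
  \<open>1\<close>.
\<close>

locale unital_cstar = banach_space D + ring D
  for D :: "('a, 'm) star_algebra_scheme" (structure) +
  assumes scale_mult_left: "x \<in> carrier D \<Longrightarrow> y \<in> carrier D \<Longrightarrow> (c \<odot> x) \<otimes> y = c \<odot> (x \<otimes> y)"
    and scale_mult_right: "x \<in> carrier D \<Longrightarrow> y \<in> carrier D \<Longrightarrow> x \<otimes> (c \<odot> y) = c \<odot> (x \<otimes> y)"
    and nrm_mult: "x \<in> carrier D \<Longrightarrow> y \<in> carrier D \<Longrightarrow> nrm D (x \<otimes> y) \<le> nrm D x * nrm D y"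
    and adj_closed [simp, intro]: "x \<in> carrier D \<Longrightarrow> adj D x \<in> carrier D"
    and adj_adj [simp]: "x \<in> carrier D \<Longrightarrow> adj D (adj D x) = x"
    and adj_add: "x \<in> carrier D \<Longrightarrow> y \<in> carrier D \<Longrightarrow> adj D (x \<oplus> y) = adj D x \<oplus> adj D y"
    and adj_scale: "x \<in> carrier D \<Longrightarrow> adj D (c \<odot> x) = cnj c \<odot> adj D x"
    and adj_mult: "x \<in> carrier D \<Longrightarrow> y \<in> carrier D \<Longrightarrow> adj D (x \<otimes> y) = adj D y \<otimes> adj D x"
    and nrm_adj [simp]: "x \<in> carrier D \<Longrightarrow> nrm D (adj D x) = nrm D x"
    and nrm_adj_mult: "x \<in> carrier D \<Longrightarrow> nrm D (adj D x \<otimes> x) = (nrm D x)\<^sup>2"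
begin

lemma adj_zero [simp]: "adj D \<zero> = \<zero>"
  using adj_scale[of \<zero> 0] by simp

lemma adj_neg: "x \<in> carrier D \<Longrightarrow> adj D (\<ominus> x) = \<ominus> adj D x"
  by (simp add: neg_eq_scale adj_scale)

lemma adj_diff: "x \<in> carrier D \<Longrightarrow> y \<in> carrier D \<Longrightarrow> adj D (x \<ominus> y) = adj D x \<ominus> adj D y"
  by (simp add: a_minus_def adj_add adj_neg)

lemma adj_one [simp]: "adj D \<one> = \<one>"
proof -
  have "adj D \<one> = adj D (adj D \<one> \<otimes> \<one>)"
    by (subst adj_mult) auto
  then show ?thesis
    by simp
qed

lemma nrm_one_le: "nrm D \<one> \<le> 1"
proof -
  have "(nrm D \<one>)\<^sup>2 = nrm D \<one>"
    using nrm_adj_mult[of \<one>] by simp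
  then show ?thesis
    by (auto simp: power2_eq_square)
qed

lemma nrm_square: "x \<in> carrier D \<Longrightarrow> adj D x = x \<Longrightarrow> nrm D (x \<otimes> x) = (nrm D x)\<^sup>2"
  using nrm_adj_mult[of x] by simp

lemma converges_to_mult_left:
  assumes "converges_to D s x" "y \<in> carrier D"
  shows "converges_to D (\<lambda>n. y \<otimes> s n) (y \<otimes> x)"
proof (rule converges_to_squeeze)
  have c: "s n \<in> carrier D" "x \<in> carrier D" for n
    using assms by (auto simp: converges_to_def)
  then show "y \<otimes> s n \<in> carrier D" "y \<otimes> x \<in> carrier D" for n
    using assms by auto
  show "nrm D (y \<otimes> s n \<ominus> y \<otimes> x) \<le> nrm D y * nrm D (s n \<ominus> x)" for n
    using nrm_mult[of y "s n \<ominus> x"] c assms by (simp add: a_minus_def r_distr r_minus)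
  show "(\<lambda>n. nrm D y * nrm D (s n \<ominus> x)) \<longlonglongrightarrow> 0"
    using assms by (auto simp: converges_to_def intro: tendsto_mult_right_zero)
qed

lemma converges_to_adj:
  assumes "converges_to D s x"
  shows "converges_to D (\<lambda>n. adj D (s n)) (adj D x)"
proof (rule converges_to_squeeze)
  have c: "s n \<in> carrier D" "x \<in> carrier D" for n
    using assms by (auto simp: converges_to_def)
  then show "adj D (s n) \<in> carrier D" "adj D x \<in> carrier D" for n
    by auto
  show "nrm D (adj D (s n) \<ominus> adj D x) \<le> nrm D (s n \<ominus> x)" for n
    using c by (simp flip: adj_diff)
  show "(\<lambda>n. nrm D (s n \<ominus> x)) \<longlonglongrightarrow> 0"
    using assms by (auto simp: converges_to_def)
qed

lemma converges_to_mult_right: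
  assumes "converges_to D s x" "y \<in> carrier D"
  shows "converges_to D (\<lambda>n. s n \<otimes> y) (x \<otimes> y)"
proof (rule converges_to_squeeze)
  have c: "s n \<in> carrier D" "x \<in> carrier D" for n
    using assms by (auto simp: converges_to_def)
  then show "s n \<otimes> y \<in> carrier D" "x \<otimes> y \<in> carrier D" for n
    using assms by auto
  show "nrm D (s n \<otimes> y \<ominus> x \<otimes> y) \<le> nrm D (s n \<ominus> x) * nrm D y" for n
    using nrm_mult[of "s n \<ominus> x" y] c assms by (simp add: a_minus_def l_distr l_minus)
  show "(\<lambda>n. nrm D (s n \<ominus> x) * nrm D y) \<longlonglongrightarrow> 0"
    using assms by (auto simp: converges_to_def intro: tendsto_mult_left_zero)
qed

lemma converges_to_square:
  assumes "converges_to D s x"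
  shows "converges_to D (\<lambda>n. s n \<otimes> s n) (x \<otimes> x)"
proof (rule converges_to_squeeze)
  have c: "s n \<in> carrier D" "x \<in> carrier D" for n
    using assms by (auto simp: converges_to_def)
  then show "s n \<otimes> s n \<in> carrier D" "x \<otimes> x \<in> carrier D" for n
    by auto
  show "nrm D (s n \<otimes> s n \<ominus> x \<otimes> x) \<le> nrm D (s n) * nrm D (s n \<ominus> x) + nrm D (s n \<ominus> x) * nrm D x" for n
  proof -
    have "s n \<otimes> s n \<ominus> x \<otimes> x = s n \<otimes> (s n \<ominus> x) \<oplus> (s n \<ominus> x) \<otimes> x"
      using c by algebra
    then show ?thesis
      using nrm_triangle[of "s n \<otimes> (s n \<ominus> x)" "(s n \<ominus> x) \<otimes> x"]
        nrm_mult[of "s n" "s n \<ominus> x"] nrm_mult[of "s n \<ominus> x" x] c by simp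
  qed
  have "(\<lambda>n. nrm D (s n) * nrm D (s n \<ominus> x) + nrm D (s n \<ominus> x) * nrm D x)
      \<longlonglongrightarrow> nrm D x * 0 + 0 * nrm D x"
    using assms by (intro tendsto_intros tendsto_nrm) (auto simp: converges_to_def)
  then show "(\<lambda>n. nrm D (s n) * nrm D (s n \<ominus> x) + nrm D (s n \<ominus> x) * nrm D x) \<longlonglongrightarrow> 0"
    by simp
qed

text \<open>
  The iteration \<open>y \<mapsto> (a + y\<^sup>2) / 2\<close>, started at \<open>0\<close>, converges to \<open>1 - \<surd>(1 - a)\<close> for
  self-adjoint contractions \<open>a\<close>: it is dominated by the same iteration for the number \<open>1\<close>.
\<close>

primrec sqrt_iter :: "'a \<Rightarrow> nat \<Rightarrow> 'a" where
  "sqrt_iter a 0 = \<zero>"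
| "sqrt_iter a (Suc n) = (1 / 2) \<odot> (a \<oplus> sqrt_iter a n \<otimes> sqrt_iter a n)"

end

primrec unit_iter :: "nat \<Rightarrow> real" where
  "unit_iter 0 = 0"
| "unit_iter (Suc n) = (1 + (unit_iter n)\<^sup>2) / 2"

lemma unit_iter_bounds: "0 \<le> unit_iter n \<and> unit_iter n \<le> 1"
  by (induction n) (auto simp: power2_eq_square mult_le_one)

lemma incseq_unit_iter: "incseq unit_iter"
proof (rule incseq_SucI)
  show "unit_iter n \<le> unit_iter (Suc n)" for n
    using zero_le_power2[of "unit_iter n - 1"] by (simp add: power2_diff)
qed

lemma Cauchy_unit_iter: "Cauchy unit_iter"
proof -
  have "Bseq unit_iter"
    using unit_iter_bounds by (intro BseqI'[of _ 1]) simp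
  then show ?thesis
    using incseq_unit_iter unfolding incseq_def
    by (intro convergent_Cauchy Bseq_mono_convergent)
qed

context unital_cstar
begin

lemma sqrt_iter_closed: "a \<in> carrier D \<Longrightarrow> sqrt_iter a n \<in> carrier D"
  by (induction n) auto

lemma nrm_sqrt_iter:
  assumes a: "a \<in> carrier D" "nrm D a \<le> 1"
  shows "nrm D (sqrt_iter a n) \<le> unit_iter n"
proof (induction n)
  case (Suc n)
  let ?y = "sqrt_iter a n"
  have y: "?y \<in> carrier D" by (rule sqrt_iter_closed[OF a(1)])
  have "nrm D (?y \<otimes> ?y) \<le> nrm D ?y * nrm D ?y"
    by (rule nrm_mult[OF y y])
  also have "\<dots> \<le> (unit_iter n)\<^sup>2"
    using Suc nrm_nonneg[OF y] by (simp add: power2_eq_square mult_mono)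
  finally show ?case
    using nrm_triangle[of a "?y \<otimes> ?y"] a y by (simp add: nrm_smult)
qed simp

lemma nrm_sqrt_iter_diff:
  assumes a: "a \<in> carrier D" "nrm D a \<le> 1"
  shows "nrm D (sqrt_iter a (Suc n) \<ominus> sqrt_iter a n) \<le> unit_iter (Suc n) - unit_iter n"
proof (induction n)
  case 0
  then show ?case using a by (simp add: nrm_smult)
next
  case (Suc n)
  define y z where "y = sqrt_iter a (Suc n)" and "z = sqrt_iter a n"
  have y: "y \<in> carrier D" and z: "z \<in> carrier D"
    unfolding y_def z_def by (rule sqrt_iter_closed[OF a(1)])+
  have ny: "nrm D y \<le> unit_iter (Suc n)" and nz: "nrm D z \<le> unit_iter n"
    unfolding y_def z_def by (rule nrm_sqrt_iter[OF a])+
  have IH: "nrm D (y \<ominus> z) \<le> unit_iter (Suc n) - unit_iter n"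
    using Suc unfolding y_def z_def .
  have "sqrt_iter a (Suc (Suc n)) \<ominus> y = (1/2) \<odot> (a \<oplus> y \<otimes> y) \<ominus> (1/2) \<odot> (a \<oplus> z \<otimes> z)"
    by (simp add: y_def z_def)
  also have "\<dots> = (1/2) \<odot> ((a \<oplus> y \<otimes> y) \<ominus> (a \<oplus> z \<otimes> z))"
    using a y z by (simp add: scale_diff)
  also have "(a \<oplus> y \<otimes> y) \<ominus> (a \<oplus> z \<otimes> z) = y \<otimes> (y \<ominus> z) \<oplus> (y \<ominus> z) \<otimes> z"
    using a y z by algebra
  finally have eq: "sqrt_iter a (Suc (Suc n)) \<ominus> y = (1/2) \<odot> (y \<otimes> (y \<ominus> z) \<oplus> (y \<ominus> z) \<otimes> z)" .
  have "nrm D (y \<otimes> (y \<ominus> z) \<oplus> (y \<ominus> z) \<otimes> z) \<le> nrm D y * nrm D (y \<ominus> z) + nrm D (y \<ominus> z) * nrm D z"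
    using nrm_triangle[of "y \<otimes> (y \<ominus> z)" "(y \<ominus> z) \<otimes> z"] nrm_mult[of y "y \<ominus> z"]
      nrm_mult[of "y \<ominus> z" z] y z by simp
  also have "\<dots> = (nrm D y + nrm D z) * nrm D (y \<ominus> z)"
    by (simp add: algebra_simps)
  also have "\<dots> \<le> (unit_iter (Suc n) + unit_iter n) * (unit_iter (Suc n) - unit_iter n)"
    using ny nz IH y z nrm_nonneg[of y] nrm_nonneg[of z] nrm_nonneg[of "y \<ominus> z"]
    by (intro mult_mono) (auto simp del: unit_iter.simps)
  also have "\<dots> = 2 * (unit_iter (Suc (Suc n)) - unit_iter (Suc n))"
    by (simp only: unit_iter.simps(2)[of "Suc n"] unit_iter.simps(2)[of n]) (simp add: field_simps power2_eq_square)
  finally show ?case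
    unfolding y_def[symmetric] eq using y z
    by (simp add: nrm_smult del: unit_iter.simps sqrt_iter.simps)
qed

lemma cauchy_sqrt_iter:
  assumes a: "a \<in> carrier D" "nrm D a \<le> 1"
  shows "cauchy_seq D (sqrt_iter a)"
proof -
  have le: "nrm D (sqrt_iter a (m + k) \<ominus> sqrt_iter a m) \<le> unit_iter (m + k) - unit_iter m" for m k
  proof (induction k)
    case (Suc k)
    then show ?case
      using nrm_diff_triangle[of "sqrt_iter a (m + Suc k)" "sqrt_iter a (m + k)" "sqrt_iter a m"]
        nrm_sqrt_iter_diff[OF a, of "m + k"] sqrt_iter_closed[OF a(1)]
      by (simp del: sqrt_iter.simps unit_iter.simps)
  qed (simp add: sqrt_iter_closed[OF a(1)])
  have "nrm D (sqrt_iter a m \<ominus> sqrt_iter a n) \<le> \<bar>unit_iter m - unit_iter n\<bar>" for m n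
  proof (cases "n \<le> m")
    case True
    then show ?thesis using le[of n "m - n"] by simp
  next
    case False
    then show ?thesis
      using le[of m "n - m"] nrm_diff_commute[of "sqrt_iter a m" "sqrt_iter a n"] sqrt_iter_closed[OF a(1)]
      by simp
  qed
  then show ?thesis
    using Cauchy_unit_iter sqrt_iter_closed[OF a(1)]
    unfolding cauchy_seq_def Cauchy_def dist_real_def by (meson order_le_less_trans)
qed

lemma sqrt_one_minus:
  assumes a: "a \<in> carrier D" "adj D a = a" "nrm D a \<le> 1"
  obtains s where "s \<in> carrier D" "adj D s = s" "s \<otimes> s = \<one> \<ominus> a" "nrm D (\<one> \<ominus> s) \<le> 1"
    "\<And>b. b \<in> carrier D \<Longrightarrow> a \<otimes> b = b \<otimes> a \<Longrightarrow> s \<otimes> b = b \<otimes> s"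
proof -
  obtain y where lim: "converges_to D (sqrt_iter a) y"
    using complete[OF cauchy_sqrt_iter[OF a(1,3)]] by blast
  have y: "y \<in> carrier D" and iter: "\<And>n. sqrt_iter a n \<in> carrier D"
    using lim by (auto simp: converges_to_def)
  have "converges_to D (\<lambda>n. sqrt_iter a (Suc n)) ((1/2) \<odot> (a \<oplus> y \<otimes> y))"
    unfolding sqrt_iter.simps
    by (intro converges_to_scale converges_to_add converges_to_const converges_to_square lim a)
  moreover have "converges_to D (\<lambda>n. sqrt_iter a (Suc n)) y"
    using lim LIMSEQ_Suc[of "\<lambda>n. nrm D (sqrt_iter a n \<ominus> y)"] unfolding converges_to_def by blast
  ultimately have fixp: "y = (1/2) \<odot> (a \<oplus> y \<otimes> y)"
    by (rule converges_to_unique[rotated])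
  then have "2 \<odot> y = 2 \<odot> ((1/2) \<odot> (a \<oplus> y \<otimes> y))" by (rule arg_cong)
  then have yy: "y \<oplus> y = a \<oplus> y \<otimes> y"
    using a y by (simp add: scale_two)
  have "(u \<ominus> y) \<otimes> (u \<ominus> y) = (u \<otimes> u \<oplus> y \<otimes> y) \<ominus> (u \<otimes> y \<oplus> y \<otimes> u)" if "u \<in> carrier D" for u
    using that y by algebra
  from this[of \<one>] have "(\<one> \<ominus> y) \<otimes> (\<one> \<ominus> y) = (\<one> \<oplus> y \<otimes> y) \<ominus> (y \<oplus> y)"
    using y by simp
  also have "\<dots> = \<one> \<ominus> a"
    unfolding yy using y a by algebra
  finally have sq: "(\<one> \<ominus> y) \<otimes> (\<one> \<ominus> y) = \<one> \<ominus> a" .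
  have "adj D (sqrt_iter a n) = sqrt_iter a n" for n
    by (induction n) (use a iter in \<open>auto simp: adj_scale adj_add adj_mult\<close>)
  then have sa: "adj D y = y"
    using converges_to_adj[OF lim] lim by (auto intro: converges_to_unique)
  have "nrm D (sqrt_iter a n) \<le> 1" for n
    using nrm_sqrt_iter[OF a(1,3), of n] unit_iter_bounds[of n] by simp
  then have "nrm D y \<le> 1"
    using tendsto_nrm[OF lim] by (intro LIMSEQ_le_const2) auto
  moreover have "\<one> \<ominus> (\<one> \<ominus> y) = y"
    using y by algebra
  ultimately have n1: "nrm D (\<one> \<ominus> (\<one> \<ominus> y)) \<le> 1" by simp
  have comm: "(\<one> \<ominus> y) \<otimes> b = b \<otimes> (\<one> \<ominus> y)" if b: "b \<in> carrier D" "a \<otimes> b = b \<otimes> a" for b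
  proof -
    have "sqrt_iter a n \<otimes> b = b \<otimes> sqrt_iter a n" for n
    proof (induction n)
      case (Suc n)
      let ?y = "sqrt_iter a n"
      have "?y \<otimes> ?y \<otimes> b = b \<otimes> (?y \<otimes> ?y)"
        using Suc iter[of n] b by (metis m_assoc)
      then show ?case
        using iter[of n] a b by (simp add: scale_mult_left scale_mult_right l_distr r_distr)
    qed (use b in simp)
    then have "y \<otimes> b = b \<otimes> y"
      using converges_to_mult_left[OF lim b(1)] converges_to_mult_right[OF lim b(1)]
      by (auto intro: converges_to_unique)
    then show ?thesis
      using y b by (simp add: a_minus_def l_distr r_distr l_minus r_minus)
  qed
  show thesis
    by (rule that[of "\<one> \<ominus> y"]) (use y sa sq n1 comm in \<open>auto simp: adj_diff\<close>)
qed

text \<open>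
  Self-adjoint elements within distance \<open>r\<close> of some number \<open>r \<ge> 0\<close>:
  an intrinsic description of positivity which makes closure under sums evident; it is shown
  below to agree with being of the form \<open>c\<^sup>* c\<close>.
\<close>

definition pos :: "'a \<Rightarrow> bool" where
  "pos h \<longleftrightarrow> h \<in> carrier D \<and> adj D h = h \<and> (\<exists>r\<ge>0. nrm D (complex_of_real r \<odot> \<one> \<ominus> h) \<le> r)"

lemma pos_closed: "pos h \<Longrightarrow> h \<in> carrier D" and pos_adj: "pos h \<Longrightarrow> adj D h = h"
  by (auto simp: pos_def)

lemma pos_zero: "pos \<zero>"
  unfolding pos_def by (auto intro!: exI[of _ 0])

lemma pos_add:
  assumes "pos h" "pos k"
  shows "pos (h \<oplus> k)"
proof -
  obtain r t where r: "0 \<le> r" "nrm D (complex_of_real r \<odot> \<one> \<ominus> h) \<le> r"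
    and t: "0 \<le> t" "nrm D (complex_of_real t \<odot> \<one> \<ominus> k) \<le> t"
    using assms unfolding pos_def by blast
  have "nrm D (complex_of_real (r + t) \<odot> \<one> \<ominus> (h \<oplus> k)) \<le> r + t"
    using nrm_diff_add_le[of "complex_of_real r \<odot> \<one>" "complex_of_real t \<odot> \<one>" h k] r t
      pos_closed[OF assms(1)] pos_closed[OF assms(2)] by (simp add: scale_add_left)
  then show ?thesis
    using assms r t unfolding pos_def by (auto simp: adj_add intro!: exI[of _ "r + t"])
qed

lemma pos_scale:
  assumes "pos h" "0 \<le> c"
  shows "pos (complex_of_real c \<odot> h)"
proof -
  obtain r where r: "0 \<le> r" "nrm D (complex_of_real r \<odot> \<one> \<ominus> h) \<le> r"
    using assms unfolding pos_def by blast
  have "complex_of_real (c * r) \<odot> \<one> \<ominus> complex_of_real c \<odot> h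
      = complex_of_real c \<odot> (complex_of_real r \<odot> \<one> \<ominus> h)"
    using pos_closed[OF assms(1)] by (simp add: scale_diff)
  then have "nrm D (complex_of_real (c * r) \<odot> \<one> \<ominus> complex_of_real c \<odot> h) \<le> c * r"
    using pos_closed[OF assms(1)] assms r by (simp add: nrm_smult mult_left_mono)
  then show ?thesis
    using assms r unfolding pos_def by (auto simp: adj_scale intro!: exI[of _ "c * r"])
qed

lemma pos_sqrt:
  assumes "pos h"
  obtains q where "pos q" "q \<otimes> q = h" "\<And>b. b \<in> carrier D \<Longrightarrow> h \<otimes> b = b \<otimes> h \<Longrightarrow> q \<otimes> b = b \<otimes> q"
proof -
  obtain r where r: "0 \<le> r" "nrm D (complex_of_real r \<odot> \<one> \<ominus> h) \<le> r"
    using assms unfolding pos_def by blast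
  note h = pos_closed[OF assms]
  show thesis
  proof (cases "r = 0")
    case True
    then have "\<zero> = h"
      using r h eq_by_nrm[of \<zero> h] by simp
    then show ?thesis
      by (intro that[of \<zero>]) (auto simp: pos_zero)
  next
    case False
    define a where "a = \<one> \<ominus> complex_of_real (1 / r) \<odot> h"
    have a: "a \<in> carrier D" "adj D a = a"
      using h pos_adj[OF assms] by (auto simp: a_def adj_diff adj_scale)
    have "a = complex_of_real (1 / r) \<odot> (complex_of_real r \<odot> \<one> \<ominus> h)"
      using False h by (simp add: a_def scale_diff)
    then have "nrm D a \<le> 1"
      using r False h by (simp add: nrm_smult norm_divide)
    then obtain s where s: "s \<in> carrier D" "adj D s = s" "s \<otimes> s = \<one> \<ominus> a" "nrm D (\<one> \<ominus> s) \<le> 1"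
      "\<And>b. b \<in> carrier D \<Longrightarrow> a \<otimes> b = b \<otimes> a \<Longrightarrow> s \<otimes> b = b \<otimes> s"
      using sqrt_one_minus[OF a] by blast
    have "\<one> \<ominus> a = complex_of_real (1 / r) \<odot> h"
      using h unfolding a_def by (simp add: minus_minus_cancel)
    then have ss: "s \<otimes> s = complex_of_real (1 / r) \<odot> h"
      using s by simp
    have "pos s"
      unfolding pos_def using s by (auto intro!: exI[of _ 1])
    then have "pos (complex_of_real (sqrt r) \<odot> s)"
      using r by (intro pos_scale) auto
    moreover have "(complex_of_real (sqrt r) \<odot> s) \<otimes> (complex_of_real (sqrt r) \<odot> s) = h"
    proof -
      have "(complex_of_real (sqrt r) \<odot> s) \<otimes> (complex_of_real (sqrt r) \<odot> s)
          = (complex_of_real (sqrt r) * complex_of_real (sqrt r)) \<odot> (s \<otimes> s)"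
        using s(1) by (simp add: scale_mult_left scale_mult_right)
      also have "\<dots> = complex_of_real r \<odot> (s \<otimes> s)"
        using r by (simp flip: of_real_mult)
      also have "\<dots> = complex_of_real (r * (1 / r)) \<odot> h"
        unfolding ss using h r by simp
      finally show ?thesis
        using False h by simp
    qed
    moreover have "(complex_of_real (sqrt r) \<odot> s) \<otimes> b = b \<otimes> (complex_of_real (sqrt r) \<odot> s)"
      if b: "b \<in> carrier D" "h \<otimes> b = b \<otimes> h" for b
    proof -
      have "a \<otimes> b = b \<otimes> a"
        using b h
        by (simp add: a_def a_minus_def l_distr r_distr l_minus r_minus scale_mult_left scale_mult_right)
      then show ?thesis
        using s b by (simp add: scale_mult_left scale_mult_right)
    qed
    ultimately show ?thesis
      by (rule that)
  qed
qed

text \<open>If \<open>v\<close> and \<open>q\<close> commute and \<open>v\<^sup>2 + q\<^sup>2 = c\<close>, then \<open>(v + i q)\<^sup>* (v + i q) = c\<close>.\<close>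

lemma commuting_squares_bound:
  assumes v: "v \<in> carrier D" "adj D v = v" and q: "q \<in> carrier D" "adj D q = q"
    and comm: "v \<otimes> q = q \<otimes> v" and sum: "v \<otimes> v \<oplus> q \<otimes> q = complex_of_real c \<odot> \<one>" and c: "0 \<le> c"
  shows "nrm D (q \<otimes> q) \<le> c"
proof -
  \<comment> \<open>The skew-adjoint element \<open>z\<close> keeps scalars out of the ring identities below.\<close>
  define z where "z = \<i> \<odot> q"
  have z: "z \<in> carrier D" "adj D z = \<ominus> z" "v \<otimes> z = z \<otimes> v" "z \<otimes> z = \<ominus> (q \<otimes> q)"
    using v q comm by (auto simp: z_def adj_scale neg_eq_scale scale_mult_left scale_mult_right)
  have "adj D (v \<oplus> z) \<otimes> (v \<oplus> z) = (v \<ominus> z) \<otimes> (v \<oplus> z)"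
    using v z by (simp add: adj_add a_minus_def)
  also have "\<dots> = (v \<otimes> v \<ominus> z \<otimes> z) \<oplus> (v \<otimes> z \<ominus> z \<otimes> v)"
    using v(1) z(1) by algebra
  also have "\<dots> = v \<otimes> v \<oplus> q \<otimes> q"
    using v q z by (simp add: a_minus_def minus_minus M.r_neg)
  finally have "(nrm D (v \<oplus> z))\<^sup>2 = c * nrm D \<one>"
    using nrm_adj_mult[of "v \<oplus> z"] v z c by (simp add: sum nrm_smult)
  then have nu: "(nrm D (v \<oplus> z))\<^sup>2 \<le> c"
    using nrm_one_le c by (simp add: mult_left_le)
  have "2 * nrm D q = nrm D (z \<oplus> z)"
    using q z by (simp add: z_def nrm_smult flip: scale_two)
  also have "z \<oplus> z = (v \<oplus> z) \<ominus> adj D (v \<oplus> z)"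
    using v z by (simp add: adj_add a_minus_def) algebra
  also have "nrm D \<dots> \<le> 2 * nrm D (v \<oplus> z)"
    using nrm_diff_le[of "v \<oplus> z" "adj D (v \<oplus> z)"] v z by simp
  finally have "(nrm D q)\<^sup>2 \<le> (nrm D (v \<oplus> z))\<^sup>2"
    using q nrm_nonneg[of q] by (intro power_mono) auto
  then show ?thesis
    using nu q by (simp add: nrm_square)
qed

lemma nrm_one_minus_square:
  assumes x: "x \<in> carrier D" "adj D x = x" "nrm D x \<le> 1"
  shows "nrm D (\<one> \<ominus> x \<otimes> x) \<le> 1"
proof -
  have xx: "x \<otimes> x \<in> carrier D" "adj D (x \<otimes> x) = x \<otimes> x" "nrm D (x \<otimes> x) \<le> 1"
    using x nrm_nonneg[of x] by (auto simp: adj_mult nrm_square power2_eq_square mult_le_one)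
  then obtain s where s: "s \<in> carrier D" "adj D s = s" "s \<otimes> s = \<one> \<ominus> x \<otimes> x"
    "\<And>b. b \<in> carrier D \<Longrightarrow> x \<otimes> x \<otimes> b = b \<otimes> (x \<otimes> x) \<Longrightarrow> s \<otimes> b = b \<otimes> s"
    using sqrt_one_minus[of "x \<otimes> x"] by blast
  have "x \<otimes> x \<oplus> s \<otimes> s = complex_of_real 1 \<odot> \<one>"
    unfolding s(3) using x by (simp add: a_minus_def) algebra
  then show ?thesis
    using commuting_squares_bound[OF x(1,2) s(1,2), of 1] s(4)[of x] s(3) x by (simp add: m_assoc)
qed

lemma nrm_minus_square:
  assumes x: "x \<in> carrier D" "adj D x = x"
  shows "nrm D (complex_of_real ((nrm D x)\<^sup>2) \<odot> \<one> \<ominus> x \<otimes> x) \<le> (nrm D x)\<^sup>2"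
proof (cases "nrm D x = 0")
  case True
  then have "x = \<zero>" using x nrm_eq_0 by blast
  then show ?thesis by simp
next
  case False
  define N where "N = nrm D x"
  define y where "y = complex_of_real (1 / N) \<odot> x"
  have N: "N > 0" using False nrm_nonneg[OF x(1)] by (simp add: N_def)
  have "nrm D y = (1 / N) * N" unfolding y_def using x N by (simp add: nrm_smult norm_divide flip: N_def)
  then have y: "y \<in> carrier D" "adj D y = y" "nrm D y \<le> 1"
    using x N by (auto simp: y_def adj_scale)
  have "complex_of_real (N\<^sup>2) \<odot> \<one> \<ominus> x \<otimes> x = complex_of_real (N\<^sup>2) \<odot> (\<one> \<ominus> y \<otimes> y)"
    using x N by (simp add: y_def scale_diff scale_mult_left scale_mult_right power2_eq_square)
  then show ?thesis
    using nrm_one_minus_square[OF y] N y(1) mult_left_mono[of "nrm D (\<one> \<ominus> y \<otimes> y)" 1 "N\<^sup>2"]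
    unfolding N_def[symmetric] by (simp add: nrm_smult norm_power)
qed

lemma pos_square: "x \<in> carrier D \<Longrightarrow> adj D x = x \<Longrightarrow> pos (x \<otimes> x)"
  unfolding pos_def using nrm_minus_square[of x] by (auto simp: adj_mult intro!: exI[of _ "(nrm D x)\<^sup>2"])

lemma pos_scalar_minus:
  assumes "h \<in> carrier D" "adj D h = h" "nrm D h \<le> c"
  shows "pos (complex_of_real c \<odot> \<one> \<ominus> h)"
proof -
  have "complex_of_real c \<odot> \<one> \<ominus> (complex_of_real c \<odot> \<one> \<ominus> h) = h"
    using assms(1) by (simp add: minus_minus_cancel)
  then show ?thesis
    unfolding pos_def using assms nrm_nonneg[of h]
    by (auto simp: adj_diff adj_scale intro!: exI[of _ c])
qed

text \<open>
  Commuting square roots \<open>q\<close> of \<open>p\<close> and \<open>v\<close> of \<open>c - p\<close> satisfy \<open>v\<^sup>2 + q\<^sup>2 = c\<close>.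
\<close>

lemma pos_le_scalar:
  assumes p: "pos p" and cp: "pos (complex_of_real c \<odot> \<one> \<ominus> p)" and c: "0 \<le> c"
  shows "nrm D p \<le> c"
proof -
  obtain q where q: "pos q" "q \<otimes> q = p"
    using pos_sqrt[OF p] by blast
  obtain v where v: "pos v" "v \<otimes> v = complex_of_real c \<odot> \<one> \<ominus> p"
    "\<And>b. b \<in> carrier D \<Longrightarrow> (complex_of_real c \<odot> \<one> \<ominus> p) \<otimes> b = b \<otimes> (complex_of_real c \<odot> \<one> \<ominus> p)
      \<Longrightarrow> v \<otimes> b = b \<otimes> v"
    using pos_sqrt[OF cp] by blast
  note cl = pos_closed[OF p] pos_closed[OF q(1)] pos_closed[OF v(1)]
  have "p \<otimes> q = q \<otimes> p"
    using cl unfolding q(2)[symmetric] by (simp add: m_assoc)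
  then have "v \<otimes> q = q \<otimes> v"
    using cl by (intro v(3))
      (auto simp: a_minus_def l_distr r_distr l_minus r_minus scale_mult_left scale_mult_right)
  moreover have "v \<otimes> v \<oplus> q \<otimes> q = complex_of_real c \<odot> \<one>"
    unfolding v q using cl by (simp add: minus_add_cancel)
  ultimately show ?thesis
    using commuting_squares_bound[of v q c] cl c pos_adj[OF q(1)] pos_adj[OF v(1)] q(2) by simp
qed

lemma nrm_mono:
  assumes "pos p" "pos (k \<ominus> p)" and k: "k \<in> carrier D"
  shows "nrm D p \<le> nrm D k"
proof -
  have "adj D k = k"
    using pos_adj[OF pos_add[OF assms(2,1)]] pos_closed[OF assms(1)] k by (simp add: minus_add_cancel)
  have "(complex_of_real (nrm D k) \<odot> \<one> \<ominus> k) \<oplus> (k \<ominus> p) = complex_of_real (nrm D k) \<odot> \<one> \<ominus> p"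
      using k pos_closed[OF assms(1)] by (simp add: diff_add_diff)
    then have "pos (complex_of_real (nrm D k) \<odot> \<one> \<ominus> p)"
      using pos_add[OF pos_scalar_minus[OF k \<open>adj D k = k\<close> order_refl] assms(2)] by simp
    then show ?thesis
      using pos_le_scalar[OF assms(1)] k nrm_nonneg by blast
qed

lemma pos_commuting_sandwich:
  assumes w: "pos w" and q: "q \<in> carrier D" "adj D q = q" and comm: "w \<otimes> q = q \<otimes> w"
  shows "pos (q \<otimes> w \<otimes> q)"
proof -
  obtain v where v: "pos v" "v \<otimes> v = w" "v \<otimes> q = q \<otimes> v"
    using pos_sqrt[OF w] q comm by metis
  note cl = pos_closed[OF v(1)] q
  have "(v \<otimes> q) \<otimes> (v \<otimes> q) = q \<otimes> w \<otimes> q"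
    unfolding v(2)[symmetric] using cl v(3) by (metis m_assoc m_closed)
  moreover have "pos ((v \<otimes> q) \<otimes> (v \<otimes> q))"
    using cl v by (intro pos_square) (auto simp: adj_mult pos_adj)
  ultimately show ?thesis by simp
qed

text \<open>
  If \<open>d\<^sup>* d = - q\<^sup>2\<close> with \<open>\<parallel>d\<parallel> = 1\<close>, then \<open>d d\<^sup>*\<close> is positive because \<open>d d\<^sup>* + d\<^sup>* d\<close> is a sum of two
  squares. Hence \<open>d\<^sup>* (1 - d d\<^sup>*) d = - (q\<^sup>2 + q\<^sup>4)\<close> has norm at most \<open>1\<close>, although \<open>q\<^sup>2\<close> already has
  norm \<open>1\<close>.
\<close>

lemma adj_mult_not_negative_unit:
  assumes d: "d \<in> carrier D" "nrm D d = 1" and q: "q \<in> carrier D" "adj D q = q"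
    and eq: "adj D d \<otimes> d = \<ominus> (q \<otimes> q)"
  shows False
proof -
  define y where "y = q \<otimes> q"
  define e where "e = adj D d"
  have y: "y \<in> carrier D" "adj D y = y"
    using q by (auto simp: y_def adj_mult)
  have e: "e \<in> carrier D" "nrm D e = 1" "adj D e = d"
    using d by (auto simp: e_def)
  have ed: "e \<otimes> d = \<ominus> y"
    using eq by (simp add: e_def y_def)
  have "nrm D (\<ominus> y) = 1"
    using nrm_adj_mult[OF d(1)] d(2) ed by (simp add: e_def)
  then have ny: "nrm D y = 1" using y by simp
  \<comment> \<open>Up to real factors, \<open>x\<close> and \<open>t\<close> are the real and imaginary parts of \<open>d\<close>, so \<open>x\<^sup>2 + t\<^sup>2 = 2 (d d\<^sup>* + d\<^sup>* d)\<close>.\<close>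
  define x t where "x = d \<oplus> e" and "t = \<i> \<odot> (d \<ominus> e)"
  have x: "x \<in> carrier D" "adj D x = x"
    using d e by (auto simp: x_def adj_add e_def M.a_comm)
  have "adj D t = (- \<i>) \<odot> (\<ominus> (d \<ominus> e))"
    using d e by (simp add: t_def adj_scale adj_diff neg_diff flip: e_def)
  then have t: "t \<in> carrier D" "adj D t = t"
    using d e by (auto simp: t_def neg_eq_scale)
  have "t \<otimes> t = \<ominus> ((d \<ominus> e) \<otimes> (d \<ominus> e))"
    using d e by (simp add: t_def scale_mult_left scale_mult_right neg_eq_scale)
  then have "(x \<otimes> x \<oplus> t \<otimes> t) \<oplus> (y \<oplus> y)
      = (x \<otimes> x \<oplus> \<ominus> ((d \<ominus> e) \<otimes> (d \<ominus> e))) \<oplus> (\<ominus> (e \<otimes> d) \<oplus> \<ominus> (e \<otimes> d))"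
    using ed y by simp
  also have "\<dots> = d \<otimes> e \<oplus> d \<otimes> e"
    unfolding x_def using d(1) e(1) by algebra
  finally have "pos (d \<otimes> e \<oplus> d \<otimes> e)"
    using pos_add[OF pos_add[OF pos_square[OF x] pos_square[OF t]] pos_add[OF pos_square[OF q] pos_square[OF q]]]
    by (simp add: y_def)
  then have "pos (complex_of_real (1 / 2) \<odot> (2 \<odot> (d \<otimes> e)))"
    using d e by (intro pos_scale) (auto simp: scale_two)
  then have pde: "pos (d \<otimes> e)"
    using d e by simp
  then obtain w where w: "pos w" "w \<otimes> w = d \<otimes> e"
    using pos_sqrt by blast
  have "(nrm D w)\<^sup>2 = 1"
    using nrm_square[OF pos_closed[OF w(1)] pos_adj[OF w(1)]] nrm_adj_mult[of e] d e w(2) by simp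
  then have nw: "nrm D w \<le> 1"
    using nrm_nonneg[OF pos_closed[OF w(1)]] by (simp add: power2_eq_1_iff)
  have "nrm D (\<one> \<ominus> d \<otimes> e) \<le> 1"
    using nrm_one_minus_square[OF pos_closed[OF w(1)] pos_adj[OF w(1)] nw] w(2) by simp
  then have "nrm D e * nrm D ((\<one> \<ominus> d \<otimes> e) \<otimes> d) \<le> 1"
    using nrm_mult[of "\<one> \<ominus> d \<otimes> e" d] d e by simp
  then have "nrm D (e \<otimes> ((\<one> \<ominus> d \<otimes> e) \<otimes> d)) \<le> 1"
    using nrm_mult[of e "(\<one> \<ominus> d \<otimes> e) \<otimes> d"] d e by simp
  also have "e \<otimes> ((\<one> \<ominus> d \<otimes> e) \<otimes> d) = e \<otimes> d \<ominus> (e \<otimes> d) \<otimes> (e \<otimes> d)"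
    using d(1) e(1) by algebra
  also have "\<dots> = \<ominus> (y \<oplus> y \<otimes> y)"
    unfolding ed using y(1) by algebra
  finally have "nrm D (y \<oplus> y \<otimes> y) \<le> 1"
    using y by simp
  then have p1: "pos (\<one> \<ominus> (y \<oplus> y \<otimes> y))"
    using pos_scalar_minus[of "y \<oplus> y \<otimes> y" 1] y by (simp add: adj_add adj_mult)
  have "(\<one> \<ominus> (y \<oplus> y \<otimes> y)) \<otimes> q = q \<otimes> (\<one> \<ominus> (y \<oplus> y \<otimes> y))"
    using q(1) by (simp add: y_def a_minus_def l_distr r_distr l_minus r_minus minus_add m_assoc)
  then have "pos (q \<otimes> (\<one> \<ominus> (y \<oplus> y \<otimes> y)) \<otimes> q)"
    using p1 q by (intro pos_commuting_sandwich)
  also have "q \<otimes> (\<one> \<ominus> (y \<oplus> y \<otimes> y)) \<otimes> q = y \<ominus> (y \<otimes> y \<oplus> y \<otimes> y \<otimes> y)"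
    using q(1) by (simp add: y_def a_minus_def l_distr r_distr l_minus r_minus minus_add m_assoc)
  finally have p2: "pos (y \<ominus> (y \<otimes> y \<oplus> y \<otimes> y \<otimes> y))" .
  have "pos ((q \<otimes> q \<otimes> q) \<otimes> (q \<otimes> q \<otimes> q))"
    using q by (intro pos_square) (auto simp: adj_mult m_assoc)
  also have "(q \<otimes> q \<otimes> q) \<otimes> (q \<otimes> q \<otimes> q) = y \<otimes> y \<otimes> y"
    using q by (simp add: y_def m_assoc)
  finally have p3: "pos (y \<otimes> y \<otimes> y)" .
  have "(\<one> \<ominus> (y \<oplus> y \<otimes> y)) \<oplus> (y \<ominus> (y \<otimes> y \<oplus> y \<otimes> y \<otimes> y)) \<oplus> y \<otimes> y \<otimes> y = \<one> \<ominus> (y \<otimes> y \<oplus> y \<otimes> y)"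
    using y(1) by algebra
  then have "pos (complex_of_real 1 \<odot> \<one> \<ominus> (y \<otimes> y \<oplus> y \<otimes> y))"
    using pos_add[OF pos_add[OF p1 p2] p3] by simp
  moreover have "pos (y \<otimes> y \<oplus> y \<otimes> y)"
    by (intro pos_add pos_square y)
  ultimately have "nrm D (y \<otimes> y \<oplus> y \<otimes> y) \<le> 1"
    using pos_le_scalar by fastforce
  then show False
    using nrm_square[OF y] ny y by (simp add: nrm_smult flip: scale_two)
qed

lemma adj_mult_negative:
  assumes d: "d \<in> carrier D" and q: "q \<in> carrier D" "adj D q = q"
    and eq: "adj D d \<otimes> d = \<ominus> (q \<otimes> q)"
  shows "d = \<zero>"
proof (rule ccontr)
  assume "d \<noteq> \<zero>"
  then have N: "nrm D d > 0"
    using d nrm_eq_0[of d] nrm_nonneg[of d] by linarith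
  let ?c = "complex_of_real (1 / nrm D d)"
  show False
  proof (rule adj_mult_not_negative_unit[of "?c \<odot> d" "?c \<odot> q"])
    show "adj D (?c \<odot> d) \<otimes> (?c \<odot> d) = \<ominus> ((?c \<odot> q) \<otimes> (?c \<odot> q))"
      using d q eq
      by (simp add: adj_scale scale_mult_left scale_mult_right scale_neg)
  qed (use d q N in \<open>auto simp: nrm_smult norm_divide adj_scale\<close>)
qed

text \<open>
  For \<open>h = c\<^sup>* c\<close> let \<open>m\<close> be the positive square root of \<open>h\<^sup>2\<close> and \<open>k = m - h\<close>, twice the negative part
  of \<open>h\<close>. Then \<open>(c k)\<^sup>* (c k) = k h k = - m k\<^sup>2\<close> is the negative of a square, hence \<open>c k = 0\<close>, which
  forces \<open>k = 0\<close> and \<open>h = m\<close>.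
\<close>

theorem pos_adj_mult:
  assumes c: "c \<in> carrier D"
  shows "pos (adj D c \<otimes> c)"
proof -
  define h where "h = adj D c \<otimes> c"
  have h: "h \<in> carrier D" "adj D h = h"
    using c by (auto simp: h_def adj_mult)
  obtain m where m: "pos m" "m \<otimes> m = h \<otimes> h" "m \<otimes> h = h \<otimes> m"
    using pos_sqrt[OF pos_square[OF h]] h by (metis m_assoc)
  obtain n where n: "pos n" "n \<otimes> n = m" "n \<otimes> m = m \<otimes> n" "n \<otimes> h = h \<otimes> n"
    using pos_sqrt[OF m(1)] h m(3) pos_closed[OF m(1)] by metis
  note cl = pos_closed[OF m(1)] pos_closed[OF n(1)] h(1)
  define k where "k = m \<ominus> h"
  have k: "k \<in> carrier D" "adj D k = k"
    using cl h pos_adj[OF m(1)] by (auto simp: k_def adj_diff)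
  have nk: "n \<otimes> k = k \<otimes> n"
    using cl n by (simp add: k_def a_minus_def l_distr r_distr l_minus r_minus)
  define q where "q = n \<otimes> k"
  have q: "q \<in> carrier D" "adj D q = q"
    using cl k nk pos_adj[OF n(1)] by (auto simp: q_def adj_mult)
  have "q \<otimes> q = n \<otimes> (k \<otimes> n) \<otimes> k"
    using cl k by (simp add: q_def m_assoc)
  then have qq: "q \<otimes> q = m \<otimes> k \<otimes> k"
    using cl k n(2) by (simp flip: nk m_assoc)
  have "k \<otimes> h = m \<otimes> h \<ominus> m \<otimes> m"
    using cl m(2) by (simp add: k_def a_minus_def l_distr l_minus)
  also have "\<dots> = \<ominus> (m \<otimes> k)"
    unfolding k_def using cl by algebra
  finally have "k \<otimes> h \<otimes> k = \<ominus> (q \<otimes> q)"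
    using cl k by (simp add: qq l_minus)
  moreover have "adj D (c \<otimes> k) \<otimes> (c \<otimes> k) = k \<otimes> h \<otimes> k"
    using c k by (simp add: adj_mult h_def m_assoc)
  ultimately have "adj D (c \<otimes> k) \<otimes> (c \<otimes> k) = \<ominus> (q \<otimes> q)" by simp
  then have "c \<otimes> k = \<zero>"
    using adj_mult_negative[of "c \<otimes> k" q] c k q by simp
  then have kh: "h \<otimes> k = \<zero>"
    using c k by (simp add: h_def m_assoc)
  have "\<ominus> (q \<otimes> q) = \<zero>"
    using \<open>k \<otimes> h \<otimes> k = \<ominus> (q \<otimes> q)\<close> kh k cl by (simp add: m_assoc)
  then have "q \<otimes> q = \<zero>"
    using q by (metis m_closed minus_zero M.minus_minus)
  then have mkk: "m \<otimes> k \<otimes> k = \<zero>"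
    by (simp add: qq)
  have "k \<otimes> k \<otimes> k = m \<otimes> k \<otimes> k \<ominus> h \<otimes> k \<otimes> k"
    using cl k by (subst k_def) (simp add: a_minus_def l_distr l_minus)
  then have "k \<otimes> k \<otimes> k = \<zero>"
    using kh k mkk by simp
  then have "(k \<otimes> k) \<otimes> (k \<otimes> k) = \<zero>"
    using k by (metis m_assoc m_closed l_null)
  then have "(nrm D (k \<otimes> k))\<^sup>2 = 0"
    using nrm_square[of "k \<otimes> k"] k by (simp add: adj_mult)
  then have "nrm D k = 0"
    using nrm_square[OF k] by simp
  then have "m \<ominus> h = \<zero>"
    using k nrm_eq_0[of k] by (simp add: k_def)
  then have "m = h"
    by (rule diff_eq_zeroD[OF _ cl(1,3)])
  then show ?thesis
    using m(1) by (simp add: h_def)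
qed

lemma positive_iff_pos: "positive D a \<longleftrightarrow> pos a"
proof
  assume "pos a"
  then obtain q where "pos q" "q \<otimes> q = a"
    using pos_sqrt by blast
  then show "positive D a"
    unfolding positive_def by (metis pos_adj pos_closed)
qed (auto simp: positive_def pos_adj_mult)

lemma pos_conjugate:
  assumes "pos p" "c \<in> carrier D"
  shows "pos (adj D c \<otimes> p \<otimes> c)"
proof -
  obtain q where q: "pos q" "q \<otimes> q = p"
    using pos_sqrt[OF assms(1)] by blast
  have "adj D (q \<otimes> c) \<otimes> (q \<otimes> c) = adj D c \<otimes> p \<otimes> c"
    using assms pos_closed[OF q(1)] pos_adj[OF q(1)] by (simp add: adj_mult m_assoc flip: q(2))
  then show ?thesis
    using pos_adj_mult[of "q \<otimes> c"] assms pos_closed[OF q(1)] by simp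
qed

text \<open>
  The number \<open>r\<close> in the definition of positivity may be taken to be \<open>\<parallel>h\<parallel>\<close>, which makes positivity a
  closed condition.
\<close>

lemma pos_iff_nrm:
  "pos h \<longleftrightarrow> h \<in> carrier D \<and> adj D h = h \<and> nrm D (complex_of_real (nrm D h) \<odot> \<one> \<ominus> h) \<le> nrm D h"
proof
  assume h: "pos h"
  then obtain q where q: "pos q" "q \<otimes> q = h"
    using pos_sqrt by blast
  show "h \<in> carrier D \<and> adj D h = h \<and> nrm D (complex_of_real (nrm D h) \<odot> \<one> \<ominus> h) \<le> nrm D h"
    using nrm_minus_square[OF pos_closed pos_adj, OF q(1) q(1)]
      nrm_square[OF pos_closed pos_adj, OF q(1) q(1)] q(2) pos_closed[OF h] pos_adj[OF h] by simp
qed (auto simp: pos_def nrm_nonneg intro!: exI[of _ "nrm D h"])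

lemma pos_limit:
  assumes lim: "converges_to D s x" and pos: "\<And>n. pos (s n)"
  shows "pos x"
  unfolding pos_iff_nrm
proof (intro conjI)
  have c: "s n \<in> carrier D" "x \<in> carrier D" for n
    using lim by (auto simp: converges_to_def)
  then show "x \<in> carrier D" by simp
  show "adj D x = x"
    using converges_to_adj[OF lim] lim pos_adj[OF pos] by (simp add: converges_to_unique)
  let ?N = "nrm D x"
  have "nrm D (complex_of_real ?N \<odot> \<one> \<ominus> x) \<le> 2 * \<bar>nrm D (s n) - ?N\<bar> + ?N + nrm D (s n \<ominus> x)" for n
  proof -
    let ?M = "nrm D (s n)"
    have "nrm D (complex_of_real ?N \<odot> \<one> \<ominus> x) \<le> nrm D (complex_of_real ?N \<odot> \<one> \<ominus> complex_of_real ?M \<odot> \<one>)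
      + nrm D (complex_of_real ?M \<odot> \<one> \<ominus> s n) + nrm D (s n \<ominus> x)"
      using nrm_diff_triangle[of "complex_of_real ?N \<odot> \<one>" "complex_of_real ?M \<odot> \<one>" x]
        nrm_diff_triangle[of "complex_of_real ?M \<odot> \<one>" "s n" x] c by simp
    moreover have "nrm D (complex_of_real ?N \<odot> \<one> \<ominus> complex_of_real ?M \<odot> \<one>) \<le> \<bar>?M - ?N\<bar>"
    proof -
      have "complex_of_real ?N \<odot> \<one> \<ominus> complex_of_real ?M \<odot> \<one> = complex_of_real (?N - ?M) \<odot> \<one>"
        by (simp add: a_minus_def neg_eq_scale flip: scale_add_left)
      then show ?thesis
        using nrm_one_le mult_left_le[of "nrm D \<one>" "\<bar>?N - ?M\<bar>"]
        by (simp only: nrm_smult one_closed norm_of_real) (simp add: abs_minus_commute)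
    qed
    moreover have "nrm D (complex_of_real ?M \<odot> \<one> \<ominus> s n) \<le> ?M"
      using pos[of n] by (simp add: pos_iff_nrm)
    moreover have "a \<le> 2 * e + N + w" if "a \<le> u + v + w" "u \<le> e" "v \<le> M" "M - N \<le> e"
      for a u v w e M N :: real
      using that by linarith
    ultimately show ?thesis
      using abs_ge_self by blast
  qed
  moreover have "(\<lambda>n. 2 * \<bar>nrm D (s n) - ?N\<bar> + ?N + nrm D (s n \<ominus> x)) \<longlonglongrightarrow> 2 * \<bar>?N - ?N\<bar> + ?N + 0"
    using lim tendsto_nrm[OF lim] by (intro tendsto_intros) (auto simp: converges_to_def)
  ultimately show "nrm D (complex_of_real ?N \<odot> \<one> \<ominus> x) \<le> ?N"
    by (intro LIMSEQ_le_const) auto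
qed

end

lemma (in abelian_group) finsum_swap:
  assumes "finite I" "finite J" "\<And>i j. i \<in> I \<Longrightarrow> j \<in> J \<Longrightarrow> f i j \<in> carrier G"
  shows "(\<Oplus>i\<in>I. \<Oplus>j\<in>J. f i j) = (\<Oplus>j\<in>J. \<Oplus>i\<in>I. f i j)"
  using assms(1,3)
proof (induction I rule: finite_induct)
  case (insert i I)
  have "(\<Oplus>j\<in>J. \<Oplus>i\<in>insert i I. f i j) = (\<Oplus>j\<in>J. f i j \<oplus> (\<Oplus>i\<in>I. f i j))"
    using insert by (intro finsum_cong') (auto simp: finsum_insert Pi_def)
  also have "\<dots> = (\<Oplus>j\<in>J. f i j) \<oplus> (\<Oplus>j\<in>J. \<Oplus>i\<in>I. f i j)"
    using insert by (intro finsum_addf) auto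
  finally show ?case
    using insert by (simp add: finsum_insert Pi_def)
qed (simp add: finsum_zero)

lemma (in unital_cstar) pos_finsum:
  "finite S \<Longrightarrow> (\<And>k. k \<in> S \<Longrightarrow> pos (f k)) \<Longrightarrow> pos (\<Oplus>k\<in>S. f k)"
  by (induction S rule: finite_induct) (auto simp: pos_zero finsum_insert Pi_def pos_closed pos_add)

lemma (in unital_cstar) adj_finsum:
  "finite S \<Longrightarrow> f \<in> S \<rightarrow> carrier D \<Longrightarrow> adj D (\<Oplus>k\<in>S. f k) = (\<Oplus>k\<in>S. adj D (f k))"
  by (induction S rule: finite_induct) (auto simp: finsum_insert adj_add Pi_def)

lemma (in unital_cstar) nrm_le_finsum_pos:
  assumes S: "finite S" "k \<in> S" and f: "\<And>k. k \<in> S \<Longrightarrow> pos (f k)"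
  shows "nrm D (f k) \<le> nrm D (\<Oplus>k\<in>S. f k)"
proof (rule nrm_mono)
  note fc = pos_closed[OF f]
  have rest: "pos (\<Oplus>k\<in>S - {k}. f k)"
    using S f by (intro pos_finsum) auto
  have "(\<Oplus>k\<in>S. f k) = f k \<oplus> (\<Oplus>k\<in>S - {k}. f k)"
    using S fc finsum_insert[of "S - {k}" k f] by (simp add: insert_absorb Pi_def)
  then have "(\<Oplus>k\<in>S. f k) \<ominus> f k = (\<Oplus>k\<in>S - {k}. f k)"
    using fc[OF S(2)] pos_closed[OF rest] by (simp add: a_comm[of "f k"] add_minus_cancel)
  then show "pos ((\<Oplus>k\<in>S. f k) \<ominus> f k)"
    using rest by simp
qed (use assms pos_closed in \<open>auto intro!: finsum_closed\<close>)

section \<open>Pre-Hilbert modules\<close>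

text \<open>
  A right inner product module over a unital C*-algebra, not necessarily complete. The norm is a
  field of the record, tied to the inner product by the last assumption; that it is a norm is a
  consequence, by the Cauchy--Schwarz inequality.
\<close>

locale pre_hilbert = unital_cstar D
  for D :: "('a, 'm) star_algebra_scheme" (structure) +
  fixes V :: "('a, 'v) hilbert_module"
  assumes module_V: "module complex_ring V"
    and ract_closed [simp, intro]: "x \<in> carrier V \<Longrightarrow> a \<in> carrier D \<Longrightarrow> ract V x a \<in> carrier V"
    and inner_closed [simp, intro]: "x \<in> carrier V \<Longrightarrow> y \<in> carrier V \<Longrightarrow> inner V x y \<in> carrier D"
    and inner_add_right:
      "x \<in> carrier V \<Longrightarrow> y \<in> carrier V \<Longrightarrow> z \<in> carrier V
        \<Longrightarrow> inner V x (y \<oplus>\<^bsub>V\<^esub> z) = inner V x y \<oplus> inner V x z"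
    and inner_scale_right:
      "x \<in> carrier V \<Longrightarrow> y \<in> carrier V \<Longrightarrow> inner V x (c \<odot>\<^bsub>V\<^esub> y) = c \<odot> inner V x y"
    and inner_ract_right:
      "x \<in> carrier V \<Longrightarrow> y \<in> carrier V \<Longrightarrow> a \<in> carrier D \<Longrightarrow> inner V x (ract V y a) = inner V x y \<otimes> a"
    and adj_inner: "x \<in> carrier V \<Longrightarrow> y \<in> carrier V \<Longrightarrow> adj D (inner V x y) = inner V y x"
    and pos_inner: "x \<in> carrier V \<Longrightarrow> pos (inner V x x)"
    and inner_definite: "x \<in> carrier V \<Longrightarrow> inner V x x = \<zero> \<Longrightarrow> x = \<zero>\<^bsub>V\<^esub>"
    and nrm_inner: "x \<in> carrier V \<Longrightarrow> nrm V x = sqrt (nrm D (inner V x x))"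
begin

interpretation V: module complex_ring V by (rule module_V)

lemma V_scale_closed [simp]: "x \<in> carrier V \<Longrightarrow> c \<odot>\<^bsub>V\<^esub> x \<in> carrier V"
  by (rule V.smult_closed) auto

lemma inner_add_left:
  assumes "x \<in> carrier V" "y \<in> carrier V" "z \<in> carrier V"
  shows "inner V (y \<oplus>\<^bsub>V\<^esub> z) x = inner V y x \<oplus> inner V z x"
  using inner_add_right[OF assms] assms by (simp add: adj_add flip: adj_inner[of x])

lemma inner_scale_left:
  assumes "x \<in> carrier V" "y \<in> carrier V"
  shows "inner V (c \<odot>\<^bsub>V\<^esub> y) x = cnj c \<odot> inner V y x"
  using inner_scale_right[OF assms] assms by (simp add: adj_scale flip: adj_inner[of x])

lemma inner_ract_left:
  assumes "x \<in> carrier V" "y \<in> carrier V" "a \<in> carrier D"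
  shows "inner V (ract V y a) x = adj D a \<otimes> inner V y x"
  using inner_ract_right[OF assms] assms by (simp add: adj_mult flip: adj_inner[of x])

lemma inner_zero_right [simp]: "x \<in> carrier V \<Longrightarrow> inner V x \<zero>\<^bsub>V\<^esub> = \<zero>"
  using inner_scale_right[of x "\<zero>\<^bsub>V\<^esub>" 0] by simp

lemma inner_zero_left [simp]: "x \<in> carrier V \<Longrightarrow> inner V \<zero>\<^bsub>V\<^esub> x = \<zero>"
  using inner_scale_left[of x "\<zero>\<^bsub>V\<^esub>" 0] by simp

lemma nrm_V_nonneg: "x \<in> carrier V \<Longrightarrow> 0 \<le> nrm V x"
  by (simp add: nrm_inner nrm_nonneg)

lemma nrm_V_square: "x \<in> carrier V \<Longrightarrow> (nrm V x)\<^sup>2 = nrm D (inner V x x)"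
  by (simp add: nrm_inner nrm_nonneg)

lemma nrm_V_eq_0: "x \<in> carrier V \<Longrightarrow> nrm V x = 0 \<Longrightarrow> x = \<zero>\<^bsub>V\<^esub>"
  using inner_definite[of x] nrm_eq_0[of "inner V x x"] by (simp add: nrm_inner)

text \<open>
  The Cauchy--Schwarz inequality; with \<open>b = \<langle>x, y\<rangle>\<close> and \<open>N = \<parallel>x\<parallel>\<^sup>2\<close> it comes from the positivity of
  \<open>\<langle>N y - x b, N y - x b\<rangle>\<close>.
\<close>

lemma cauchy_schwarz:
  assumes x: "x \<in> carrier V" and y: "y \<in> carrier V"
  shows "nrm D (inner V x y) \<le> nrm V x * nrm V y"
proof (cases "nrm V x = 0")
  case True
  then show ?thesis
    using nrm_V_eq_0[OF x] y by simp
next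
  case False
  define N b where "N = (nrm V x)\<^sup>2" and "b = inner V x y"
  have N: "N > 0" using False by (simp add: N_def)
  have b: "b \<in> carrier D" "adj D b = inner V y x"
    using x y by (auto simp: b_def adj_inner)
  define w where "w = complex_of_real N \<odot>\<^bsub>V\<^esub> y \<oplus>\<^bsub>V\<^esub> (- 1) \<odot>\<^bsub>V\<^esub> ract V x b"
  have w: "w \<in> carrier V" using x y b by (auto simp: w_def)
  define P S T where "P = complex_of_real (N\<^sup>2) \<odot> inner V y y"
    and "S = adj D b \<otimes> inner V x x \<otimes> b" and "T = complex_of_real N \<odot> (adj D b \<otimes> b)"
  have cl: "P \<in> carrier D" "S \<in> carrier D" "T \<in> carrier D"
    using x y b(1) by (auto simp: P_def S_def T_def)
  have "inner V w w = (P \<oplus> \<ominus> T) \<oplus> (\<ominus> T \<oplus> S)"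
    using x y b(1)
    by (simp add: w_def inner_add_left inner_add_right inner_scale_left inner_scale_right
        inner_ract_left inner_ract_right P_def S_def T_def scale_add_right neg_eq_scale power2_eq_square
        m_assoc scale_mult_left scale_mult_right l_distr r_distr flip: b(2) b_def)
  then have p1: "pos ((P \<oplus> \<ominus> T) \<oplus> (\<ominus> T \<oplus> S))"
    using pos_inner[OF w] by simp
  have "pos (complex_of_real N \<odot> \<one> \<ominus> inner V x x)"
    using pos_scalar_minus[of "inner V x x" N] x by (simp add: adj_inner N_def nrm_V_square)
  then have "pos (adj D b \<otimes> (complex_of_real N \<odot> \<one> \<ominus> inner V x x) \<otimes> b)"
    using b by (intro pos_conjugate)
  also have "adj D b \<otimes> (complex_of_real N \<odot> \<one> \<ominus> inner V x x) \<otimes> b = T \<oplus> \<ominus> S"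
    using b(1) x by (simp add: T_def S_def a_minus_def r_distr l_distr r_minus l_minus
        scale_mult_left scale_mult_right m_assoc neg_eq_scale scale_add_right)
  finally have p2: "pos (T \<oplus> \<ominus> S)" .
  have "((P \<oplus> \<ominus> T) \<oplus> (\<ominus> T \<oplus> S)) \<oplus> (T \<oplus> \<ominus> S) = P \<ominus> T"
    using cl by algebra
  then have "pos (P \<ominus> T)"
    using pos_add[OF p1 p2] by simp
  moreover have "pos T"
    unfolding T_def using b N by (intro pos_scale pos_adj_mult) auto
  ultimately have "nrm D T \<le> nrm D P"
    using cl by (intro nrm_mono)
  moreover have "nrm D T = N * (nrm D b)\<^sup>2"
    using nrm_adj_mult[OF b(1)] N b(1) by (simp add: T_def nrm_smult)
  moreover have "nrm D P = N\<^sup>2 * (nrm V y)\<^sup>2"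
    using N y by (simp add: P_def nrm_smult nrm_V_square norm_power)
  ultimately have "N * (nrm D b)\<^sup>2 \<le> N * (N * (nrm V y)\<^sup>2)"
    by (simp add: power2_eq_square mult.assoc)
  then have "(nrm D b)\<^sup>2 \<le> N * (nrm V y)\<^sup>2"
    using N by (rule mult_left_le_imp_le)
  then have "(nrm D b)\<^sup>2 \<le> (nrm V x * nrm V y)\<^sup>2"
    by (simp add: N_def power_mult_distrib)
  then show ?thesis
    unfolding b_def using nrm_V_nonneg[OF x] nrm_V_nonneg[OF y] by (rule power2_le_imp_le[OF _ mult_nonneg_nonneg])
qed

sublocale V: normed_space V
proof (intro normed_space.intro module_V normed_space_axioms.intro)
  fix x assume x: "x \<in> carrier V"
  show "0 \<le> nrm V x" by (rule nrm_V_nonneg[OF x])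
  show "nrm V x = 0 \<longleftrightarrow> x = \<zero>\<^bsub>V\<^esub>"
    using nrm_V_eq_0[OF x] by (auto simp: nrm_inner)
  show "nrm V (c \<odot>\<^bsub>V\<^esub> x) = cmod c * nrm V x" for c
    using x by (simp add: nrm_inner inner_scale_left inner_scale_right nrm_smult norm_mult real_sqrt_mult)
  fix y assume y: "y \<in> carrier V"
  have "(nrm V (x \<oplus>\<^bsub>V\<^esub> y))\<^sup>2 = nrm D ((inner V x x \<oplus> inner V x y) \<oplus> (inner V y x \<oplus> inner V y y))"
    using x y by (simp add: nrm_V_square inner_add_left inner_add_right a_ac)
  also have "\<dots> \<le> nrm D (inner V x x) + nrm D (inner V x y) + (nrm D (inner V y x) + nrm D (inner V y y))"
    using x y nrm_triangle[of "inner V x x \<oplus> inner V x y" "inner V y x \<oplus> inner V y y"]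
      nrm_triangle[of "inner V x x" "inner V x y"] nrm_triangle[of "inner V y x" "inner V y y"] by simp
  also have "\<dots> \<le> (nrm V x)\<^sup>2 + nrm V x * nrm V y + (nrm V y * nrm V x + (nrm V y)\<^sup>2)"
    using x y by (intro add_mono cauchy_schwarz) (simp_all add: nrm_V_square)
  also have "\<dots> = (nrm V x + nrm V y)\<^sup>2"
    by (simp add: power2_sum)
  finally show "nrm V (x \<oplus>\<^bsub>V\<^esub> y) \<le> nrm V x + nrm V y"
    using nrm_V_nonneg[OF x] nrm_V_nonneg[OF y]
    by (rule power2_le_imp_le[OF _ add_nonneg_nonneg])
qed

lemma linear_inner: "x \<in> carrier V \<Longrightarrow> linear_map V D (inner V x)"
  by (auto simp: linear_map_def inner_add_right inner_scale_right)

lemma inner_neg_right: "x \<in> carrier V \<Longrightarrow> y \<in> carrier V \<Longrightarrow> inner V x (\<ominus>\<^bsub>V\<^esub> y) = \<ominus> inner V x y"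
  by (simp add: V.neg_eq_scale neg_eq_scale inner_scale_right)

lemma inner_diff_right:
  "x \<in> carrier V \<Longrightarrow> y \<in> carrier V \<Longrightarrow> z \<in> carrier V
    \<Longrightarrow> inner V x (y \<ominus>\<^bsub>V\<^esub> z) = inner V x y \<ominus> inner V x z"
  by (simp add: a_minus_def inner_add_right inner_neg_right)

lemma inner_diff_left:
  "x \<in> carrier V \<Longrightarrow> y \<in> carrier V \<Longrightarrow> z \<in> carrier V
    \<Longrightarrow> inner V (y \<ominus>\<^bsub>V\<^esub> z) x = inner V y x \<ominus> inner V z x"
  using inner_diff_right[of x y z] by (simp add: adj_diff flip: adj_inner[of x])

lemma eq_by_inner:
  assumes "x \<in> carrier V" "y \<in> carrier V" "\<And>z. z \<in> carrier V \<Longrightarrow> inner V z x = inner V z y"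
  shows "x = y"
  using inner_definite[of "x \<ominus>\<^bsub>V\<^esub> y"] assms V.diff_eq_zeroD[of x y] by (simp add: inner_diff_right)

lemma inner_finsum_right:
  "finite S \<Longrightarrow> f \<in> S \<rightarrow> carrier V \<Longrightarrow> x \<in> carrier V
    \<Longrightarrow> inner V x (\<Oplus>\<^bsub>V\<^esub>k\<in>S. f k) = (\<Oplus>k\<in>S. inner V x (f k))"
  by (induction S rule: finite_induct) (auto simp: V.M.finsum_insert finsum_insert inner_add_right Pi_def)

lemma inner_finsum_left:
  "finite S \<Longrightarrow> f \<in> S \<rightarrow> carrier V \<Longrightarrow> x \<in> carrier V
    \<Longrightarrow> inner V (\<Oplus>\<^bsub>V\<^esub>k\<in>S. f k) x = (\<Oplus>k\<in>S. inner V (f k) x)"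
  by (induction S rule: finite_induct) (auto simp: V.M.finsum_insert finsum_insert inner_add_left Pi_def)

lemma ract_add:
  "x \<in> carrier V \<Longrightarrow> y \<in> carrier V \<Longrightarrow> a \<in> carrier D
    \<Longrightarrow> ract V (x \<oplus>\<^bsub>V\<^esub> y) a = ract V x a \<oplus>\<^bsub>V\<^esub> ract V y a"
  by (rule eq_by_inner) (auto simp: inner_ract_right inner_add_right l_distr)

lemma ract_scale:
  "x \<in> carrier V \<Longrightarrow> a \<in> carrier D \<Longrightarrow> ract V (c \<odot>\<^bsub>V\<^esub> x) a = c \<odot>\<^bsub>V\<^esub> ract V x a"
  by (rule eq_by_inner) (auto simp: inner_ract_right inner_scale_right scale_mult_left)

lemma ract_diff:
  "x \<in> carrier V \<Longrightarrow> y \<in> carrier V \<Longrightarrow> a \<in> carrier D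
    \<Longrightarrow> ract V (x \<ominus>\<^bsub>V\<^esub> y) a = ract V x a \<ominus>\<^bsub>V\<^esub> ract V y a"
  by (simp add: a_minus_def ract_add V.neg_eq_scale ract_scale)

lemma nrm_ract_le:
  assumes x: "x \<in> carrier V" and a: "a \<in> carrier D"
  shows "nrm V (ract V x a) \<le> nrm V x * nrm D a"
proof (rule power2_le_imp_le)
  have "(nrm V (ract V x a))\<^sup>2 = nrm D (adj D a \<otimes> (inner V x x \<otimes> a))"
    using x a by (simp add: nrm_V_square inner_ract_left inner_ract_right m_assoc)
  also have "\<dots> \<le> nrm D a * (nrm D (inner V x x) * nrm D a)"
    using nrm_mult[of "adj D a" "inner V x x \<otimes> a"] nrm_mult[of "inner V x x" a] x a
      mult_left_mono[OF nrm_mult[of "inner V x x" a] nrm_nonneg[of a]] by simp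
  finally show "(nrm V (ract V x a))\<^sup>2 \<le> (nrm V x * nrm D a)\<^sup>2"
    using x by (simp add: power_mult_distrib nrm_V_square) (simp add: power2_eq_square mult_ac)
qed (use x a V.nrm_nonneg nrm_nonneg in auto)

lemma nrm_inner_diff_le:
  assumes "x \<in> carrier V" "y \<in> carrier V" "z \<in> carrier V" "w \<in> carrier V"
  shows "nrm D (inner V x y \<ominus> inner V z w)
    \<le> nrm V (x \<ominus>\<^bsub>V\<^esub> z) * nrm V y + nrm V z * nrm V (y \<ominus>\<^bsub>V\<^esub> w)"
  using nrm_diff_triangle[of "inner V x y" "inner V z y" "inner V z w"]
    cauchy_schwarz[of "x \<ominus>\<^bsub>V\<^esub> z" y] cauchy_schwarz[of z "y \<ominus>\<^bsub>V\<^esub> w"] assms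
  by (simp add: inner_diff_left inner_diff_right)

lemma converges_to_inner:
  assumes "converges_to V s x" "converges_to V t y"
  shows "converges_to D (\<lambda>n. inner V (s n) (t n)) (inner V x y)"
proof (rule converges_to_squeeze)
  have c: "s n \<in> carrier V" "t n \<in> carrier V" for n
    using assms by (auto simp: converges_to_def)
  have d: "x \<in> carrier V" "y \<in> carrier V"
    using assms by (auto simp: converges_to_def)
  show "inner V (s n) (t n) \<in> carrier D" "inner V x y \<in> carrier D" for n
    using c d by auto
  show "nrm D (inner V (s n) (t n) \<ominus> inner V x y)
      \<le> nrm V (s n \<ominus>\<^bsub>V\<^esub> x) * nrm V (t n) + nrm V x * nrm V (t n \<ominus>\<^bsub>V\<^esub> y)" for n
    using c d by (intro nrm_inner_diff_le)
  have "(\<lambda>n. nrm V (s n \<ominus>\<^bsub>V\<^esub> x) * nrm V (t n) + nrm V x * nrm V (t n \<ominus>\<^bsub>V\<^esub> y))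
      \<longlonglongrightarrow> 0 * nrm V y + nrm V x * 0"
    using assms by (intro tendsto_intros V.tendsto_nrm) (auto simp: converges_to_def)
  then show "(\<lambda>n. nrm V (s n \<ominus>\<^bsub>V\<^esub> x) * nrm V (t n) + nrm V x * nrm V (t n \<ominus>\<^bsub>V\<^esub> y)) \<longlonglongrightarrow> 0"
    by simp
qed

end

section \<open>Completions of pre-Hilbert modules\<close>

lemma cauchy_seq_dominated:
  assumes s: "cauchy_seq V s" and t: "\<And>n. t n \<in> carrier W" and K: "0 \<le> K"
    and le: "\<And>m n. nrm W (t m \<ominus>\<^bsub>W\<^esub> t n) \<le> K * nrm V (s m \<ominus>\<^bsub>V\<^esub> s n)"
  shows "cauchy_seq W t"
  unfolding cauchy_seq_def
proof (intro conjI allI impI t)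
  fix \<epsilon> :: real assume \<epsilon>: "\<epsilon> > 0"
  then obtain N where N: "\<And>m n. m \<ge> N \<Longrightarrow> n \<ge> N \<Longrightarrow> nrm V (s m \<ominus>\<^bsub>V\<^esub> s n) < \<epsilon> / (K + 1)"
    using s K unfolding cauchy_seq_def by (metis add_nonneg_pos divide_pos_pos zero_less_one)
  have "nrm W (t m \<ominus>\<^bsub>W\<^esub> t n) < \<epsilon>" if "m \<ge> N" "n \<ge> N" for m n
  proof -
    have "K * nrm V (s m \<ominus>\<^bsub>V\<^esub> s n) \<le> K * (\<epsilon> / (K + 1))"
      using N[OF that] K by (intro mult_left_mono) auto
    also have "\<dots> < \<epsilon>"
      using K \<epsilon> by (simp add: field_simps)
    finally show ?thesis
      using le[of m n] by simp
  qed
  then show "\<exists>N. \<forall>m\<ge>N. \<forall>n\<ge>N. nrm W (t m \<ominus>\<^bsub>W\<^esub> t n) < \<epsilon>" by blast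
qed

context normed_space
begin

lemma cauchy_seq_closed: "cauchy_seq V s \<Longrightarrow> s n \<in> carrier V"
  by (simp add: cauchy_seq_def)

lemma cauchy_seq_const: "x \<in> carrier V \<Longrightarrow> cauchy_seq V (\<lambda>n. x)"
  by (auto simp: cauchy_seq_def)

lemma cauchy_seq_add:
  assumes s: "cauchy_seq V s" and t: "cauchy_seq V t"
  shows "cauchy_seq V (\<lambda>n. s n \<oplus> t n)"
  unfolding cauchy_seq_def
proof (intro conjI allI impI)
  fix \<epsilon> :: real assume "\<epsilon> > 0"
  then obtain N M where N: "\<And>m n. m \<ge> N \<Longrightarrow> n \<ge> N \<Longrightarrow> nrm V (s m \<ominus> s n) < \<epsilon> / 2"
    and M: "\<And>m n. m \<ge> M \<Longrightarrow> n \<ge> M \<Longrightarrow> nrm V (t m \<ominus> t n) < \<epsilon> / 2"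
    using s t unfolding cauchy_seq_def by (meson half_gt_zero)
  have "nrm V ((s m \<oplus> t m) \<ominus> (s n \<oplus> t n)) < \<epsilon>" if "m \<ge> max N M" "n \<ge> max N M" for m n
    using N[of m n] M[of m n] that nrm_diff_add_le[of "s m" "t m" "s n" "t n"]
      cauchy_seq_closed[OF s] cauchy_seq_closed[OF t] by simp
  then show "\<exists>N. \<forall>m\<ge>N. \<forall>n\<ge>N. nrm V ((s m \<oplus> t m) \<ominus> (s n \<oplus> t n)) < \<epsilon>" by blast
qed (use s t cauchy_seq_closed in auto)

lemma cauchy_seq_scale:
  assumes s: "cauchy_seq V s"
  shows "cauchy_seq V (\<lambda>n. c \<odot> s n)"
  by (rule cauchy_seq_dominated[OF s, of _ _ "cmod c"])
    (use cauchy_seq_closed[OF s] in \<open>auto simp: nrm_smult simp flip: scale_diff\<close>)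

lemma cauchy_seq_nrm:
  assumes s: "cauchy_seq V s"
  shows "convergent (\<lambda>n. nrm V (s n))"
proof (rule Cauchy_convergent)
  show "Cauchy (\<lambda>n. nrm V (s n))"
    unfolding Cauchy_def dist_real_def
  proof (intro allI impI)
    fix \<epsilon> :: real assume "\<epsilon> > 0"
    then obtain N where N: "\<And>m n. m \<ge> N \<Longrightarrow> n \<ge> N \<Longrightarrow> nrm V (s m \<ominus> s n) < \<epsilon>"
      using s unfolding cauchy_seq_def by meson
    then show "\<exists>N. \<forall>m\<ge>N. \<forall>n\<ge>N. \<bar>nrm V (s m) - nrm V (s n)\<bar> < \<epsilon>"
      using abs_nrm_diff_le[OF cauchy_seq_closed cauchy_seq_closed, OF s s]
      by (meson order_le_less_trans)
  qed
qed

lemma cauchy_seq_bounded: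
  assumes s: "cauchy_seq V s"
  obtains K where "0 \<le> K" "\<And>n. nrm V (s n) \<le> K"
proof -
  obtain K where "\<And>n. norm (nrm V (s n)) \<le> K"
    using convergent_imp_Bseq[OF cauchy_seq_nrm[OF s]] unfolding Bseq_def by blast
  then show thesis
    using that[of K] nrm_nonneg[OF cauchy_seq_closed[OF s]]
    by (metis abs_ge_self norm_ge_zero order_trans real_norm_def)
qed

lemma equiv_null_rel: "equiv {s. cauchy_seq V s} (null_rel V)"
proof (rule equivI)
  show "null_rel V \<subseteq> {s. cauchy_seq V s} \<times> {s. cauchy_seq V s}"
    by (auto simp: null_rel_def)
  show "refl_on {s. cauchy_seq V s} (null_rel V)"
    by (auto simp: refl_on_def null_rel_def cauchy_seq_closed)
  show "sym (null_rel V)"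
    by (rule symI) (auto simp: null_rel_def nrm_diff_commute[OF cauchy_seq_closed cauchy_seq_closed])
  show "trans (null_rel V)"
  proof (rule transI)
    fix s t u assume "(s, t) \<in> null_rel V" "(t, u) \<in> null_rel V"
    then have st: "cauchy_seq V s" "cauchy_seq V t" "(\<lambda>n. nrm V (s n \<ominus> t n)) \<longlonglongrightarrow> 0"
      and tu: "cauchy_seq V u" "(\<lambda>n. nrm V (t n \<ominus> u n)) \<longlonglongrightarrow> 0"
      by (auto simp: null_rel_def)
    note c = st(1,2)[THEN cauchy_seq_closed] tu(1)[THEN cauchy_seq_closed]
    have "(\<lambda>n. nrm V (s n \<ominus> u n)) \<longlonglongrightarrow> 0"
    proof (rule tendsto_sandwich[OF _ _ tendsto_const])
      show "(\<lambda>n. nrm V (s n \<ominus> t n) + nrm V (t n \<ominus> u n)) \<longlonglongrightarrow> 0"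
        using tendsto_add[OF st(3) tu(2)] by simp
    qed (use c nrm_nonneg nrm_diff_triangle in \<open>auto intro!: always_eventually\<close>)
    then show "(s, u) \<in> null_rel V"
      using st tu by (simp add: null_rel_def)
  qed
qed

lemma seq_class_eq_iff:
  assumes "cauchy_seq V s" "cauchy_seq V t"
  shows "seq_class V s = seq_class V t \<longleftrightarrow> (\<lambda>n. nrm V (s n \<ominus> t n)) \<longlonglongrightarrow> 0"
  using eq_equiv_class_iff[OF equiv_null_rel, of s t] assms by (simp add: seq_class_def null_rel_def)

lemma seq_rep_class:
  assumes "cauchy_seq V s"
  shows "cauchy_seq V (seq_rep (seq_class V s))"
    and "(\<lambda>n. nrm V (seq_rep (seq_class V s) n \<ominus> s n)) \<longlonglongrightarrow> 0"
proof -
  have "s \<in> seq_class V s"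
    using assms by (simp add: seq_class_def null_rel_def cauchy_seq_closed)
  then have "seq_rep (seq_class V s) \<in> seq_class V s"
    unfolding seq_rep_def by (rule someI[of "\<lambda>t. t \<in> seq_class V s"])
  then have "cauchy_seq V (seq_rep (seq_class V s))"
    "(\<lambda>n. nrm V (s n \<ominus> seq_rep (seq_class V s) n)) \<longlonglongrightarrow> 0"
    by (auto simp: seq_class_def null_rel_def)
  then show "cauchy_seq V (seq_rep (seq_class V s))"
    "(\<lambda>n. nrm V (seq_rep (seq_class V s) n \<ominus> s n)) \<longlonglongrightarrow> 0"
    using nrm_diff_commute[OF cauchy_seq_closed cauchy_seq_closed] assms by auto
qed

end

context pre_hilbert
begin

text \<open>
  \<open>C\<close> is the completion of \<open>V\<close>; it is again an inner product module over \<open>D\<close>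
  (\<open>pre_hilbert_completion\<close>) in which \<open>embed V\<close> has dense range (\<open>embed_dense\<close>). Elements are handled
  through representing Cauchy sequences, on which all operations act termwise.
\<close>

abbreviation "C \<equiv> completion D V"

lemma completion_cases:
  assumes "X \<in> carrier C"
  obtains s where "cauchy_seq V s" "X = seq_class V s"
  using assms by (auto simp: completion_def seq_class_def elim: quotientE)

lemma seq_class_closed [simp]: "cauchy_seq V s \<Longrightarrow> seq_class V s \<in> carrier C"
  by (auto simp: completion_def seq_class_def intro: quotientI)

text \<open>A Lipschitz map on representatives induces a map on classes.\<close>

lemma seq_class_map_eq:
  assumes s: "cauchy_seq V s" and f: "\<And>x. x \<in> carrier V \<Longrightarrow> f x \<in> carrier V" and K: "0 \<le> K"
    and lip: "\<And>x y. x \<in> carrier V \<Longrightarrow> y \<in> carrier V \<Longrightarrow> nrm V (f x \<ominus>\<^bsub>V\<^esub> f y) \<le> K * nrm V (x \<ominus>\<^bsub>V\<^esub> y)"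
  shows "cauchy_seq V (\<lambda>n. f (s n))"
    and "seq_class V (\<lambda>n. f (seq_rep (seq_class V s) n)) = seq_class V (\<lambda>n. f (s n))"
proof -
  have c: "cauchy_seq V (\<lambda>n. f (t n))" if "cauchy_seq V t" for t
    using that f lip K by (intro cauchy_seq_dominated[OF that, of _ _ K]) (auto simp: V.cauchy_seq_closed)
  then show "cauchy_seq V (\<lambda>n. f (s n))" using s .
  let ?r = "seq_rep (seq_class V s)"
  have "(\<lambda>n. nrm V (f (?r n) \<ominus>\<^bsub>V\<^esub> f (s n))) \<longlonglongrightarrow> 0"
  proof (rule tendsto_sandwich[OF _ _ tendsto_const])
    show "(\<lambda>n. K * nrm V (?r n \<ominus>\<^bsub>V\<^esub> s n)) \<longlonglongrightarrow> 0"
      using V.seq_rep_class(2)[OF s] by (rule tendsto_mult_right_zero)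
  qed (use s f lip V.seq_rep_class(1)[OF s] V.nrm_nonneg in
      \<open>auto intro!: always_eventually simp: V.cauchy_seq_closed\<close>)
  then show "seq_class V (\<lambda>n. f (?r n)) = seq_class V (\<lambda>n. f (s n))"
    using V.seq_class_eq_iff[OF c[OF V.seq_rep_class(1)[OF s]] c[OF s]] by simp
qed

lemma completion_zero: "\<zero>\<^bsub>C\<^esub> = seq_class V (\<lambda>n. \<zero>\<^bsub>V\<^esub>)"
  by (simp add: completion_def)

lemma completion_add:
  assumes s: "cauchy_seq V s" and t: "cauchy_seq V t"
  shows "seq_class V s \<oplus>\<^bsub>C\<^esub> seq_class V t = seq_class V (\<lambda>n. s n \<oplus>\<^bsub>V\<^esub> t n)"
proof -
  let ?r = "seq_rep (seq_class V s)" and ?q = "seq_rep (seq_class V t)"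
  note c = V.cauchy_seq_closed[OF s] V.cauchy_seq_closed[OF t]
    V.cauchy_seq_closed[OF V.seq_rep_class(1)[OF s]] V.cauchy_seq_closed[OF V.seq_rep_class(1)[OF t]]
  have "(\<lambda>n. nrm V ((?r n \<oplus>\<^bsub>V\<^esub> ?q n) \<ominus>\<^bsub>V\<^esub> (s n \<oplus>\<^bsub>V\<^esub> t n))) \<longlonglongrightarrow> 0"
  proof (rule tendsto_sandwich[OF _ _ tendsto_const])
    show "(\<lambda>n. nrm V (?r n \<ominus>\<^bsub>V\<^esub> s n) + nrm V (?q n \<ominus>\<^bsub>V\<^esub> t n)) \<longlonglongrightarrow> 0"
      using tendsto_add[OF V.seq_rep_class(2)[OF s] V.seq_rep_class(2)[OF t]] by simp
  qed (use c V.nrm_nonneg V.nrm_diff_add_le in \<open>auto intro!: always_eventually\<close>)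
  then have "seq_class V (\<lambda>n. ?r n \<oplus>\<^bsub>V\<^esub> ?q n) = seq_class V (\<lambda>n. s n \<oplus>\<^bsub>V\<^esub> t n)"
    using V.seq_class_eq_iff[OF V.cauchy_seq_add V.cauchy_seq_add] V.seq_rep_class(1) s t by simp
  then show ?thesis
    by (simp add: completion_def)
qed

lemma completion_scale:
  assumes s: "cauchy_seq V s"
  shows "c \<odot>\<^bsub>C\<^esub> seq_class V s = seq_class V (\<lambda>n. c \<odot>\<^bsub>V\<^esub> s n)"
proof -
  have "seq_class V (\<lambda>n. c \<odot>\<^bsub>V\<^esub> seq_rep (seq_class V s) n) = seq_class V (\<lambda>n. c \<odot>\<^bsub>V\<^esub> s n)"
    by (rule seq_class_map_eq[OF s, of _ "cmod c"]) (auto simp: V.nrm_smult simp flip: V.scale_diff)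
  then show ?thesis
    by (simp add: completion_def)
qed

lemma completion_ract:
  assumes s: "cauchy_seq V s" and a: "a \<in> carrier D"
  shows "cauchy_seq V (\<lambda>n. ract V (s n) a)"
    and "ract C (seq_class V s) a = seq_class V (\<lambda>n. ract V (s n) a)"
proof -
  have lip: "nrm V (ract V x a \<ominus>\<^bsub>V\<^esub> ract V y a) \<le> nrm D a * nrm V (x \<ominus>\<^bsub>V\<^esub> y)"
    if "x \<in> carrier V" "y \<in> carrier V" for x y
    using nrm_ract_le[of "x \<ominus>\<^bsub>V\<^esub> y" a] that a by (simp add: ract_diff mult.commute)
  show "cauchy_seq V (\<lambda>n. ract V (s n) a)"
    by (rule seq_class_map_eq(1)[OF s, of "\<lambda>x. ract V x a" "nrm D a"])
      (use a nrm_nonneg lip in auto)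
  have "seq_class V (\<lambda>n. ract V (seq_rep (seq_class V s) n) a) = seq_class V (\<lambda>n. ract V (s n) a)"
    by (rule seq_class_map_eq(2)[OF s, of "\<lambda>x. ract V x a" "nrm D a"])
      (use a nrm_nonneg lip in auto)
  then show "ract C (seq_class V s) a = seq_class V (\<lambda>n. ract V (s n) a)"
    by (simp add: completion_def)
qed

lemma completion_nrm:
  assumes s: "cauchy_seq V s"
  shows "(\<lambda>n. nrm V (s n)) \<longlonglongrightarrow> nrm C (seq_class V s)"
proof -
  let ?r = "seq_rep (seq_class V s)"
  note r = V.seq_rep_class[OF s]
  have "(\<lambda>n. nrm V (?r n)) \<longlonglongrightarrow> nrm C (seq_class V s)"
    using V.cauchy_seq_nrm[OF r(1)] by (simp add: completion_def convergent_LIMSEQ_iff)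
  moreover have "(\<lambda>n. nrm V (s n) - nrm V (?r n)) \<longlonglongrightarrow> 0"
  proof (rule tendsto_rabs_zero_cancel, rule tendsto_sandwich[OF _ _ tendsto_const r(2)])
    show "\<forall>\<^sub>F n in sequentially. \<bar>nrm V (s n) - nrm V (?r n)\<bar> \<le> nrm V (?r n \<ominus>\<^bsub>V\<^esub> s n)"
      using V.abs_nrm_diff_le[OF V.cauchy_seq_closed[OF r(1)] V.cauchy_seq_closed[OF s]]
      by (auto intro!: always_eventually simp: abs_minus_commute)
  qed auto
  ultimately have "(\<lambda>n. nrm V (?r n) + (nrm V (s n) - nrm V (?r n))) \<longlonglongrightarrow> nrm C (seq_class V s) + 0"
    by (rule tendsto_add)
  then show ?thesis by simp
qed

lemma cauchy_seq_inner:
  assumes s: "cauchy_seq V s" and t: "cauchy_seq V t"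
  shows "cauchy_seq D (\<lambda>n. inner V (s n) (t n))"
  unfolding cauchy_seq_def
proof (intro conjI allI impI)
  note c = V.cauchy_seq_closed[OF s] V.cauchy_seq_closed[OF t]
  show "inner V (s n) (t n) \<in> carrier D" for n
    using c by auto
  obtain K where K: "0 \<le> K" "\<And>n. nrm V (s n) \<le> K"
    using V.cauchy_seq_bounded[OF s] by blast
  obtain L where L: "0 \<le> L" "\<And>n. nrm V (t n) \<le> L"
    using V.cauchy_seq_bounded[OF t] by blast
  fix \<epsilon> :: real assume \<epsilon>: "\<epsilon> > 0"
  let ?\<delta> = "\<epsilon> / (K + L + 1)"
  have \<delta>: "?\<delta> > 0" using \<epsilon> K L by (simp add: add_nonneg_pos)
  then obtain N M where N: "\<And>m n. m \<ge> N \<Longrightarrow> n \<ge> N \<Longrightarrow> nrm V (s m \<ominus>\<^bsub>V\<^esub> s n) < ?\<delta>"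
    and M: "\<And>m n. m \<ge> M \<Longrightarrow> n \<ge> M \<Longrightarrow> nrm V (t m \<ominus>\<^bsub>V\<^esub> t n) < ?\<delta>"
    using s t unfolding cauchy_seq_def by meson
  have "nrm D (inner V (s m) (t m) \<ominus> inner V (s n) (t n)) < \<epsilon>"
    if "m \<ge> max N M" "n \<ge> max N M" for m n
  proof -
    have "nrm D (inner V (s m) (t m) \<ominus> inner V (s n) (t n))
        \<le> nrm V (s m \<ominus>\<^bsub>V\<^esub> s n) * nrm V (t m) + nrm V (s n) * nrm V (t m \<ominus>\<^bsub>V\<^esub> t n)"
      using c by (intro nrm_inner_diff_le)
    also have "\<dots> \<le> ?\<delta> * L + K * ?\<delta>"
      using N[of m n] M[of m n] that K L c V.nrm_nonneg \<delta>
      by (intro add_mono mult_mono) (auto intro: less_imp_le)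
    also have "\<dots> = ?\<delta> * (K + L)"
      by (simp only: distrib_left mult.commute[of K] add.commute)
    also have "\<dots> < ?\<delta> * (K + L + 1)"
      using \<delta> by (intro mult_strict_left_mono) auto
    also have "\<dots> = \<epsilon>"
      using K L by (simp add: add_nonneg_eq_0_iff)
    finally show ?thesis .
  qed
  then show "\<exists>N. \<forall>m\<ge>N. \<forall>n\<ge>N. nrm D (inner V (s m) (t m) \<ominus> inner V (s n) (t n)) < \<epsilon>" by blast
qed

lemma completion_inner:
  assumes s: "cauchy_seq V s" and t: "cauchy_seq V t"
  shows "converges_to D (\<lambda>n. inner V (s n) (t n)) (inner C (seq_class V s) (seq_class V t))"
proof -
  let ?r = "seq_rep (seq_class V s)" and ?q = "seq_rep (seq_class V t)"
  note r = V.seq_rep_class[OF s] and q = V.seq_rep_class[OF t]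
  note c = V.cauchy_seq_closed[OF s] V.cauchy_seq_closed[OF t]
    V.cauchy_seq_closed[OF r(1)] V.cauchy_seq_closed[OF q(1)]
  obtain a where a: "converges_to D (\<lambda>n. inner V (?r n) (?q n)) a"
    using complete[OF cauchy_seq_inner[OF r(1) q(1)]] by blast
  have eq: "inner C (seq_class V s) (seq_class V t) = a"
    unfolding completion_def using a by (auto intro!: the_equality intro: converges_to_unique)
  obtain K where K: "0 \<le> K" "\<And>n. nrm V (?r n) \<le> K"
    using V.cauchy_seq_bounded[OF r(1)] by blast
  obtain L where L: "0 \<le> L" "\<And>n. nrm V (t n) \<le> L"
    using V.cauchy_seq_bounded[OF t] by blast
  have ca: "a \<in> carrier D" using a by (simp add: converges_to_def)
  have "converges_to D (\<lambda>n. inner V (s n) (t n)) a"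
  proof (rule converges_to_squeeze[OF _ ca])
    show "inner V (s n) (t n) \<in> carrier D" for n using c by auto
    show "nrm D (inner V (s n) (t n) \<ominus> a)
      \<le> (nrm V (?r n \<ominus>\<^bsub>V\<^esub> s n) * L + K * nrm V (?q n \<ominus>\<^bsub>V\<^esub> t n)) + nrm D (inner V (?r n) (?q n) \<ominus> a)" for n
    proof -
      have "nrm D (inner V (s n) (t n) \<ominus> a) \<le> nrm D (inner V (s n) (t n) \<ominus> inner V (?r n) (?q n))
          + nrm D (inner V (?r n) (?q n) \<ominus> a)"
        using c ca by (intro nrm_diff_triangle) auto
      moreover have "nrm D (inner V (s n) (t n) \<ominus> inner V (?r n) (?q n))
          \<le> nrm V (s n \<ominus>\<^bsub>V\<^esub> ?r n) * nrm V (t n) + nrm V (?r n) * nrm V (t n \<ominus>\<^bsub>V\<^esub> ?q n)"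
        using c by (intro nrm_inner_diff_le)
      moreover have "nrm V (s n \<ominus>\<^bsub>V\<^esub> ?r n) * nrm V (t n) \<le> nrm V (?r n \<ominus>\<^bsub>V\<^esub> s n) * L"
        using c L V.nrm_nonneg V.nrm_diff_commute[of "s n" "?r n"] by (intro mult_mono) auto
      moreover have "nrm V (?r n) * nrm V (t n \<ominus>\<^bsub>V\<^esub> ?q n) \<le> K * nrm V (?q n \<ominus>\<^bsub>V\<^esub> t n)"
        using c K V.nrm_nonneg V.nrm_diff_commute[of "t n" "?q n"] by (intro mult_mono) auto
      ultimately show ?thesis by linarith
    qed
    have "(\<lambda>n. (nrm V (?r n \<ominus>\<^bsub>V\<^esub> s n) * L + K * nrm V (?q n \<ominus>\<^bsub>V\<^esub> t n)) + nrm D (inner V (?r n) (?q n) \<ominus> a))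
        \<longlonglongrightarrow> (0 * L + K * 0) + 0"
      using a by (intro tendsto_intros r(2) q(2)) (auto simp: converges_to_def)
    then show "(\<lambda>n. (nrm V (?r n \<ominus>\<^bsub>V\<^esub> s n) * L + K * nrm V (?q n \<ominus>\<^bsub>V\<^esub> t n))
        + nrm D (inner V (?r n) (?q n) \<ominus> a)) \<longlonglongrightarrow> 0" by simp
  qed
  then show ?thesis by (simp add: eq)
qed

lemma completion_minus_one_add:
  assumes s: "cauchy_seq V s"
  shows "(- 1) \<odot>\<^bsub>C\<^esub> seq_class V s \<oplus>\<^bsub>C\<^esub> seq_class V s = \<zero>\<^bsub>C\<^esub>"
proof -
  have "(- 1) \<odot>\<^bsub>V\<^esub> s n \<oplus>\<^bsub>V\<^esub> s n = \<zero>\<^bsub>V\<^esub>" for n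
    using V.neg_eq_scale[of "s n"] V.M.l_neg[of "s n"] V.cauchy_seq_closed[OF s] by simp
  then show ?thesis
    using s by (simp add: completion_scale completion_add V.cauchy_seq_scale completion_zero)
qed

lemma module_completion: "module complex_ring C"
proof (rule moduleI[OF cring_complex_ring])
  note [simp] = completion_add completion_scale completion_zero V.cauchy_seq_add V.cauchy_seq_scale
    V.cauchy_seq_const V.cauchy_seq_closed
  show "abelian_group C"
  proof (rule abelian_groupI)
    show "\<exists>Y\<in>carrier C. Y \<oplus>\<^bsub>C\<^esub> X = \<zero>\<^bsub>C\<^esub>" if "X \<in> carrier C" for X
      using that completion_minus_one_add
      by (elim completion_cases) (metis completion_scale seq_class_closed V.cauchy_seq_scale)
  qed (auto elim!: completion_cases simp: V.M.a_ac)
qed (auto elim!: completion_cases simp: completion_add completion_scale V.cauchy_seq_add V.cauchy_seq_scale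
    V.cauchy_seq_closed V.scale_add_left V.scale_add_right)

lemma pre_hilbert_completion: "pre_hilbert D C"
proof (intro pre_hilbert.intro unital_cstar_axioms pre_hilbert_axioms.intro module_completion)
  fix X Y assume X: "X \<in> carrier C" and Y: "Y \<in> carrier C"
  obtain s where s: "cauchy_seq V s" "X = seq_class V s"
    using X by (rule completion_cases)
  obtain t where t: "cauchy_seq V t" "Y = seq_class V t"
    using Y by (rule completion_cases)
  note cs = V.cauchy_seq_closed[OF s(1)] and ct = V.cauchy_seq_closed[OF t(1)]
  note lim = completion_inner[OF s(1) t(1)]
  show "inner C X Y \<in> carrier D"
    using lim by (simp add: converges_to_def s t)
  show "inner C X (c \<odot>\<^bsub>C\<^esub> Y) = c \<odot> inner C X Y" for c
    using converges_to_scale[OF lim, of c] completion_inner[OF s(1) V.cauchy_seq_scale[OF t(1)], of c]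
    by (simp add: s t completion_scale inner_scale_right cs ct converges_to_unique)
  show "adj D (inner C X Y) = inner C Y X"
    using converges_to_adj[OF lim] completion_inner[OF t(1) s(1)]
    by (simp add: s t adj_inner cs ct converges_to_unique)
  show "pos (inner C X X)"
    unfolding s(2) by (rule pos_limit[OF completion_inner[OF s(1) s(1)]]) (simp add: cs pos_inner)
  have nrm2: "(\<lambda>n. nrm V (s n)) \<longlonglongrightarrow> sqrt (nrm D (inner C X X))"
    using tendsto_real_sqrt[OF tendsto_nrm[OF completion_inner[OF s(1) s(1)]]]
    by (simp add: nrm_inner cs s(2))
  then show "nrm C X = sqrt (nrm D (inner C X X))"
    using completion_nrm[OF s(1)] by (simp add: s(2) LIMSEQ_unique)
  show "X = \<zero>\<^bsub>C\<^esub>" if "inner C X X = \<zero>"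
    unfolding s(2) completion_zero
    using nrm2 V.seq_class_eq_iff[OF s(1) V.cauchy_seq_const[of "\<zero>\<^bsub>V\<^esub>"]] that cs by simp
  {
    fix Z assume "Z \<in> carrier C"
    then obtain u where u: "cauchy_seq V u" "Z = seq_class V u"
      by (rule completion_cases)
    show "inner C X (Y \<oplus>\<^bsub>C\<^esub> Z) = inner C X Y \<oplus> inner C X Z"
      using converges_to_add[OF lim completion_inner[OF s(1) u(1)]]
        completion_inner[OF s(1) V.cauchy_seq_add[OF t(1) u(1)]]
      by (simp add: s t u completion_add inner_add_right cs ct V.cauchy_seq_closed converges_to_unique)
  }
  fix a assume a: "a \<in> carrier D"
  show "ract C X a \<in> carrier C"
    using completion_ract[OF s(1) a] by (simp add: s)
  show "inner C X (ract C Y a) = inner C X Y \<otimes> a"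
    using converges_to_mult_right[OF lim a] completion_inner[OF s(1) completion_ract(1)[OF t(1) a]]
    by (simp add: s t completion_ract[OF t(1) a] inner_ract_right cs ct a converges_to_unique)
qed

interpretation C: pre_hilbert D C by (rule pre_hilbert_completion)

lemma embed_closed [simp, intro]: "x \<in> carrier V \<Longrightarrow> embed V x \<in> carrier C"
  by (simp add: embed_def V.cauchy_seq_const)

lemma embed_zero: "embed V \<zero>\<^bsub>V\<^esub> = \<zero>\<^bsub>C\<^esub>"
  by (simp add: embed_def completion_zero)

lemma embed_add:
  "x \<in> carrier V \<Longrightarrow> y \<in> carrier V \<Longrightarrow> embed V (x \<oplus>\<^bsub>V\<^esub> y) = embed V x \<oplus>\<^bsub>C\<^esub> embed V y"
  by (simp add: embed_def completion_add V.cauchy_seq_const)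

lemma embed_scale: "x \<in> carrier V \<Longrightarrow> embed V (c \<odot>\<^bsub>V\<^esub> x) = c \<odot>\<^bsub>C\<^esub> embed V x"
  by (simp add: embed_def completion_scale V.cauchy_seq_const)

lemma embed_ract: "x \<in> carrier V \<Longrightarrow> a \<in> carrier D \<Longrightarrow> embed V (ract V x a) = ract C (embed V x) a"
  by (simp add: embed_def completion_ract V.cauchy_seq_const)

lemma embed_diff:
  "x \<in> carrier V \<Longrightarrow> y \<in> carrier V \<Longrightarrow> embed V (x \<ominus>\<^bsub>V\<^esub> y) = embed V x \<ominus>\<^bsub>C\<^esub> embed V y"
  by (simp add: a_minus_def embed_add embed_scale V.neg_eq_scale C.V.neg_eq_scale)

lemma nrm_embed: "x \<in> carrier V \<Longrightarrow> nrm C (embed V x) = nrm V x"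
  using completion_nrm[OF V.cauchy_seq_const[of x]] LIMSEQ_unique[OF tendsto_const]
  unfolding embed_def by fastforce

lemma inner_embed:
  "x \<in> carrier V \<Longrightarrow> y \<in> carrier V \<Longrightarrow> inner C (embed V x) (embed V y) = inner V x y"
  using completion_inner[OF V.cauchy_seq_const[of x] V.cauchy_seq_const[of y]]
    converges_to_const[of "inner V x y"] unfolding embed_def by (auto intro: converges_to_unique)

lemma embed_seq_converges:
  assumes s: "cauchy_seq V s"
  shows "converges_to C (\<lambda>n. embed V (s n)) (seq_class V s)"
  unfolding converges_to_def
proof (intro conjI allI)
  note c = V.cauchy_seq_closed[OF s]
  show "embed V (s n) \<in> carrier C" for n using c by auto
  show "seq_class V s \<in> carrier C" using s by simp
  show "(\<lambda>n. nrm C (embed V (s n) \<ominus>\<^bsub>C\<^esub> seq_class V s)) \<longlonglongrightarrow> 0"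
  proof (rule LIMSEQ_I)
    fix \<epsilon> :: real assume "\<epsilon> > 0"
    then obtain N where N: "\<And>m n. m \<ge> N \<Longrightarrow> n \<ge> N \<Longrightarrow> nrm V (s m \<ominus>\<^bsub>V\<^esub> s n) < \<epsilon> / 2"
      using s unfolding cauchy_seq_def by (meson half_gt_zero)
    have "nrm C (embed V (s n) \<ominus>\<^bsub>C\<^esub> seq_class V s) \<le> \<epsilon> / 2" if n: "n \<ge> N" for n
    proof -
      have eq: "embed V (s n) \<ominus>\<^bsub>C\<^esub> seq_class V s = seq_class V (\<lambda>m. s n \<oplus>\<^bsub>V\<^esub> (- 1) \<odot>\<^bsub>V\<^esub> s m)"
        using s c by (simp add: a_minus_def C.V.neg_eq_scale completion_scale embed_def completion_add
            V.cauchy_seq_const V.cauchy_seq_scale)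
      have "(\<lambda>m. nrm V (s n \<oplus>\<^bsub>V\<^esub> (- 1) \<odot>\<^bsub>V\<^esub> s m)) \<longlonglongrightarrow> nrm C (embed V (s n) \<ominus>\<^bsub>C\<^esub> seq_class V s)"
        unfolding eq using s c
        by (intro completion_nrm V.cauchy_seq_add V.cauchy_seq_const V.cauchy_seq_scale)
      then show ?thesis
      proof (rule LIMSEQ_le_const2)
        have "nrm V (s n \<oplus>\<^bsub>V\<^esub> (- 1) \<odot>\<^bsub>V\<^esub> s m) \<le> \<epsilon> / 2" if "m \<ge> N" for m
          using N[OF n that] c by (simp add: a_minus_def V.neg_eq_scale)
        then show "\<exists>N. \<forall>m\<ge>N. nrm V (s n \<oplus>\<^bsub>V\<^esub> (- 1) \<odot>\<^bsub>V\<^esub> s m) \<le> \<epsilon> / 2" by blast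
      qed
    qed
    moreover have "0 \<le> nrm C (embed V (s n) \<ominus>\<^bsub>C\<^esub> seq_class V s)" for n
      using c s by (intro C.V.nrm_nonneg) auto
    ultimately show "\<exists>N. \<forall>n\<ge>N. norm (nrm C (embed V (s n) \<ominus>\<^bsub>C\<^esub> seq_class V s) - 0) < \<epsilon>"
      using \<open>\<epsilon> > 0\<close> by (intro exI[of _ N]) (fastforce intro: order_le_less_trans[of _ "\<epsilon> / 2"])
  qed
qed

lemma embed_dense:
  assumes "X \<in> carrier C"
  obtains s where "\<And>n. s n \<in> carrier V" "converges_to C (\<lambda>n. embed V (s n)) X"
  using assms
proof (rule completion_cases)
  fix s assume "cauchy_seq V s" "X = seq_class V s"
  then show thesis
    using embed_seq_converges[of s] by (intro that[of s]) (auto simp: V.cauchy_seq_closed)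
qed

lemma embed_dense_eps:
  assumes "X \<in> carrier C" "\<epsilon> > 0"
  obtains x where "x \<in> carrier V" "nrm C (embed V x \<ominus>\<^bsub>C\<^esub> X) < \<epsilon>"
proof -
  obtain s where s: "\<And>n. s n \<in> carrier V" "converges_to C (\<lambda>n. embed V (s n)) X"
    using embed_dense[OF assms(1)] by blast
  then have "\<forall>\<^sub>F n in sequentially. nrm C (embed V (s n) \<ominus>\<^bsub>C\<^esub> X) < \<epsilon>"
    using assms(2) by (intro order_tendstoD(2)[of _ 0]) (auto simp: converges_to_def)
  then show thesis
    using that s(1) by (auto simp: eventually_sequentially)
qed

lemma completion_eq_by_inner:
  assumes "X \<in> carrier C" "Y \<in> carrier C"
    and eq: "\<And>z. z \<in> carrier V \<Longrightarrow> inner C (embed V z) X = inner C (embed V z) Y"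
  shows "X = Y"
proof (rule C.eq_by_inner[OF assms(1,2)])
  fix Z assume "Z \<in> carrier C"
  then obtain s where s: "\<And>n. s n \<in> carrier V" "converges_to C (\<lambda>n. embed V (s n)) Z"
    using embed_dense by blast
  have "converges_to D (\<lambda>n. inner C (embed V (s n)) X) (inner C Z X)"
    "converges_to D (\<lambda>n. inner C (embed V (s n)) Y) (inner C Z Y)"
    using s(2) assms by (intro C.converges_to_inner C.V.converges_to_const; simp)+
  then show "inner C Z X = inner C Z Y"
    by (simp add: eq s(1) converges_to_unique)
qed

end

section \<open>Adjointable operators\<close>

context pre_hilbert
begin

text \<open>
  \<open>L\<close> is the algebra of adjointable operators on \<open>V\<close>. No completeness of \<open>V\<close> is needed below.
\<close>

abbreviation "L \<equiv> adjointable_algebra V"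

lemma L_simps:
  "\<zero>\<^bsub>L\<^esub> = (\<lambda>x\<in>carrier V. \<zero>\<^bsub>V\<^esub>)"
  "S \<otimes>\<^bsub>L\<^esub> T = (\<lambda>x\<in>carrier V. S (T x))"
  "S \<oplus>\<^bsub>L\<^esub> T = (\<lambda>x\<in>carrier V. S x \<oplus>\<^bsub>V\<^esub> T x)"
  "c \<odot>\<^bsub>L\<^esub> T = (\<lambda>x\<in>carrier V. c \<odot>\<^bsub>V\<^esub> T x)"
  "nrm L T = op_norm V V T"
  by (simp_all add: adjointable_algebra_def)

lemma L_carrier:
  "T \<in> carrier L \<longleftrightarrow> T \<in> carrier V \<rightarrow>\<^sub>E carrier V \<and> bounded_map V V T
    \<and> (\<exists>S \<in> carrier V \<rightarrow>\<^sub>E carrier V. is_adjoint V T S)"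
  by (simp add: adjointable_algebra_def)

lemma is_adjointD:
  "is_adjoint V T S \<Longrightarrow> x \<in> carrier V \<Longrightarrow> y \<in> carrier V \<Longrightarrow> inner V (T x) y = inner V x (S y)"
  by (simp add: is_adjoint_def)

lemma is_adjoint_sym:
  assumes "is_adjoint V T S" "T \<in> carrier V \<rightarrow> carrier V" "S \<in> carrier V \<rightarrow> carrier V"
  shows "is_adjoint V S T"
  unfolding is_adjoint_def
proof (intro ballI)
  fix x y assume xy: "x \<in> carrier V" "y \<in> carrier V"
  then have c: "S x \<in> carrier V" "T y \<in> carrier V"
    using assms(2,3) by auto
  show "inner V (S x) y = inner V x (T y)"
    using is_adjointD[OF assms(1) xy(2,1)] adj_inner[OF xy(2) c(1)] adj_inner[OF c(2) xy(1)] by simp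
qed

lemma is_adjoint_linear:
  assumes "is_adjoint V T S" and T: "T \<in> carrier V \<rightarrow> carrier V" and S: "S \<in> carrier V \<rightarrow> carrier V"
  shows "linear_map V V T" and "x \<in> carrier V \<Longrightarrow> a \<in> carrier D \<Longrightarrow> T (ract V x a) = ract V (T x) a"
proof -
  note adj = is_adjointD[OF is_adjoint_sym[OF assms], symmetric]
  have Tc: "x \<in> carrier V \<Longrightarrow> T x \<in> carrier V" and Sc: "x \<in> carrier V \<Longrightarrow> S x \<in> carrier V" for x
    using T S by auto
  show "linear_map V V T"
    unfolding linear_map_def
    by (intro conjI ballI allI; (rule eq_by_inner)?)
      (auto simp: Tc Sc adj inner_add_right inner_scale_right)
  show "T (ract V x a) = ract V (T x) a" if "x \<in> carrier V" "a \<in> carrier D"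
    using that by (intro eq_by_inner) (auto simp: Tc Sc adj inner_ract_right)
qed

lemma is_adjoint_bound:
  assumes "is_adjoint V T S" and T: "T \<in> carrier V \<rightarrow> carrier V" and S: "S \<in> carrier V \<rightarrow> carrier V"
    and K: "\<And>x. x \<in> carrier V \<Longrightarrow> nrm V (T x) \<le> K * nrm V x" and y: "y \<in> carrier V"
  shows "nrm V (S y) \<le> K * nrm V y"
proof (cases "nrm V (S y) = 0")
  case True
  have "K * nrm V y \<ge> nrm V (T y)" using K[OF y] .
  moreover have "nrm V (T y) \<ge> 0" using T y V.nrm_nonneg by auto
  ultimately show ?thesis using True by simp
next
  case False
  have Sy: "S y \<in> carrier V" and TSy: "T (S y) \<in> carrier V" using S T y by auto
  have "nrm V (S y) * nrm V (S y) = nrm D (inner V (T (S y)) y)"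
    using is_adjointD[OF assms(1) Sy y] nrm_V_square[OF Sy] by (simp add: power2_eq_square)
  also have "\<dots> \<le> nrm V (T (S y)) * nrm V y"
    by (rule cauchy_schwarz[OF TSy y])
  also have "\<dots> \<le> (K * nrm V (S y)) * nrm V y"
    by (rule mult_right_mono[OF K[OF Sy] V.nrm_nonneg[OF y]])
  finally have "nrm V (S y) * nrm V (S y) \<le> nrm V (S y) * (K * nrm V y)"
    by (simp add: mult_ac)
  then show ?thesis
    using False V.nrm_nonneg[OF Sy] by (auto intro: mult_left_le_imp_le)
qed

text \<open>
  Linearity of \<open>T\<close> and \<open>S\<close> and boundedness of \<open>S\<close> are automatic.
\<close>

lemma adjointableI:
  assumes T: "T \<in> carrier V \<rightarrow>\<^sub>E carrier V" and S: "S \<in> carrier V \<rightarrow>\<^sub>E carrier V"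
    and adj: "is_adjoint V T S" and K: "\<And>x. x \<in> carrier V \<Longrightarrow> nrm V (T x) \<le> K * nrm V x"
  shows "T \<in> carrier L"
  unfolding L_carrier bounded_map_def
  using assms is_adjoint_linear(1)[OF adj] by (auto simp: PiE_def)

lemma adj_L_eqI:
  assumes T: "T \<in> carrier V \<rightarrow> carrier V" and S: "S \<in> carrier V \<rightarrow>\<^sub>E carrier V"
    and adj: "is_adjoint V T S"
  shows "adj L T = S"
proof -
  have "S' = S" if "S' \<in> carrier V \<rightarrow>\<^sub>E carrier V" "is_adjoint V T S'" for S'
  proof (rule PiE_ext[OF that(1) S])
    fix y assume y: "y \<in> carrier V"
    show "S' y = S y"
      using y that S T is_adjointD[OF adj _ y] is_adjointD[OF that(2) _ y]
      by (intro eq_by_inner) (auto simp: PiE_def)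
  qed
  then have "(THE S. S \<in> carrier V \<rightarrow>\<^sub>E carrier V \<and> is_adjoint V T S) = S"
    using S adj by (intro the_equality) blast+
  then show ?thesis
    by (simp add: adjointable_algebra_def)
qed

lemma L_PiE: "T \<in> carrier L \<Longrightarrow> T \<in> carrier V \<rightarrow>\<^sub>E carrier V"
  by (simp add: L_carrier)

lemma L_app [simp, intro]: "T \<in> carrier L \<Longrightarrow> x \<in> carrier V \<Longrightarrow> T x \<in> carrier V"
  by (auto simp: L_carrier)

lemma L_linear: "T \<in> carrier L \<Longrightarrow> linear_map V V T"
  by (simp add: L_carrier bounded_map_def)

lemmas L_add = linear_mapD(2)[OF L_linear] and L_scale = linear_mapD(3)[OF L_linear]

lemma L_diff: "T \<in> carrier L \<Longrightarrow> x \<in> carrier V \<Longrightarrow> y \<in> carrier V \<Longrightarrow> T (x \<ominus>\<^bsub>V\<^esub> y) = T x \<ominus>\<^bsub>V\<^esub> T y"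
  by (rule linear_map_diff[OF V.normed_space_axioms V.normed_space_axioms L_linear])

lemma L_zero: "T \<in> carrier L \<Longrightarrow> T \<zero>\<^bsub>V\<^esub> = \<zero>\<^bsub>V\<^esub>"
  using L_scale[of T "\<zero>\<^bsub>V\<^esub>" 0] by simp

lemma L_bound: "T \<in> carrier L \<Longrightarrow> x \<in> carrier V \<Longrightarrow> nrm V (T x) \<le> nrm L T * nrm V x"
  unfolding L_simps
  by (rule op_norm_bound[OF V.normed_space_axioms V.normed_space_axioms]) (simp add: L_carrier)

lemma nrm_L_nonneg: "T \<in> carrier L \<Longrightarrow> 0 \<le> nrm L T"
  unfolding L_simps
  by (rule op_norm_nonneg[OF V.normed_space_axioms V.normed_space_axioms]) (simp add: L_carrier)

lemma nrm_L_least: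
  assumes "0 \<le> K" "\<And>x. x \<in> carrier V \<Longrightarrow> nrm V (T x) \<le> K * nrm V x"
  shows "nrm L T \<le> K"
  unfolding L_simps
proof (rule op_norm_least[OF V.normed_space_axioms])
  fix x assume "x \<in> carrier V" "nrm V x \<le> 1"
  then show "nrm V (T x) \<le> K"
    using assms(2)[of x] mult_left_mono[of "nrm V x" 1 K] assms(1) by simp
qed

lemma L_eqI:
  assumes "S \<in> carrier L" "T \<in> carrier L" "\<And>x. x \<in> carrier V \<Longrightarrow> S x = T x"
  shows "S = T"
  using PiE_ext[OF L_PiE L_PiE] assms by blast

lemma adj_L:
  assumes "T \<in> carrier L"
  shows "adj L T \<in> carrier L" and "is_adjoint V T (adj L T)"
proof -
  obtain S where S: "S \<in> carrier V \<rightarrow>\<^sub>E carrier V" "is_adjoint V T S"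
    using assms by (auto simp: L_carrier)
  have T: "T \<in> carrier V \<rightarrow>\<^sub>E carrier V" using assms by (rule L_PiE)
  have eq: "adj L T = S"
    using T S by (intro adj_L_eqI) (auto simp: PiE_def)
  show "is_adjoint V T (adj L T)" using S by (simp add: eq)
  show "adj L T \<in> carrier L"
    unfolding eq
  proof (rule adjointableI[OF S(1) T])
    show "is_adjoint V S T"
      by (rule is_adjoint_sym[OF S(2)]) (use T S in \<open>auto simp: PiE_def\<close>)
    show "nrm V (S x) \<le> nrm L T * nrm V x" if "x \<in> carrier V" for x
      by (rule is_adjoint_bound[OF S(2) _ _ L_bound[OF assms] that]) (use T S in \<open>auto simp: PiE_def\<close>)
  qed
qed

lemma L_ract: "T \<in> carrier L \<Longrightarrow> x \<in> carrier V \<Longrightarrow> a \<in> carrier D \<Longrightarrow> T (ract V x a) = ract V (T x) a"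
  using is_adjoint_linear(2)[of T "adj L T" x a] adj_L L_app by blast

lemma inner_adj_right:
  "T \<in> carrier L \<Longrightarrow> x \<in> carrier V \<Longrightarrow> y \<in> carrier V \<Longrightarrow> inner V x (adj L T y) = inner V (T x) y"
  using is_adjointD[OF adj_L(2)] by simp

lemma inner_adj_left:
  assumes "T \<in> carrier L" "x \<in> carrier V" "y \<in> carrier V"
  shows "inner V (adj L T x) y = inner V x (T y)"
  using inner_adj_right[OF assms(1,3,2)] adj_inner[of y "adj L T x"] adj_inner[of "T y" x] assms adj_L(1)
  by simp

lemma adj_L_unique:
  assumes "T \<in> carrier L" "S \<in> carrier L"
    "\<And>x y. x \<in> carrier V \<Longrightarrow> y \<in> carrier V \<Longrightarrow> inner V (T x) y = inner V x (S y)"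
  shows "adj L T = S"
  using assms L_PiE[of S] by (intro adj_L_eqI) (auto simp: is_adjoint_def)

lemma nrm_adj_L_le: "T \<in> carrier L \<Longrightarrow> nrm L (adj L T) \<le> nrm L T"
  using nrm_L_nonneg adj_L
  by (intro nrm_L_least is_adjoint_bound[OF adj_L(2), where K = "nrm L T"] L_bound) auto

lemma zero_L: "\<zero>\<^bsub>L\<^esub> \<in> carrier L"
  by (rule adjointableI[of _ "\<zero>\<^bsub>L\<^esub>" 0]) (auto simp: L_simps is_adjoint_def)

lemma add_L:
  assumes "S \<in> carrier L" "T \<in> carrier L"
  shows "S \<oplus>\<^bsub>L\<^esub> T \<in> carrier L" and "adj L (S \<oplus>\<^bsub>L\<^esub> T) = adj L S \<oplus>\<^bsub>L\<^esub> adj L T"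
    and "nrm L (S \<oplus>\<^bsub>L\<^esub> T) \<le> nrm L S + nrm L T"
proof -
  note a = adj_L(1)[OF assms(1)] adj_L(1)[OF assms(2)]
  have 1: "S \<oplus>\<^bsub>L\<^esub> T \<in> carrier V \<rightarrow>\<^sub>E carrier V" "adj L S \<oplus>\<^bsub>L\<^esub> adj L T \<in> carrier V \<rightarrow>\<^sub>E carrier V"
    using assms a by (auto simp: L_simps)
  have 2: "is_adjoint V (S \<oplus>\<^bsub>L\<^esub> T) (adj L S \<oplus>\<^bsub>L\<^esub> adj L T)"
    using assms a by (auto simp: L_simps is_adjoint_def inner_add_left inner_add_right inner_adj_right)
  have 3: "nrm V ((S \<oplus>\<^bsub>L\<^esub> T) x) \<le> (nrm L S + nrm L T) * nrm V x" if "x \<in> carrier V" for x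
    using V.nrm_triangle[of "S x" "T x"] L_bound[OF assms(1) that] L_bound[OF assms(2) that] assms that
    by (simp add: L_simps(3) distrib_right)
  show "S \<oplus>\<^bsub>L\<^esub> T \<in> carrier L" by (rule adjointableI[OF 1 2 3])
  show "adj L (S \<oplus>\<^bsub>L\<^esub> T) = adj L S \<oplus>\<^bsub>L\<^esub> adj L T"
    using 1 2 by (intro adj_L_eqI) (auto simp: PiE_def)
  show "nrm L (S \<oplus>\<^bsub>L\<^esub> T) \<le> nrm L S + nrm L T"
    using 3 nrm_L_nonneg assms by (intro nrm_L_least) auto
qed

lemma scale_L:
  assumes "T \<in> carrier L"
  shows "c \<odot>\<^bsub>L\<^esub> T \<in> carrier L" and "adj L (c \<odot>\<^bsub>L\<^esub> T) = cnj c \<odot>\<^bsub>L\<^esub> adj L T"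
    and "nrm L (c \<odot>\<^bsub>L\<^esub> T) \<le> cmod c * nrm L T"
proof -
  note a = adj_L(1)[OF assms(1)]
  have 1: "c \<odot>\<^bsub>L\<^esub> T \<in> carrier V \<rightarrow>\<^sub>E carrier V" "cnj c \<odot>\<^bsub>L\<^esub> adj L T \<in> carrier V \<rightarrow>\<^sub>E carrier V"
    using assms a by (auto simp: L_simps)
  have 2: "is_adjoint V (c \<odot>\<^bsub>L\<^esub> T) (cnj c \<odot>\<^bsub>L\<^esub> adj L T)"
    using assms a by (auto simp: L_simps is_adjoint_def inner_scale_left inner_scale_right inner_adj_right)
  have 3: "nrm V ((c \<odot>\<^bsub>L\<^esub> T) x) \<le> (cmod c * nrm L T) * nrm V x" if "x \<in> carrier V" for x
    using mult_left_mono[OF L_bound[OF assms that], of "cmod c"] assms that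
    by (simp add: L_simps(4) V.nrm_smult mult.assoc)
  show "c \<odot>\<^bsub>L\<^esub> T \<in> carrier L" by (rule adjointableI[OF 1 2 3])
  show "adj L (c \<odot>\<^bsub>L\<^esub> T) = cnj c \<odot>\<^bsub>L\<^esub> adj L T"
    using 1 2 by (intro adj_L_eqI) (auto simp: PiE_def)
  show "nrm L (c \<odot>\<^bsub>L\<^esub> T) \<le> cmod c * nrm L T"
    using 3 nrm_L_nonneg assms by (intro nrm_L_least) auto
qed

lemma mult_L:
  assumes "S \<in> carrier L" "T \<in> carrier L"
  shows "S \<otimes>\<^bsub>L\<^esub> T \<in> carrier L" and "adj L (S \<otimes>\<^bsub>L\<^esub> T) = adj L T \<otimes>\<^bsub>L\<^esub> adj L S"
    and "nrm L (S \<otimes>\<^bsub>L\<^esub> T) \<le> nrm L S * nrm L T"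
proof -
  note a = adj_L(1)[OF assms(1)] adj_L(1)[OF assms(2)]
  have 1: "S \<otimes>\<^bsub>L\<^esub> T \<in> carrier V \<rightarrow>\<^sub>E carrier V" "adj L T \<otimes>\<^bsub>L\<^esub> adj L S \<in> carrier V \<rightarrow>\<^sub>E carrier V"
    using assms a by (auto simp: L_simps)
  have 2: "is_adjoint V (S \<otimes>\<^bsub>L\<^esub> T) (adj L T \<otimes>\<^bsub>L\<^esub> adj L S)"
    using assms a by (auto simp: L_simps is_adjoint_def inner_adj_right)
  have 3: "nrm V ((S \<otimes>\<^bsub>L\<^esub> T) x) \<le> (nrm L S * nrm L T) * nrm V x" if "x \<in> carrier V" for x
    using L_bound[OF assms(1), of "T x"] mult_left_mono[OF L_bound[OF assms(2) that] nrm_L_nonneg[OF assms(1)]]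
      assms that by (simp add: L_simps(2) mult.assoc)
  show "S \<otimes>\<^bsub>L\<^esub> T \<in> carrier L" by (rule adjointableI[OF 1 2 3])
  show "adj L (S \<otimes>\<^bsub>L\<^esub> T) = adj L T \<otimes>\<^bsub>L\<^esub> adj L S"
    using 1 2 by (intro adj_L_eqI) (auto simp: PiE_def)
  show "nrm L (S \<otimes>\<^bsub>L\<^esub> T) \<le> nrm L S * nrm L T"
    using 3 nrm_L_nonneg assms by (intro nrm_L_least) auto
qed

lemma nrm_scale_L:
  assumes "T \<in> carrier L"
  shows "nrm L (c \<odot>\<^bsub>L\<^esub> T) = cmod c * nrm L T"
proof (cases "c = 0")
  case True
  then show ?thesis
    using scale_L(3)[OF assms, of 0] nrm_L_nonneg[OF scale_L(1)[OF assms, of 0]] by simp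
next
  case False
  have "(1 / c) \<odot>\<^bsub>L\<^esub> (c \<odot>\<^bsub>L\<^esub> T) = T"
    using False assms by (intro L_eqI scale_L) (auto simp: L_simps)
  then have "nrm L T \<le> cmod (1 / c) * nrm L (c \<odot>\<^bsub>L\<^esub> T)"
    using scale_L(3)[OF scale_L(1)[OF assms, of c], of "1 / c"] by simp
  then show ?thesis
    using scale_L(3)[OF assms, of c] False by (simp add: norm_divide field_simps)
qed

lemma normed_space_L: "normed_space L"
proof (rule normed_spaceI)
  fix T assume T: "T \<in> carrier L" "nrm L T = 0"
  have "nrm V (T x) = 0" if "x \<in> carrier V" for x
    using L_bound[OF T(1) that] V.nrm_nonneg[of "T x"] T that by simp
  then show "T = \<zero>\<^bsub>L\<^esub>"
    using T by (intro L_eqI zero_L) (auto simp: L_simps(1) V.nrm_eq_0)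
qed (auto simp: zero_L add_L scale_L nrm_L_nonneg nrm_scale_L
      intro!: L_eqI, auto simp: L_simps V.M.a_ac V.scale_add_left V.scale_add_right)

sublocale L: normed_space L by (rule normed_space_L)

lemma L_app_diff:
  assumes "S \<in> carrier L" "T \<in> carrier L" "x \<in> carrier V"
  shows "(S \<ominus>\<^bsub>L\<^esub> T) x = S x \<ominus>\<^bsub>V\<^esub> T x"
  using assms by (simp add: a_minus_def L.neg_eq_scale L_simps V.neg_eq_scale)

end

section \<open>Extending maps to completions\<close>

context pre_hilbert
begin

interpretation C: pre_hilbert D C by (rule pre_hilbert_completion)

text \<open>Bounded operators and bounded maps into a Banach space extend to the completion.\<close>

lemma extend_operator:
  assumes T: "linear_map V V T" and K: "0 \<le> K" "\<And>x. x \<in> carrier V \<Longrightarrow> nrm V (T x) \<le> K * nrm V x"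
  obtains T' where "T' \<in> carrier C \<rightarrow>\<^sub>E carrier C" "linear_map C C T'"
    "\<And>X. X \<in> carrier C \<Longrightarrow> nrm C (T' X) \<le> K * nrm C X"
    "\<And>x. x \<in> carrier V \<Longrightarrow> T' (embed V x) = embed V (T x)"
proof -
  define T' where "T' = (\<lambda>X\<in>carrier C. seq_class V (\<lambda>n. T (seq_rep X n)))"
  have lip: "nrm V (T x \<ominus>\<^bsub>V\<^esub> T y) \<le> K * nrm V (x \<ominus>\<^bsub>V\<^esub> y)" if "x \<in> carrier V" "y \<in> carrier V" for x y
    using K(2)[of "x \<ominus>\<^bsub>V\<^esub> y"] that
    by (simp add: linear_map_diff[OF V.normed_space_axioms V.normed_space_axioms T])
  have cs: "cauchy_seq V (\<lambda>n. T (s n))" and T': "T' (seq_class V s) = seq_class V (\<lambda>n. T (s n))"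
    if s: "cauchy_seq V s" for s
    using seq_class_map_eq[OF s, of T, OF linear_mapD(1)[OF T] K(1) lip] s by (auto simp: T'_def)
  show thesis
  proof (rule that)
    show "T' \<in> carrier C \<rightarrow>\<^sub>E carrier C"
    proof
      show "T' X \<in> carrier C" if "X \<in> carrier C" for X
        using that by (rule completion_cases) (auto simp: T' cs)
    qed (simp add: T'_def)
    have "T' (X \<oplus>\<^bsub>C\<^esub> Y) = T' X \<oplus>\<^bsub>C\<^esub> T' Y" if X: "X \<in> carrier C" and Y: "Y \<in> carrier C" for X Y
    proof -
      obtain s where s: "cauchy_seq V s" "X = seq_class V s" using X by (rule completion_cases)
      obtain t where t: "cauchy_seq V t" "Y = seq_class V t" using Y by (rule completion_cases)
      show ?thesis
        using s(1) t(1) V.cauchy_seq_closed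
        by (simp add: s t completion_add V.cauchy_seq_add T' cs linear_mapD[OF T])
    qed
    moreover have "T' (c \<odot>\<^bsub>C\<^esub> X) = c \<odot>\<^bsub>C\<^esub> T' X" if X: "X \<in> carrier C" for c X
    proof -
      obtain s where s: "cauchy_seq V s" "X = seq_class V s" using X by (rule completion_cases)
      show ?thesis
        using s(1) V.cauchy_seq_closed
        by (simp add: s completion_scale V.cauchy_seq_scale T' cs linear_mapD[OF T])
    qed
    moreover have "T' X \<in> carrier C" if "X \<in> carrier C" for X
      using that by (rule completion_cases) (auto simp: T' cs)
    ultimately show "linear_map C C T'"
      by (simp add: linear_map_def)
    show "nrm C (T' X) \<le> K * nrm C X" if "X \<in> carrier C" for X
    proof -
      obtain s where s: "cauchy_seq V s" "X = seq_class V s"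
        using \<open>X \<in> carrier C\<close> by (rule completion_cases)
      show ?thesis
        unfolding s(2) T'[OF s(1)]
        by (rule LIMSEQ_le[OF completion_nrm[OF cs[OF s(1)]] tendsto_mult_left[OF completion_nrm[OF s(1)]]])
          (use K V.cauchy_seq_closed[OF s(1)] in auto)
    qed
    show "T' (embed V x) = embed V (T x)" if "x \<in> carrier V" for x
      using that T' by (simp add: embed_def V.cauchy_seq_const)
  qed
qed

lemma extend_functional:
  assumes W: "banach_space W" and P: "linear_map V W P"
    and K: "0 \<le> K" "\<And>x. x \<in> carrier V \<Longrightarrow> nrm W (P x) \<le> K * nrm V x"
  obtains P' where "linear_map C W P'" "\<And>X. X \<in> carrier C \<Longrightarrow> nrm W (P' X) \<le> K * nrm C X"
    "\<And>x. x \<in> carrier V \<Longrightarrow> P' (embed V x) = P x"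
proof -
  interpret W: banach_space W by (rule W)
  define P' where "P' = (\<lambda>X. THE w. converges_to W (\<lambda>n. P (seq_rep X n)) w)"
  have lip: "nrm W (P x \<ominus>\<^bsub>W\<^esub> P y) \<le> K * nrm V (x \<ominus>\<^bsub>V\<^esub> y)" if "x \<in> carrier V" "y \<in> carrier V" for x y
    using K(2)[of "x \<ominus>\<^bsub>V\<^esub> y"] that
    by (simp add: linear_map_diff[OF V.normed_space_axioms W.normed_space_axioms P])
  note Pc = linear_mapD(1)[OF P]
  have lim: "converges_to W (\<lambda>n. P (s n)) (P' (seq_class V s))" if s: "cauchy_seq V s" for s
  proof -
    let ?r = "seq_rep (seq_class V s)"
    note r = V.seq_rep_class[OF s]
    note c = V.cauchy_seq_closed[OF s] V.cauchy_seq_closed[OF r(1)]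
    have "cauchy_seq W (\<lambda>n. P (?r n))"
      using c lip Pc K(1) by (intro cauchy_seq_dominated[OF r(1), of _ _ K]) auto
    then obtain w where w: "converges_to W (\<lambda>n. P (?r n)) w"
      using W.complete by blast
    have eq: "P' (seq_class V s) = w"
      unfolding P'_def using w by (auto intro!: the_equality intro: W.converges_to_unique)
    have wc: "w \<in> carrier W" using w by (simp add: converges_to_def)
    show ?thesis
      unfolding eq
    proof (rule W.converges_to_squeeze[OF _ wc])
      show "P (s n) \<in> carrier W" for n using c Pc by auto
      show "nrm W (P (s n) \<ominus>\<^bsub>W\<^esub> w) \<le> K * nrm V (?r n \<ominus>\<^bsub>V\<^esub> s n) + nrm W (P (?r n) \<ominus>\<^bsub>W\<^esub> w)" for n
        using W.nrm_diff_triangle[of "P (s n)" "P (?r n)" w] lip[of "s n" "?r n"] c Pc wc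
          V.nrm_diff_commute[of "s n" "?r n"] by simp
      have "(\<lambda>n. K * nrm V (?r n \<ominus>\<^bsub>V\<^esub> s n) + nrm W (P (?r n) \<ominus>\<^bsub>W\<^esub> w)) \<longlonglongrightarrow> K * 0 + 0"
        using w by (intro tendsto_intros r(2)) (auto simp: converges_to_def)
      then show "(\<lambda>n. K * nrm V (?r n \<ominus>\<^bsub>V\<^esub> s n) + nrm W (P (?r n) \<ominus>\<^bsub>W\<^esub> w)) \<longlonglongrightarrow> 0" by simp
    qed
  qed
  show thesis
  proof (rule that)
    have "P' (X \<oplus>\<^bsub>C\<^esub> Y) = P' X \<oplus>\<^bsub>W\<^esub> P' Y" if X: "X \<in> carrier C" and Y: "Y \<in> carrier C" for X Y
    proof -
      obtain s where s: "cauchy_seq V s" "X = seq_class V s" using X by (rule completion_cases)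
      obtain t where t: "cauchy_seq V t" "Y = seq_class V t" using Y by (rule completion_cases)
      show ?thesis
        using W.converges_to_add[OF lim[OF s(1)] lim[OF t(1)]] lim[OF V.cauchy_seq_add[OF s(1) t(1)]]
          V.cauchy_seq_closed s(1) t(1)
        by (simp add: s t completion_add linear_mapD[OF P] W.converges_to_unique)
    qed
    moreover have "P' (c \<odot>\<^bsub>C\<^esub> X) = c \<odot>\<^bsub>W\<^esub> P' X" if X: "X \<in> carrier C" for c X
    proof -
      obtain s where s: "cauchy_seq V s" "X = seq_class V s" using X by (rule completion_cases)
      show ?thesis
        using W.converges_to_scale[OF lim[OF s(1)], of c] lim[OF V.cauchy_seq_scale[OF s(1), of c]]
          V.cauchy_seq_closed[OF s(1)]
        by (simp add: s completion_scale linear_mapD[OF P] W.converges_to_unique)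
    qed
    moreover have "P' X \<in> carrier W" if X: "X \<in> carrier C" for X
      using X by (rule completion_cases) (use lim in \<open>auto simp: converges_to_def\<close>)
    ultimately show "linear_map C W P'"
      by (auto simp: linear_map_def)
    show "nrm W (P' X) \<le> K * nrm C X" if "X \<in> carrier C" for X
    proof -
      obtain s where s: "cauchy_seq V s" "X = seq_class V s"
        using \<open>X \<in> carrier C\<close> by (rule completion_cases)
      show ?thesis
        unfolding s(2)
        by (rule LIMSEQ_le[OF W.tendsto_nrm[OF lim[OF s(1)]] tendsto_mult_left[OF completion_nrm[OF s(1)]]])
          (use K V.cauchy_seq_closed[OF s(1)] in auto)
    qed
    show "P' (embed V x) = P x" if "x \<in> carrier V" for x
      using that lim[OF V.cauchy_seq_const[of x]] W.converges_to_const[of "P x"] Pc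
      by (auto simp: embed_def intro: W.converges_to_unique)
  qed
qed

lemma C_op_eqI:
  assumes S: "S \<in> carrier C.L" and T: "T \<in> carrier C.L"
    and eq: "\<And>x. x \<in> carrier V \<Longrightarrow> S (embed V x) = T (embed V x)"
  shows "S = T"
proof (rule C.L_eqI[OF S T])
  fix X assume "X \<in> carrier C"
  then obtain s where s: "\<And>n. s n \<in> carrier V" "converges_to C (\<lambda>n. embed V (s n)) X"
    using embed_dense by blast
  note conv = converges_to_linear_map[OF C.V.normed_space_axioms C.V.normed_space_axioms
      C.L_linear C.L_bound s(2)]
  show "S X = T X"
    using conv[OF S S] conv[OF T T] eq[OF s(1)] by (simp add: C.V.converges_to_unique)
qed

text \<open>
  Two bounded operators on \<open>V\<close> adjoint to each other extend to an adjointable operator on the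
  completion.
\<close>

lemma extend_adjoint_pair:
  assumes T: "linear_map V V T" "\<And>x. x \<in> carrier V \<Longrightarrow> nrm V (T x) \<le> K * nrm V x"
    and S: "linear_map V V S" "\<And>x. x \<in> carrier V \<Longrightarrow> nrm V (S x) \<le> K * nrm V x"
    and K: "0 \<le> K"
    and adj: "\<And>x y. x \<in> carrier V \<Longrightarrow> y \<in> carrier V \<Longrightarrow> inner V (T x) y = inner V x (S y)"
  obtains T' where "T' \<in> carrier C.L" "\<And>x. x \<in> carrier V \<Longrightarrow> T' (embed V x) = embed V (T x)"
proof -
  obtain T' where T': "T' \<in> carrier C \<rightarrow>\<^sub>E carrier C" "linear_map C C T'"
    "\<And>X. X \<in> carrier C \<Longrightarrow> nrm C (T' X) \<le> K * nrm C X"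
    "\<And>x. x \<in> carrier V \<Longrightarrow> T' (embed V x) = embed V (T x)"
    using extend_operator[OF T(1) K T(2)] by blast
  obtain S' where S': "S' \<in> carrier C \<rightarrow>\<^sub>E carrier C" "linear_map C C S'"
    "\<And>X. X \<in> carrier C \<Longrightarrow> nrm C (S' X) \<le> K * nrm C X"
    "\<And>x. x \<in> carrier V \<Longrightarrow> S' (embed V x) = embed V (S x)"
    using extend_operator[OF S(1) K S(2)] by blast
  have "is_adjoint C T' S'"
    unfolding is_adjoint_def
  proof (intro ballI)
    fix X Y assume X: "X \<in> carrier C" and Y: "Y \<in> carrier C"
    obtain s where s: "\<And>n. s n \<in> carrier V" "converges_to C (\<lambda>n. embed V (s n)) X"
      using embed_dense[OF X] by blast
    obtain t where t: "\<And>n. t n \<in> carrier V" "converges_to C (\<lambda>n. embed V (t n)) Y"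
      using embed_dense[OF Y] by blast
    note conv = converges_to_linear_map[OF C.V.normed_space_axioms C.V.normed_space_axioms]
    have "converges_to D (\<lambda>n. inner C (T' (embed V (s n))) (embed V (t n))) (inner C (T' X) Y)"
      by (intro C.converges_to_inner conv[OF T'(2,3)] s t)
    moreover have "converges_to D (\<lambda>n. inner C (embed V (s n)) (S' (embed V (t n)))) (inner C X (S' Y))"
      by (intro C.converges_to_inner conv[OF S'(2,3)] s t)
    moreover have "inner C (T' (embed V (s n))) (embed V (t n)) = inner C (embed V (s n)) (S' (embed V (t n)))" for n
      using s(1) t(1) by (simp add: T' S' inner_embed linear_mapD(1)[OF T(1)] linear_mapD(1)[OF S(1)] adj)
    ultimately show "inner C (T' X) Y = inner C X (S' Y)"
      by (simp add: converges_to_unique)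
  qed
  then have "T' \<in> carrier C.L"
    using T' S' by (intro C.adjointableI)
  then show thesis
    using that T'(4) by blast
qed

end

section \<open>C*-algebras of adjointable operators\<close>

text \<open>
  Dividing by \<open>K + 1\<close> rather than by \<open>K\<close> avoids the case \<open>K = 0\<close>.
\<close>

lemma mult_div_add_one_le: "0 \<le> K \<Longrightarrow> 0 < \<epsilon> \<Longrightarrow> K * (\<epsilon> / (K + 1)) \<le> \<epsilon>" for K \<epsilon> :: real
  by (simp add: field_simps)

context pre_hilbert
begin

lemma mult_L_app [simp]: "x \<in> carrier V \<Longrightarrow> (S \<otimes>\<^bsub>L\<^esub> T) x = S (T x)"
  by (simp add: L_simps)

lemma add_L_app [simp]: "x \<in> carrier V \<Longrightarrow> (S \<oplus>\<^bsub>L\<^esub> T) x = S x \<oplus>\<^bsub>V\<^esub> T x"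
  by (simp add: L_simps)

lemma scale_L_app [simp]: "x \<in> carrier V \<Longrightarrow> (c \<odot>\<^bsub>L\<^esub> T) x = c \<odot>\<^bsub>V\<^esub> T x"
  by (simp add: L_simps)

lemma zero_L_app [simp]: "x \<in> carrier V \<Longrightarrow> \<zero>\<^bsub>L\<^esub> x = \<zero>\<^bsub>V\<^esub>"
  by (simp add: L_simps)

lemma mult_L_distrib:
  "S \<in> carrier L \<Longrightarrow> T \<in> carrier L \<Longrightarrow> R \<in> carrier L
    \<Longrightarrow> (S \<oplus>\<^bsub>L\<^esub> T) \<otimes>\<^bsub>L\<^esub> R = S \<otimes>\<^bsub>L\<^esub> R \<oplus>\<^bsub>L\<^esub> T \<otimes>\<^bsub>L\<^esub> R"
  "S \<in> carrier L \<Longrightarrow> T \<in> carrier L \<Longrightarrow> R \<in> carrier L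
    \<Longrightarrow> R \<otimes>\<^bsub>L\<^esub> (S \<oplus>\<^bsub>L\<^esub> T) = R \<otimes>\<^bsub>L\<^esub> S \<oplus>\<^bsub>L\<^esub> R \<otimes>\<^bsub>L\<^esub> T"
  by (rule L_eqI; simp add: mult_L add_L L_add)+

lemma mult_L_diff:
  assumes "S \<in> carrier L" "T \<in> carrier L" "S' \<in> carrier L" "T' \<in> carrier L"
  shows "S \<otimes>\<^bsub>L\<^esub> T \<ominus>\<^bsub>L\<^esub> S' \<otimes>\<^bsub>L\<^esub> T' = (S \<ominus>\<^bsub>L\<^esub> S') \<otimes>\<^bsub>L\<^esub> T \<oplus>\<^bsub>L\<^esub> S' \<otimes>\<^bsub>L\<^esub> (T \<ominus>\<^bsub>L\<^esub> T')"
  using assms by (intro L_eqI) (simp_all add: mult_L add_L L_app_diff L_diff V.diff_add_diff)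

lemma adj_zero_L: "adj L \<zero>\<^bsub>L\<^esub> = \<zero>\<^bsub>L\<^esub>"
  by (rule adj_L_unique) (auto simp: zero_L)

lemma adj_diff_L: "S \<in> carrier L \<Longrightarrow> T \<in> carrier L \<Longrightarrow> adj L (S \<ominus>\<^bsub>L\<^esub> T) = adj L S \<ominus>\<^bsub>L\<^esub> adj L T"
  by (simp add: a_minus_def L.neg_eq_scale add_L scale_L adj_L)

text \<open>
  The additive span of a set of operators and its norm closure. Sums suffice, since the set of
  generators of the reduced algebra is closed under scalars.
\<close>

inductive_set additive_span :: "('v \<Rightarrow> 'v) set \<Rightarrow> ('v \<Rightarrow> 'v) set" for S where
  zero: "\<zero>\<^bsub>L\<^esub> \<in> additive_span S"
| add: "s \<in> S \<Longrightarrow> y \<in> additive_span S \<Longrightarrow> s \<oplus>\<^bsub>L\<^esub> y \<in> additive_span S"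

definition closed_span :: "('v \<Rightarrow> 'v) set \<Rightarrow> ('v \<Rightarrow> 'v) set" where
  "closed_span S = {x \<in> carrier L. \<forall>\<epsilon>>0. \<exists>y\<in>additive_span S. nrm L (x \<ominus>\<^bsub>L\<^esub> y) \<le> \<epsilon>}"

lemma closed_spanD:
  assumes "x \<in> closed_span S" "\<epsilon> > 0"
  obtains y where "y \<in> additive_span S" "nrm L (x \<ominus>\<^bsub>L\<^esub> y) \<le> \<epsilon>"
  using assms by (auto simp: closed_span_def)

context
  fixes S :: "('v \<Rightarrow> 'v) set"
  assumes S: "S \<subseteq> carrier L"
begin

lemma additive_span_closed: "y \<in> additive_span S \<Longrightarrow> y \<in> carrier L"
  by (induction rule: additive_span.induct) (use S zero_L add_L in auto)

lemma additive_span_add: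
  assumes "x \<in> additive_span S" "y \<in> additive_span S"
  shows "x \<oplus>\<^bsub>L\<^esub> y \<in> additive_span S"
  using assms(1)
proof (induction rule: additive_span.induct)
  case zero
  then show ?case using assms(2) additive_span_closed by simp
next
  case (add s z)
  then have "s \<oplus>\<^bsub>L\<^esub> z \<oplus>\<^bsub>L\<^esub> y = s \<oplus>\<^bsub>L\<^esub> (z \<oplus>\<^bsub>L\<^esub> y)"
    using S assms(2) additive_span_closed by (intro L.M.a_assoc) auto
  then show ?case
    using add additive_span.add by simp
qed

lemma additive_span_incl: "s \<in> S \<Longrightarrow> s \<in> additive_span S"
  using additive_span.add[OF _ additive_span.zero, of s S] S by auto

text \<open>An additive map from operators to operators which preserves \<open>S\<close> preserves its span.\<close>

lemma additive_span_map:
  assumes "x \<in> additive_span S" "f \<zero>\<^bsub>L\<^esub> = \<zero>\<^bsub>L\<^esub>"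
    and "\<And>x y. x \<in> carrier L \<Longrightarrow> y \<in> carrier L \<Longrightarrow> f (x \<oplus>\<^bsub>L\<^esub> y) = f x \<oplus>\<^bsub>L\<^esub> f y"
    and "\<And>s. s \<in> S \<Longrightarrow> f s \<in> additive_span S"
  shows "f x \<in> additive_span S"
  using assms(1)
proof (induction rule: additive_span.induct)
  case zero
  then show ?case using assms(2) additive_span.zero by simp
next
  case (add s y)
  have "f (s \<oplus>\<^bsub>L\<^esub> y) = f s \<oplus>\<^bsub>L\<^esub> f y"
    using S add additive_span_closed by (intro assms(3)) auto
  then show ?case
    using additive_span_add[OF assms(4)[OF add.hyps(1)] add.IH] by simp
qed

lemma closed_span_incl: "s \<in> S \<Longrightarrow> s \<in> closed_span S"
  using S additive_span_incl[of s] by (auto simp: closed_span_def intro!: bexI[of _ s])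

context
  assumes S_scale: "\<And>c s. s \<in> S \<Longrightarrow> c \<odot>\<^bsub>L\<^esub> s \<in> S"
    and S_mult: "\<And>s t. s \<in> S \<Longrightarrow> t \<in> S \<Longrightarrow> s \<otimes>\<^bsub>L\<^esub> t \<in> S"
    and S_adj: "\<And>s. s \<in> S \<Longrightarrow> adj L s \<in> S"
begin

lemma additive_span_scale: "x \<in> additive_span S \<Longrightarrow> c \<odot>\<^bsub>L\<^esub> x \<in> additive_span S"
  by (rule additive_span_map[of x "\<lambda>x. c \<odot>\<^bsub>L\<^esub> x"])
    (simp_all add: L.scale_add_right S_scale additive_span_incl)

lemma additive_span_adj: "x \<in> additive_span S \<Longrightarrow> adj L x \<in> additive_span S"
  by (rule additive_span_map[of x "adj L"]) (simp_all add: adj_zero_L add_L S_adj additive_span_incl)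

lemma additive_span_mult:
  assumes "x \<in> additive_span S" "y \<in> additive_span S"
  shows "x \<otimes>\<^bsub>L\<^esub> y \<in> additive_span S"
proof (rule additive_span_map[of x "\<lambda>x. x \<otimes>\<^bsub>L\<^esub> y", OF assms(1)])
  note y = additive_span_closed[OF assms(2)]
  show "\<zero>\<^bsub>L\<^esub> \<otimes>\<^bsub>L\<^esub> y = \<zero>\<^bsub>L\<^esub>"
    using y by (intro L_eqI mult_L zero_L) auto
  show "(x \<oplus>\<^bsub>L\<^esub> z) \<otimes>\<^bsub>L\<^esub> y = x \<otimes>\<^bsub>L\<^esub> y \<oplus>\<^bsub>L\<^esub> z \<otimes>\<^bsub>L\<^esub> y" if "x \<in> carrier L" "z \<in> carrier L" for x z
    using that y by (rule mult_L_distrib)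
  fix s assume s: "s \<in> S"
  then have sL: "s \<in> carrier L" using S by auto
  show "s \<otimes>\<^bsub>L\<^esub> y \<in> additive_span S"
  proof (rule additive_span_map[of y "\<lambda>y. s \<otimes>\<^bsub>L\<^esub> y", OF assms(2)])
    show "s \<otimes>\<^bsub>L\<^esub> \<zero>\<^bsub>L\<^esub> = \<zero>\<^bsub>L\<^esub>"
      using sL by (intro L_eqI mult_L zero_L) (auto simp: L_zero)
    show "s \<otimes>\<^bsub>L\<^esub> (x \<oplus>\<^bsub>L\<^esub> z) = s \<otimes>\<^bsub>L\<^esub> x \<oplus>\<^bsub>L\<^esub> s \<otimes>\<^bsub>L\<^esub> z" if "x \<in> carrier L" "z \<in> carrier L" for x z
      using that sL by (rule mult_L_distrib)
  qed (use S_mult[OF s] additive_span_incl in auto)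
qed

lemma cstar_subalgebra_closed_span: "cstar_subalgebra L (closed_span S)"
  unfolding cstar_subalgebra_def
proof (intro conjI ballI allI impI)
  have cl: "x \<in> closed_span S \<Longrightarrow> x \<in> carrier L" for x by (simp add: closed_span_def)
  then show "closed_span S \<subseteq> carrier L" by auto
  show "\<zero>\<^bsub>L\<^esub> \<in> closed_span S"
    unfolding closed_span_def using additive_span.zero[of S] by (auto intro!: bexI[of _ "\<zero>\<^bsub>L\<^esub>"])
  fix x assume x: "x \<in> closed_span S"
  note xL = cl[OF x]
  show "adj L x \<in> closed_span S"
    unfolding closed_span_def
  proof (intro CollectI conjI adj_L xL allI impI)
    fix \<epsilon> :: real assume "\<epsilon> > 0"
    then obtain y where y: "y \<in> additive_span S" "nrm L (x \<ominus>\<^bsub>L\<^esub> y) \<le> \<epsilon>"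
      using x by (blast elim: closed_spanD)
    have "nrm L (adj L x \<ominus>\<^bsub>L\<^esub> adj L y) \<le> \<epsilon>"
      using nrm_adj_L_le[of "x \<ominus>\<^bsub>L\<^esub> y"] xL additive_span_closed[OF y(1)] y(2) by (simp add: adj_diff_L)
    then show "\<exists>y\<in>additive_span S. nrm L (adj L x \<ominus>\<^bsub>L\<^esub> y) \<le> \<epsilon>"
      using additive_span_adj[OF y(1)] by blast
  qed
  show "c \<odot>\<^bsub>L\<^esub> x \<in> closed_span S" for c
    unfolding closed_span_def
  proof (intro CollectI conjI L.scale_closed xL allI impI)
    fix \<epsilon> :: real assume "\<epsilon> > 0"
    then obtain y where y: "y \<in> additive_span S" "nrm L (x \<ominus>\<^bsub>L\<^esub> y) \<le> \<epsilon> / (cmod c + 1)"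
      using x closed_spanD[of x S "\<epsilon> / (cmod c + 1)"]
      by (metis add_nonneg_pos divide_pos_pos norm_ge_zero zero_less_one)
    have "cmod c * nrm L (x \<ominus>\<^bsub>L\<^esub> y) \<le> cmod c * (\<epsilon> / (cmod c + 1))"
      using y(2) by (rule mult_left_mono) simp
    also have "\<dots> \<le> \<epsilon>"
      using \<open>\<epsilon> > 0\<close> by (intro mult_div_add_one_le) auto
    finally have "nrm L (c \<odot>\<^bsub>L\<^esub> x \<ominus>\<^bsub>L\<^esub> c \<odot>\<^bsub>L\<^esub> y) \<le> \<epsilon>"
      using xL additive_span_closed[OF y(1)] by (simp add: L.nrm_smult flip: L.scale_diff)
    then show "\<exists>y\<in>additive_span S. nrm L (c \<odot>\<^bsub>L\<^esub> x \<ominus>\<^bsub>L\<^esub> y) \<le> \<epsilon>"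
      using additive_span_scale[OF y(1)] by blast
  qed
  {
    fix y assume y: "y \<in> closed_span S"
    note yL = cl[OF y]
    show "x \<oplus>\<^bsub>L\<^esub> y \<in> closed_span S"
      unfolding closed_span_def
    proof (intro CollectI conjI L.M.a_closed xL yL allI impI)
      fix \<epsilon> :: real assume "\<epsilon> > 0"
      then have "\<epsilon> / 2 > 0" by simp
      then obtain a b where ab: "a \<in> additive_span S" "b \<in> additive_span S"
        "nrm L (x \<ominus>\<^bsub>L\<^esub> a) \<le> \<epsilon> / 2" "nrm L (y \<ominus>\<^bsub>L\<^esub> b) \<le> \<epsilon> / 2"
        using x y by (meson closed_spanD)
      have "nrm L ((x \<oplus>\<^bsub>L\<^esub> y) \<ominus>\<^bsub>L\<^esub> (a \<oplus>\<^bsub>L\<^esub> b)) \<le> \<epsilon>"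
        using L.nrm_diff_add_le[of x y a b] xL yL additive_span_closed ab by force
      then show "\<exists>z\<in>additive_span S. nrm L (x \<oplus>\<^bsub>L\<^esub> y \<ominus>\<^bsub>L\<^esub> z) \<le> \<epsilon>"
        using additive_span_add[OF ab(1,2)] by blast
    qed
    show "x \<otimes>\<^bsub>L\<^esub> y \<in> closed_span S"
      unfolding closed_span_def
    proof (intro CollectI conjI mult_L xL yL allI impI)
      fix \<epsilon> :: real assume "\<epsilon> > 0"
      let ?N = "nrm L x + nrm L y + 1"
      define \<delta> where "\<delta> = min 1 (\<epsilon> / ?N)"
      have N: "?N > 0" using nrm_L_nonneg[OF xL] nrm_L_nonneg[OF yL] by simp
      have "\<delta> \<le> \<epsilon> / ?N" by (simp add: \<delta>_def)
      then have \<delta>: "\<delta> > 0" "\<delta> \<le> 1" "\<delta> * ?N \<le> \<epsilon>"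
        using \<open>\<epsilon> > 0\<close> N by (simp add: \<delta>_def, simp add: \<delta>_def, simp only: pos_le_divide_eq)
      then obtain a b where ab: "a \<in> additive_span S" "b \<in> additive_span S"
        "nrm L (x \<ominus>\<^bsub>L\<^esub> a) \<le> \<delta>" "nrm L (y \<ominus>\<^bsub>L\<^esub> b) \<le> \<delta>"
        using x y by (meson closed_spanD)
      note aL = additive_span_closed[OF ab(1)] and bL = additive_span_closed[OF ab(2)]
      have na: "nrm L a \<le> nrm L x + 1"
        using L.nrm_le_diff_add[OF aL xL] L.nrm_diff_commute[OF aL xL] ab(3) \<delta> by simp
      have "nrm L (x \<otimes>\<^bsub>L\<^esub> y \<ominus>\<^bsub>L\<^esub> a \<otimes>\<^bsub>L\<^esub> b)
          \<le> nrm L ((x \<ominus>\<^bsub>L\<^esub> a) \<otimes>\<^bsub>L\<^esub> y) + nrm L (a \<otimes>\<^bsub>L\<^esub> (y \<ominus>\<^bsub>L\<^esub> b))"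
        unfolding mult_L_diff[OF xL yL aL bL]
        using xL yL aL bL by (intro L.nrm_triangle mult_L) auto
      also have "\<dots> \<le> nrm L (x \<ominus>\<^bsub>L\<^esub> a) * nrm L y + nrm L a * nrm L (y \<ominus>\<^bsub>L\<^esub> b)"
        using xL yL aL bL by (intro add_mono mult_L) auto
      also have "\<dots> \<le> \<delta> * nrm L y + (nrm L x + 1) * \<delta>"
        using ab na \<delta> nrm_L_nonneg xL yL bL by (intro add_mono mult_mono) auto
      also have "\<dots> = \<delta> * ?N"
        by (simp add: algebra_simps)
      finally have "nrm L (x \<otimes>\<^bsub>L\<^esub> y \<ominus>\<^bsub>L\<^esub> a \<otimes>\<^bsub>L\<^esub> b) \<le> \<epsilon>"
        using \<delta>(3) by simp
      then show "\<exists>z\<in>additive_span S. nrm L (x \<otimes>\<^bsub>L\<^esub> y \<ominus>\<^bsub>L\<^esub> z) \<le> \<epsilon>"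
        using additive_span_mult[OF ab(1,2)] by blast
    qed
  }
next
  fix s x assume "(\<forall>n. s n \<in> closed_span S) \<and> converges_to L s x"
  then have s: "\<And>n. s n \<in> closed_span S" and lim: "converges_to L s x" by auto
  have xL: "x \<in> carrier L" and sL: "\<And>n. s n \<in> carrier L"
    using lim by (auto simp: converges_to_def)
  show "x \<in> closed_span S"
    unfolding closed_span_def
  proof (intro CollectI conjI xL allI impI)
    fix \<epsilon> :: real assume "\<epsilon> > 0"
    then have "\<forall>\<^sub>F n in sequentially. nrm L (s n \<ominus>\<^bsub>L\<^esub> x) < \<epsilon> / 2"
      using lim by (intro order_tendstoD(2)[of _ 0]) (auto simp: converges_to_def)
    then obtain n where n: "nrm L (s n \<ominus>\<^bsub>L\<^esub> x) < \<epsilon> / 2"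
      by (auto simp: eventually_sequentially)
    obtain y where y: "y \<in> additive_span S" "nrm L (s n \<ominus>\<^bsub>L\<^esub> y) \<le> \<epsilon> / 2"
      using closed_spanD[OF s[of n], of "\<epsilon> / 2"] \<open>\<epsilon> > 0\<close> by auto
    have "nrm L (x \<ominus>\<^bsub>L\<^esub> y) \<le> \<epsilon>"
      using L.nrm_diff_triangle[of x "s n" y] L.nrm_diff_commute[of x "s n"] n y(2)
        xL sL additive_span_closed[OF y(1)] by fastforce
    then show "\<exists>y\<in>additive_span S. nrm L (x \<ominus>\<^bsub>L\<^esub> y) \<le> \<epsilon>"
      using y(1) by blast
  qed
qed

lemma cstar_generated_subset: "cstar_generated L S \<subseteq> closed_span S"
  using cstar_subalgebra_closed_span closed_span_incl unfolding cstar_generated_def by blast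

lemma cstar_subalgebra_generated: "cstar_subalgebra L (cstar_generated L S)"
proof -
  have 0: "cstar_generated L S \<subseteq> carrier L"
    using cstar_generated_subset by (auto simp: closed_span_def)
  have memI: "x \<in> cstar_generated L S" if "\<And>K. cstar_subalgebra L K \<Longrightarrow> S \<subseteq> K \<Longrightarrow> x \<in> K" for x
    using that unfolding cstar_generated_def by (intro InterI) simp
  have memD: "x \<in> K" if "x \<in> cstar_generated L S" "cstar_subalgebra L K" "S \<subseteq> K" for x K
    using that unfolding cstar_generated_def by simp
  have 1: "s_lim \<in> cstar_generated L S"
    if "\<And>n. s n \<in> cstar_generated L S" "converges_to L s s_lim" for s s_lim
  proof (rule memI)
    fix K assume K: "cstar_subalgebra L K" "S \<subseteq> K"
    then have "\<forall>n. s n \<in> K"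
      using memD[OF that(1)] by simp
    then show "s_lim \<in> K"
      using K(1) that(2) unfolding cstar_subalgebra_def by blast
  qed
  have 2: "\<zero>\<^bsub>L\<^esub> \<in> cstar_generated L S"
    by (rule memI) (simp add: cstar_subalgebra_def)
  have 3: "x \<oplus>\<^bsub>L\<^esub> y \<in> cstar_generated L S \<and> x \<otimes>\<^bsub>L\<^esub> y \<in> cstar_generated L S"
    if "x \<in> cstar_generated L S" "y \<in> cstar_generated L S" for x y
    by (intro conjI; rule memI; frule (1) memD[OF that(1)]; frule (1) memD[OF that(2)];
        simp add: cstar_subalgebra_def)
  have 4: "c \<odot>\<^bsub>L\<^esub> x \<in> cstar_generated L S" "adj L x \<in> cstar_generated L S"
    if "x \<in> cstar_generated L S" for c x
    by (rule memI; frule (1) memD[OF that(1)]; simp add: cstar_subalgebra_def)+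
  show ?thesis
    unfolding cstar_subalgebra_def[of L "cstar_generated L S"] using 0 1 2 3 4 by blast
qed

end

end

end

text \<open>
  A C*-algebra \<open>A\<close> of adjointable operators on \<open>V\<close>, given by its set \<open>A0\<close> of elements.
\<close>

locale operator_algebra = pre_hilbert +
  fixes A0 :: "('c \<Rightarrow> 'c) set"
  assumes subalgebra: "cstar_subalgebra (adjointable_algebra V) A0"
begin

abbreviation "A \<equiv> L\<lparr>carrier := A0\<rparr>"

lemma A_L: "x \<in> A0 \<Longrightarrow> x \<in> carrier L"
  using subalgebra by (auto simp: cstar_subalgebra_def)

lemma A_zero: "\<zero>\<^bsub>L\<^esub> \<in> A0"
  and A_add: "x \<in> A0 \<Longrightarrow> y \<in> A0 \<Longrightarrow> x \<oplus>\<^bsub>L\<^esub> y \<in> A0"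
  and A_mult: "x \<in> A0 \<Longrightarrow> y \<in> A0 \<Longrightarrow> x \<otimes>\<^bsub>L\<^esub> y \<in> A0"
  and A_scale: "x \<in> A0 \<Longrightarrow> c \<odot>\<^bsub>L\<^esub> x \<in> A0"
  and A_adj: "x \<in> A0 \<Longrightarrow> adj L x \<in> A0"
  using subalgebra by (auto simp: cstar_subalgebra_def)

lemma normed_space_A: "normed_space A"
proof (rule normed_spaceI)
  fix x y z assume "x \<in> carrier A" "y \<in> carrier A" "z \<in> carrier A"
  then show "x \<oplus>\<^bsub>A\<^esub> y \<oplus>\<^bsub>A\<^esub> z = x \<oplus>\<^bsub>A\<^esub> (y \<oplus>\<^bsub>A\<^esub> z)"
    by (simp add: L.M.a_assoc A_L)
qed (simp_all add: A_zero A_add A_scale A_L L.M.a_comm L.scale_add_left L.scale_add_right L.nrm_smult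
      L.nrm_nonneg L.nrm_eq_0 L.nrm_triangle)

sublocale A: normed_space A by (rule normed_space_A)

lemma A_diff: "x \<in> A0 \<Longrightarrow> y \<in> A0 \<Longrightarrow> x \<ominus>\<^bsub>A\<^esub> y = x \<ominus>\<^bsub>L\<^esub> y"
  by (simp add: a_minus_def A.neg_eq_scale L.neg_eq_scale A_L)

lemma A_diff_app: "x \<in> A0 \<Longrightarrow> y \<in> A0 \<Longrightarrow> v \<in> carrier V \<Longrightarrow> (x \<ominus>\<^bsub>A\<^esub> y) v = x v \<ominus>\<^bsub>V\<^esub> y v"
  by (simp add: A_diff L_app_diff A_L)

lemma A_finsum_app:
  "finite S \<Longrightarrow> f \<in> S \<rightarrow> A0 \<Longrightarrow> v \<in> carrier V
    \<Longrightarrow> (\<Oplus>\<^bsub>A\<^esub>k\<in>S. f k) v = (\<Oplus>\<^bsub>V\<^esub>k\<in>S. f k v)"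
proof (induction S rule: finite_induct)
  case (insert k S)
  then have "(\<Oplus>\<^bsub>A\<^esub>k\<in>insert k S. f k) = f k \<oplus>\<^bsub>L\<^esub> (\<Oplus>\<^bsub>A\<^esub>k\<in>S. f k)"
    by (subst A.M.finsum_insert) auto
  then show ?case
    using insert by (subst V.M.finsum_insert) (auto simp: A_L Pi_def)
qed simp

text \<open>A positive operator matrix \<open>m = c\<^sup>* c\<close> defines a positive form on tuples of vectors.\<close>

lemma positive_matrix_form:
  assumes m: "positive_matrix A n m" and \<eta>: "\<And>i. i < n \<Longrightarrow> \<eta> i \<in> carrier V"
  shows "pos (\<Oplus>i\<in>{..<n}. \<Oplus>j\<in>{..<n}. inner V (\<eta> i) (m i j (\<eta> j)))"
proof -
  obtain c where c: "\<And>i j. i < n \<Longrightarrow> j < n \<Longrightarrow> c i j \<in> A0"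
    and mc: "\<And>i j. i < n \<Longrightarrow> j < n \<Longrightarrow> m i j = (\<Oplus>\<^bsub>A\<^esub>k\<in>{..<n}. adj L (c k i) \<otimes>\<^bsub>L\<^esub> c k j)"
  proof -
    obtain c where "\<forall>i<n. \<forall>j<n. c i j \<in> carrier A"
      "\<forall>i<n. \<forall>j<n. m i j = (\<Oplus>\<^bsub>A\<^esub>k\<in>{..<n}. adj A (c k i) \<otimes>\<^bsub>A\<^esub> c k j)"
      using m unfolding positive_matrix_def by blast
    then show thesis
      by (intro that[of c]) simp_all
  qed
  have entry: "inner V (\<eta> i) (m i j (\<eta> j)) = (\<Oplus>k\<in>{..<n}. inner V (c k i (\<eta> i)) (c k j (\<eta> j)))"
    if ij: "i < n" "j < n" for i j
  proof -
    have "m i j (\<eta> j) = (\<Oplus>\<^bsub>V\<^esub>k\<in>{..<n}. (adj L (c k i) \<otimes>\<^bsub>L\<^esub> c k j) (\<eta> j))"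
      unfolding mc[OF ij] using ij c \<eta> by (intro A_finsum_app) (auto intro: A_mult A_adj)
    then have "inner V (\<eta> i) (m i j (\<eta> j))
        = inner V (\<eta> i) (\<Oplus>\<^bsub>V\<^esub>k\<in>{..<n}. (adj L (c k i) \<otimes>\<^bsub>L\<^esub> c k j) (\<eta> j))"
      by (rule arg_cong)
    also have "\<dots> = (\<Oplus>k\<in>{..<n}. inner V (\<eta> i) ((adj L (c k i) \<otimes>\<^bsub>L\<^esub> c k j) (\<eta> j)))"
    proof (rule inner_finsum_right)
      have "(adj L (c k i) \<otimes>\<^bsub>L\<^esub> c k j) (\<eta> j) \<in> carrier V" if "k < n" for k
        using A_L[OF A_mult[OF A_adj[OF c[OF that ij(1)]] c[OF that ij(2)]]] \<eta>[OF ij(2)] by (rule L_app)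
      then show "(\<lambda>k. (adj L (c k i) \<otimes>\<^bsub>L\<^esub> c k j) (\<eta> j)) \<in> {..<n} \<rightarrow> carrier V"
        by auto
    qed (use \<eta> ij in auto)
    also have "\<dots> = (\<Oplus>k\<in>{..<n}. inner V (c k i (\<eta> i)) (c k j (\<eta> j)))"
      using ij c \<eta> by (intro finsum_cong') (auto simp: inner_adj_right A_L)
    finally show ?thesis .
  qed
  define \<zeta> where "\<zeta> k = (\<Oplus>\<^bsub>V\<^esub>j\<in>{..<n}. c k j (\<eta> j))" for k
  have cv: "c k j (\<eta> j) \<in> carrier V" if "k < n" "j < n" for k j
    using that c \<eta> A_L by blast
  have \<zeta>: "\<zeta> k \<in> carrier V" if "k < n" for k
    unfolding \<zeta>_def using that cv by (intro V.M.finsum_closed) auto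
  have "(\<Oplus>i\<in>{..<n}. \<Oplus>j\<in>{..<n}. inner V (\<eta> i) (m i j (\<eta> j)))
      = (\<Oplus>i\<in>{..<n}. \<Oplus>j\<in>{..<n}. \<Oplus>k\<in>{..<n}. inner V (c k i (\<eta> i)) (c k j (\<eta> j)))"
    using cv by (intro finsum_cong') (auto simp: entry intro!: finsum_cong' finsum_closed)
  also have "\<dots> = (\<Oplus>i\<in>{..<n}. \<Oplus>k\<in>{..<n}. \<Oplus>j\<in>{..<n}. inner V (c k i (\<eta> i)) (c k j (\<eta> j)))"
  proof (rule finsum_cong'[OF refl])
    fix i assume i: "i \<in> {..<n}"
    show "(\<Oplus>j\<in>{..<n}. \<Oplus>k\<in>{..<n}. inner V (c k i (\<eta> i)) (c k j (\<eta> j)))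
        = (\<Oplus>k\<in>{..<n}. \<Oplus>j\<in>{..<n}. inner V (c k i (\<eta> i)) (c k j (\<eta> j)))"
      using cv i by (intro finsum_swap) auto
  qed (use cv in \<open>auto intro!: finsum_closed\<close>)
  also have "\<dots> = (\<Oplus>k\<in>{..<n}. \<Oplus>i\<in>{..<n}. \<Oplus>j\<in>{..<n}. inner V (c k i (\<eta> i)) (c k j (\<eta> j)))"
    using cv by (intro finsum_swap) (auto intro!: finsum_closed)
  also have "\<dots> = (\<Oplus>k\<in>{..<n}. inner V (\<zeta> k) (\<zeta> k))"
  proof (rule finsum_cong')
    fix k assume k: "k \<in> {..<n}"
    have "inner V (\<zeta> k) (\<zeta> k) = (\<Oplus>i\<in>{..<n}. inner V (c k i (\<eta> i)) (\<zeta> k))"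
      using k cv \<zeta> by (subst (1) \<zeta>_def) (intro inner_finsum_left, auto)
    also have "\<dots> = (\<Oplus>i\<in>{..<n}. \<Oplus>j\<in>{..<n}. inner V (c k i (\<eta> i)) (c k j (\<eta> j)))"
      using k cv by (intro finsum_cong') (auto simp: \<zeta>_def intro!: inner_finsum_right finsum_closed)
    finally show "(\<Oplus>i\<in>{..<n}. \<Oplus>j\<in>{..<n}. inner V (c k i (\<eta> i)) (c k j (\<eta> j))) = inner V (\<zeta> k) (\<zeta> k)"
      by simp
  qed (use \<zeta> in auto)
  finally show ?thesis
    using \<zeta> by (auto intro!: pos_finsum pos_inner)
qed

end

text \<open>
  A bounded linear map which vanishes on a set of operators closed under the algebraic operations
  vanishes on the C*-algebra that it generates.
\<close>

lemma (in pre_hilbert) generated_vanish: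
  fixes W :: "('w, 'n) normed_module_scheme"
  assumes S: "S \<subseteq> carrier L" and S_scale: "\<And>c s. s \<in> S \<Longrightarrow> c \<odot>\<^bsub>L\<^esub> s \<in> S"
    and S_mult: "\<And>s t. s \<in> S \<Longrightarrow> t \<in> S \<Longrightarrow> s \<otimes>\<^bsub>L\<^esub> t \<in> S" and S_adj: "\<And>s. s \<in> S \<Longrightarrow> adj L s \<in> S"
    and W: "normed_space W" and f: "linear_map (L\<lparr>carrier := cstar_generated L S\<rparr>) W f"
    and K: "0 \<le> K" "\<And>x. x \<in> cstar_generated L S \<Longrightarrow> nrm W (f x) \<le> K * nrm L x"
    and zero: "\<And>s. s \<in> S \<Longrightarrow> f s = \<zero>\<^bsub>W\<^esub>" and x: "x \<in> cstar_generated L S"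
  shows "f x = \<zero>\<^bsub>W\<^esub>"
proof -
  interpret operator_algebra D V "cstar_generated L S"
    by (intro operator_algebra.intro pre_hilbert_axioms operator_algebra_axioms.intro
        cstar_subalgebra_generated S S_scale S_mult S_adj)
  interpret W: normed_space W by (rule W)
  have S_A: "s \<in> cstar_generated L S" if "s \<in> S" for s
    using that by (auto simp: cstar_generated_def)
  have span: "y \<in> cstar_generated L S \<and> f y = \<zero>\<^bsub>W\<^esub>" if "y \<in> additive_span S" for y
    using that
  proof (induction rule: additive_span.induct)
    case zero
    show ?case
      using A_zero linear_mapD(3)[OF f, of "\<zero>\<^bsub>L\<^esub>" 0] linear_mapD(1)[OF f, of "\<zero>\<^bsub>L\<^esub>"] by simp
  next
    case (add s y)
    then show ?case
      using A_add S_A linear_mapD(2)[OF f, of s y] zero by simp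
  qed
  have fx: "f x \<in> carrier W"
    using linear_mapD(1)[OF f] x by simp
  have "nrm W (f x) \<le> \<epsilon>" if "\<epsilon> > 0" for \<epsilon>
  proof -
    have "x \<in> closed_span S"
      using cstar_generated_subset[OF S S_scale S_mult S_adj] x by blast
    moreover have "\<epsilon> / (K + 1) > 0" using that K by simp
    ultimately obtain y where y: "y \<in> additive_span S" "nrm L (x \<ominus>\<^bsub>L\<^esub> y) \<le> \<epsilon> / (K + 1)"
      by (rule closed_spanD)
    note yA = span[OF y(1)]
    have "f (x \<ominus>\<^bsub>A\<^esub> y) = f x"
      using linear_map_diff[OF normed_space_A W f, of x y] x yA fx by simp
    then have "nrm W (f x) \<le> K * nrm L (x \<ominus>\<^bsub>L\<^esub> y)"
      using K(2)[of "x \<ominus>\<^bsub>A\<^esub> y"] A.M.minus_closed[of x y] x yA by (simp add: A_diff)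
    also have "\<dots> \<le> K * (\<epsilon> / (K + 1))"
      using y(2) K(1) by (rule mult_left_mono)
    also have "\<dots> \<le> \<epsilon>"
      using that K(1) by (intro mult_div_add_one_le)
    finally show ?thesis .
  qed
  then have "nrm W (f x) \<le> 0"
    by (rule field_le_epsilon[of _ 0, simplified])
  then show ?thesis
    using W.nrm_nonneg[OF fx] W.nrm_eq_0[OF fx] by simp
qed

text \<open>
  Consequently bounded linear maps on the generated C*-algebra are determined by their values on
  the generating set.
\<close>

lemma (in pre_hilbert) generated_agree:
  fixes W :: "('w, 'n) normed_module_scheme"
  assumes S: "S \<subseteq> carrier L" "\<And>c s. s \<in> S \<Longrightarrow> c \<odot>\<^bsub>L\<^esub> s \<in> S"
      "\<And>s t. s \<in> S \<Longrightarrow> t \<in> S \<Longrightarrow> s \<otimes>\<^bsub>L\<^esub> t \<in> S" "\<And>s. s \<in> S \<Longrightarrow> adj L s \<in> S"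
    and W: "normed_space W"
    and f: "linear_map (L\<lparr>carrier := cstar_generated L S\<rparr>) W f"
      "0 \<le> K" "\<And>x. x \<in> cstar_generated L S \<Longrightarrow> nrm W (f x) \<le> K * nrm L x"
    and h: "linear_map (L\<lparr>carrier := cstar_generated L S\<rparr>) W h"
      "0 \<le> K'" "\<And>x. x \<in> cstar_generated L S \<Longrightarrow> nrm W (h x) \<le> K' * nrm L x"
    and eq: "\<And>s. s \<in> S \<Longrightarrow> f s = h s" and x: "x \<in> cstar_generated L S"
  shows "f x = h x"
proof -
  interpret W: normed_space W by (rule W)
  have c: "f x \<in> carrier W" "h x \<in> carrier W" if "x \<in> cstar_generated L S" for x
    using that linear_mapD(1)[OF f(1)] linear_mapD(1)[OF h(1)] by auto
  have S_A: "s \<in> cstar_generated L S" if "s \<in> S" for s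
    using that by (auto simp: cstar_generated_def)
  have "f x \<ominus>\<^bsub>W\<^esub> h x = \<zero>\<^bsub>W\<^esub>"
  proof (rule generated_vanish[OF S W linear_map_minus[OF W f(1) h(1)], of "K + K'"])
    show "nrm W (f x \<ominus>\<^bsub>W\<^esub> h x) \<le> (K + K') * nrm L x" if "x \<in> cstar_generated L S" for x
      using W.nrm_diff_le[OF c[OF that]] f(3)[OF that] h(3)[OF that] by (simp add: distrib_right)
    show "f s \<ominus>\<^bsub>W\<^esub> h s = \<zero>\<^bsub>W\<^esub>" if "s \<in> S" for s
      using eq[OF that] c[OF S_A[OF that]] by simp
  qed (use f h x in auto)
  then show ?thesis
    using W.diff_eq_zeroD c[OF x] by blast
qed

section \<open>The C*-algebra of the unit fibre\<close>

context fell_bundle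
begin

abbreviation "D \<equiv> unit_algebra G B"

lemma D_simps [simp]:
  "carrier D = carrier (fibre B \<one>)" "mult D = bmult B \<one> \<one>" "zero D = zero (fibre B \<one>)"
  "add D = add (fibre B \<one>)" "smult D = smult (fibre B \<one>)" "nrm D = nrm (fibre B \<one>)"
  "adj D = bstar B \<one>"
  by (simp_all add: unit_algebra_def Let_def)

lemma minus_D: "a_minus D = a_minus (fibre B \<one>)"
  by (simp add: a_minus_def a_inv_def m_inv_def fun_eq_iff)

lemma finsum_fibre_one: "finsum (fibre B \<one>) = finsum D"
  by (simp add: finsum_def finprod_def fun_eq_iff)

lemma normed_fibre: "g \<in> carrier G \<Longrightarrow> normed_space (fibre B g)"
  using banach_fibre by (simp add: banach_space_def)

lemmas fibre_add_closed [simp] =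
    abelian_monoid.a_closed[OF abelian_group.axioms(1)[OF normed_space.abelian_group_V[OF normed_fibre]]]
  and fibre_zero_closed [simp] =
    abelian_monoid.zero_closed[OF abelian_group.axioms(1)[OF normed_space.abelian_group_V[OF normed_fibre]]]
  and fibre_scale_closed [simp] = normed_space.scale_closed[OF normed_fibre]
  and fibre_scale_zero [simp] = normed_space.scale_0_right[OF normed_fibre]
  and fibre_scale_0 [simp] = normed_space.scale_0_left[OF normed_fibre]

lemmas bmult_add_right = linear_mapD(2)[OF bmult_linear_right]
  and bmult_scale_right = linear_mapD(3)[OF bmult_linear_right]
  and bmult_add_left = linear_mapD(2)[OF bmult_linear_left]
  and bmult_scale_left = linear_mapD(3)[OF bmult_linear_left]

lemma bmult_zero_right [simp]:
  assumes "g \<in> carrier G" "h \<in> carrier G" "a \<in> carrier (fibre B g)"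
  shows "bmult B g h a \<zero>\<^bsub>fibre B h\<^esub> = \<zero>\<^bsub>fibre B (g \<otimes> h)\<^esub>"
  using bmult_scale_right[of g h a "\<zero>\<^bsub>fibre B h\<^esub>" 0] bmult_closed[of g h a "\<zero>\<^bsub>fibre B h\<^esub>"] assms by simp

lemma bmult_zero_left [simp]:
  assumes "g \<in> carrier G" "h \<in> carrier G" "b \<in> carrier (fibre B h)"
  shows "bmult B g h \<zero>\<^bsub>fibre B g\<^esub> b = \<zero>\<^bsub>fibre B (g \<otimes> h)\<^esub>"
  using bmult_scale_left[of g h b "\<zero>\<^bsub>fibre B g\<^esub>" 0] bmult_closed[of g h "\<zero>\<^bsub>fibre B g\<^esub>" b] assms by simp

lemma bstar_zero [simp]:
  assumes "g \<in> carrier G"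
  shows "bstar B g \<zero>\<^bsub>fibre B g\<^esub> = \<zero>\<^bsub>fibre B (inv g)\<^esub>"
  using bstar_smult[of g "\<zero>\<^bsub>fibre B g\<^esub>" 0] bstar_closed[of g "\<zero>\<^bsub>fibre B g\<^esub>"] assms by simp

text \<open>The product \<open>a\<^sup>* b\<close> of elements of the same fibre, with values in the unit fibre.\<close>

definition ip :: "'g \<Rightarrow> 'b \<Rightarrow> 'b \<Rightarrow> 'b" where
  "ip g a b = bmult B (inv g) g (bstar B g a) b"

lemma ip_closed [simp]:
  assumes "g \<in> carrier G" "a \<in> carrier (fibre B g)" "b \<in> carrier (fibre B g)"
  shows "ip g a b \<in> carrier (fibre B \<one>)"
  using bmult_closed[of "inv g" g "bstar B g a" b] assms by (simp add: ip_def bstar_closed)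

lemma bstar_ip:
  assumes "g \<in> carrier G" "a \<in> carrier (fibre B g)" "b \<in> carrier (fibre B g)"
  shows "bstar B \<one> (ip g a b) = ip g b a"
  using bstar_bmult[of "inv g" g "bstar B g a" b] assms by (simp add: ip_def bstar_closed bstar_bstar)

lemma ip_add_right:
  assumes "g \<in> carrier G" "a \<in> carrier (fibre B g)" "b \<in> carrier (fibre B g)" "c \<in> carrier (fibre B g)"
  shows "ip g a (b \<oplus>\<^bsub>fibre B g\<^esub> c) = ip g a b \<oplus>\<^bsub>fibre B \<one>\<^esub> ip g a c"
  using bmult_add_right[of "inv g" g "bstar B g a" b c] assms by (simp add: ip_def bstar_closed)

lemma ip_scale_right:
  assumes "g \<in> carrier G" "a \<in> carrier (fibre B g)" "b \<in> carrier (fibre B g)"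
  shows "ip g a (c \<odot>\<^bsub>fibre B g\<^esub> b) = c \<odot>\<^bsub>fibre B \<one>\<^esub> ip g a b"
  using bmult_scale_right[of "inv g" g "bstar B g a" b c] assms by (simp add: ip_def bstar_closed)

lemma ip_zero [simp]:
  assumes "g \<in> carrier G" "a \<in> carrier (fibre B g)"
  shows "ip g a \<zero>\<^bsub>fibre B g\<^esub> = \<zero>\<^bsub>fibre B \<one>\<^esub>" and "ip g \<zero>\<^bsub>fibre B g\<^esub> a = \<zero>\<^bsub>fibre B \<one>\<^esub>"
  using bmult_zero_right[of "inv g" g "bstar B g a"] bmult_zero_left[of "inv g" g a] assms
  by (auto simp: ip_def bstar_closed)

lemma nrm_ip: "g \<in> carrier G \<Longrightarrow> a \<in> carrier (fibre B g) \<Longrightarrow> nrm (fibre B \<one>) (ip g a a) = (nrm (fibre B g) a)\<^sup>2"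
  by (simp add: ip_def nrm_cstar)

end

context unital_fell_bundle
begin

lemma one_D:
  shows one_D_closed [simp]: "\<one>\<^bsub>D\<^esub> \<in> carrier (fibre B \<one>)"
    and one_D_left: "a \<in> carrier (fibre B \<one>) \<Longrightarrow> bmult B \<one> \<one> \<one>\<^bsub>D\<^esub> a = a"
    and one_D_right: "a \<in> carrier (fibre B \<one>) \<Longrightarrow> bmult B \<one> \<one> a \<one>\<^bsub>D\<^esub> = a"
proof -
  let ?P = "\<lambda>u. u \<in> carrier (fibre B \<one>) \<and>
    (\<forall>a\<in>carrier (fibre B \<one>). bmult B \<one> \<one> u a = a \<and> bmult B \<one> \<one> a u = a)"
  obtain u where u: "?P u" using unital by blast
  have "(THE u. ?P u) = u"
    by (rule the_equality[of ?P, OF u]) (use u in metis)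
  then have "\<one>\<^bsub>D\<^esub> = u"
    by (simp add: unit_algebra_def Let_def)
  then show "\<one>\<^bsub>D\<^esub> \<in> carrier (fibre B \<one>)"
    "a \<in> carrier (fibre B \<one>) \<Longrightarrow> bmult B \<one> \<one> \<one>\<^bsub>D\<^esub> a = a"
    "a \<in> carrier (fibre B \<one>) \<Longrightarrow> bmult B \<one> \<one> a \<one>\<^bsub>D\<^esub> = a"
    using u by auto
qed

lemma unital_cstar_D: "unital_cstar D"
proof -
  interpret F: banach_space "fibre B \<one>" by (rule banach_fibre) simp
  have nD: "normed_space D"
    by (rule normed_spaceI)
      (simp_all add: F.M.a_ac F.scale_add_left F.scale_add_right F.nrm_nonneg F.nrm_eq_0
        F.nrm_smult F.nrm_triangle)
  show ?thesis
  proof (intro unital_cstar.intro banach_space.intro banach_space_axioms.intro nD unital_cstar_axioms.intro)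
    show "\<exists>x. converges_to D s x" if "cauchy_seq D s" for s
      using that F.complete[of s] by (simp add: cauchy_seq_def converges_to_def minus_D)
    show "ring D"
    proof (rule ringI)
      show "abelian_group D" using nD by (rule normed_space.abelian_group_V)
      show "Group.monoid D"
        by (rule monoidI) (use bmult_closed[of \<one> \<one>] bmult_assoc[of \<one> \<one> \<one>] one_D in simp_all)
    qed (use bmult_add_left[of \<one> \<one>] bmult_add_right[of \<one> \<one>] in simp_all)
    fix x y c assume x: "x \<in> carrier D" and y: "y \<in> carrier D"
    show "(c \<odot>\<^bsub>D\<^esub> x) \<otimes>\<^bsub>D\<^esub> y = c \<odot>\<^bsub>D\<^esub> (x \<otimes>\<^bsub>D\<^esub> y)"
      using bmult_scale_left[of \<one> \<one> y x c] x y by simp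
    show "x \<otimes>\<^bsub>D\<^esub> (c \<odot>\<^bsub>D\<^esub> y) = c \<odot>\<^bsub>D\<^esub> (x \<otimes>\<^bsub>D\<^esub> y)"
      using bmult_scale_right[of \<one> \<one> x y c] x y by simp
    show "nrm D (x \<otimes>\<^bsub>D\<^esub> y) \<le> nrm D x * nrm D y"
      using nrm_bmult[of \<one> \<one> x y] x y by simp
    show "adj D x \<in> carrier D" using bstar_closed[of \<one> x] x by simp
    show "adj D (adj D x) = x" using bstar_bstar[of \<one> x] x by simp
    show "adj D (x \<oplus>\<^bsub>D\<^esub> y) = adj D x \<oplus>\<^bsub>D\<^esub> adj D y" using bstar_add[of \<one> x y] x y by simp
    show "adj D (c \<odot>\<^bsub>D\<^esub> x) = cnj c \<odot>\<^bsub>D\<^esub> adj D x" using bstar_smult[of \<one> x c] x by simp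
    show "adj D (x \<otimes>\<^bsub>D\<^esub> y) = adj D y \<otimes>\<^bsub>D\<^esub> adj D x" using bstar_bmult[of \<one> \<one> x y] x y by simp
    show "nrm D (adj D x) = nrm D x" using nrm_bstar[of \<one> x] x by simp
    show "nrm D (adj D x \<otimes>\<^bsub>D\<^esub> x) = (nrm D x)\<^sup>2" using nrm_cstar[of \<one> x] x by simp
  qed
qed

sublocale D: unital_cstar D by (rule unital_cstar_D)

lemma pos_ip: "g \<in> carrier G \<Longrightarrow> a \<in> carrier (fibre B g) \<Longrightarrow> D.pos (ip g a a)"
  using positive_cstar by (simp add: ip_def D.positive_iff_pos)

lemma bmult_ract_ip:
  assumes "g \<in> carrier G" "a \<in> carrier (fibre B g)" "b \<in> carrier (fibre B g)" "d \<in> carrier (fibre B \<one>)"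
  shows "ip g a (bmult B g \<one> b d) = bmult B \<one> \<one> (ip g a b) d"
  using bmult_assoc[of "inv g" g \<one> "bstar B g a" b d] assms by (simp add: ip_def bstar_closed)

text \<open>The unit of the unit fibre acts as a unit on every fibre, by the C*-identity for \<open>u c - c\<close>.\<close>

lemma one_D_fibre:
  assumes g: "g \<in> carrier G" and c: "c \<in> carrier (fibre B g)"
  shows "bmult B \<one> g \<one>\<^bsub>D\<^esub> c = c"
proof -
  interpret F: normed_space "fibre B g" by (rule normed_fibre[OF g])
  interpret F': normed_space "fibre B (inv g)" by (rule normed_fibre) (use g in simp)
  let ?u = "\<one>\<^bsub>D\<^esub>"
  define x where "x = bmult B \<one> g ?u c"
  \<comment> \<open>\<open>y = u c - c\<close> satisfies \<open>y w = u (c w) - c w = 0\<close> for all \<open>w\<close> of degree \<open>g\<^sup>-\<^sup>1\<close>.\<close>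
  define y where "y = x \<oplus>\<^bsub>fibre B g\<^esub> (- 1) \<odot>\<^bsub>fibre B g\<^esub> c"
  have x: "x \<in> carrier (fibre B g)" using bmult_closed[of \<one> g ?u c] g c by (simp add: x_def)
  have y: "y \<in> carrier (fibre B g)" using x c by (simp add: y_def)
  have cc: "bmult B g (inv g) c w \<in> carrier (fibre B \<one>)" if "w \<in> carrier (fibre B (inv g))" for w
    using bmult_closed[of g "inv g" c w] g c that by simp
  have "bmult B g (inv g) x w = bmult B g (inv g) c w" if "w \<in> carrier (fibre B (inv g))" for w
    using bmult_assoc[of \<one> g "inv g" ?u c w] g c that one_D_left[OF cc[OF that]] by (simp add: x_def)
  then have "bmult B g (inv g) y w = bmult B g (inv g) c w \<oplus>\<^bsub>D\<^esub> (- 1) \<odot>\<^bsub>D\<^esub> bmult B g (inv g) c w"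
    if "w \<in> carrier (fibre B (inv g))" for w
    using bmult_add_left[of g "inv g" w x "(- 1) \<odot>\<^bsub>fibre B g\<^esub> c"] bmult_scale_left[of g "inv g" w c "- 1"]
      that g c x by (simp add: y_def)
  then have "bmult B g (inv g) y (bstar B g y) = \<zero>\<^bsub>D\<^esub>"
    using D.M.r_neg[of "bmult B g (inv g) c (bstar B g y)"] D.neg_eq_scale cc bstar_closed[OF g y] by simp
  then have "(nrm (fibre B (inv g)) (bstar B g y))\<^sup>2 = 0"
    using nrm_cstar[of "inv g" "bstar B g y"] g y bstar_closed[OF g y] bstar_bstar[OF g y] D.nrm_zero by simp
  then have "nrm (fibre B g) y = 0"
    using nrm_bstar[OF g y] by simp
  then have "y = \<zero>\<^bsub>fibre B g\<^esub>"
    using F.nrm_eq_0[OF y] by simp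
  then show ?thesis
    using F.diff_eq_zeroD[of x c] x c by (simp add: y_def a_minus_def F.neg_eq_scale flip: x_def)
qed

lemma one_D_fibre_right:
  assumes g: "g \<in> carrier G" and c: "c \<in> carrier (fibre B g)"
  shows "bmult B g \<one> c \<one>\<^bsub>D\<^esub> = c"
proof -
  have "bstar B g (bmult B g \<one> c \<one>\<^bsub>D\<^esub>) = bstar B g c"
    using bstar_bmult[of g \<one> c "\<one>\<^bsub>D\<^esub>"] g c one_D_fibre[of "inv g" "bstar B g c"] bstar_closed[OF g c]
      D.adj_one by simp
  moreover have "bmult B g \<one> c \<one>\<^bsub>D\<^esub> \<in> carrier (fibre B g)"
    using bmult_closed[of g \<one> c "\<one>\<^bsub>D\<^esub>"] g c by simp
  ultimately show ?thesis
    using bstar_bstar[OF g] c by metis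
qed

end

section \<open>Finitely supported sections\<close>

context unital_fell_bundle
begin

abbreviation "Sec \<equiv> fin_sections G B"

text \<open>
  The support of a section; it equals the set used in the definition of \<open>fin_sections\<close>.
\<close>

definition supp :: "('a \<Rightarrow> 'b) \<Rightarrow> 'a set" where
  "supp \<xi> = {g \<in> carrier G. \<xi> g \<noteq> \<zero>\<^bsub>fibre B g\<^esub>}"

lemma Sec_simps:
  "carrier Sec = {\<xi> \<in> (\<Pi>\<^sub>E g\<in>carrier G. carrier (fibre B g)). finite (supp \<xi>)}"
  "zero Sec = (\<lambda>g\<in>carrier G. \<zero>\<^bsub>fibre B g\<^esub>)"
  "add Sec \<xi> \<eta> = (\<lambda>g\<in>carrier G. \<xi> g \<oplus>\<^bsub>fibre B g\<^esub> \<eta> g)"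
  "smult Sec c \<xi> = (\<lambda>g\<in>carrier G. c \<odot>\<^bsub>fibre B g\<^esub> \<xi> g)"
  "ract Sec \<xi> b = (\<lambda>g\<in>carrier G. bmult B g \<one> (\<xi> g) b)"
  "inner Sec \<xi> \<eta> = (\<Oplus>\<^bsub>D\<^esub>g\<in>supp \<xi>. ip g (\<xi> g) (\<eta> g))"
  "nrm Sec \<xi> = sqrt (nrm D (inner Sec \<xi> \<xi>))"
  by (simp_all add: fin_sections_def Let_def supp_def ip_def finsum_fibre_one)

lemma Sec_app: "\<xi> \<in> carrier Sec \<Longrightarrow> g \<in> carrier G \<Longrightarrow> \<xi> g \<in> carrier (fibre B g)"
  by (auto simp: Sec_simps)

lemma finite_supp: "\<xi> \<in> carrier Sec \<Longrightarrow> finite (supp \<xi>)"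
  by (simp add: Sec_simps)

lemma Sec_eqI:
  assumes "\<xi> \<in> carrier Sec" "\<eta> \<in> carrier Sec" "\<And>g. g \<in> carrier G \<Longrightarrow> \<xi> g = \<eta> g"
  shows "\<xi> = \<eta>"
proof (rule PiE_ext)
  show "\<xi> \<in> (\<Pi>\<^sub>E g\<in>carrier G. carrier (fibre B g))" "\<eta> \<in> (\<Pi>\<^sub>E g\<in>carrier G. carrier (fibre B g))"
    using assms(1,2) by (simp_all add: Sec_simps)
qed (rule assms(3))

lemma Sec_closedI:
  assumes "\<And>g. g \<in> carrier G \<Longrightarrow> f g \<in> carrier (fibre B g)" "finite S"
    and "\<And>g. g \<in> carrier G \<Longrightarrow> g \<notin> S \<Longrightarrow> f g = \<zero>\<^bsub>fibre B g\<^esub>"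
  shows "(\<lambda>g\<in>carrier G. f g) \<in> carrier Sec"
proof -
  have "supp (\<lambda>g\<in>carrier G. f g) \<subseteq> S"
    using assms(3) by (auto simp: supp_def)
  then show ?thesis
    using assms(1) finite_subset[OF _ assms(2)] by (auto simp: Sec_simps)
qed

declare Sec_app [simp] finite_supp [simp]

lemma not_suppD: "g \<in> carrier G \<Longrightarrow> g \<notin> supp \<xi> \<Longrightarrow> \<xi> g = \<zero>\<^bsub>fibre B g\<^esub>"
  by (auto simp: supp_def)

lemma Sec_closed:
  shows Sec_zero: "zero Sec \<in> carrier Sec"
    and Sec_add: "\<xi> \<in> carrier Sec \<Longrightarrow> \<eta> \<in> carrier Sec \<Longrightarrow> add Sec \<xi> \<eta> \<in> carrier Sec"
    and Sec_scale: "\<xi> \<in> carrier Sec \<Longrightarrow> smult Sec c \<xi> \<in> carrier Sec"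
    and Sec_ract: "\<xi> \<in> carrier Sec \<Longrightarrow> b \<in> carrier D \<Longrightarrow> ract Sec \<xi> b \<in> carrier Sec"
proof -
  have zero_add: "\<zero>\<^bsub>fibre B g\<^esub> \<oplus>\<^bsub>fibre B g\<^esub> \<zero>\<^bsub>fibre B g\<^esub> = \<zero>\<^bsub>fibre B g\<^esub>" if "g \<in> carrier G" for g
    using abelian_monoid.l_zero[OF abelian_group.axioms(1)[OF normed_space.abelian_group_V[OF normed_fibre[OF that]]]]
      fibre_zero_closed[OF that] by blast
  show "zero Sec \<in> carrier Sec"
    unfolding Sec_simps(2) by (rule Sec_closedI[of _ "{}"]) auto
  show "add Sec \<xi> \<eta> \<in> carrier Sec" if "\<xi> \<in> carrier Sec" "\<eta> \<in> carrier Sec"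
    unfolding Sec_simps(3) using that
    by (intro Sec_closedI[of _ "supp \<xi> \<union> supp \<eta>"]) (auto simp: not_suppD zero_add)
  show "smult Sec c \<xi> \<in> carrier Sec" if "\<xi> \<in> carrier Sec"
    unfolding Sec_simps(4) using that by (intro Sec_closedI[of _ "supp \<xi>"]) (auto simp: not_suppD)
  show "ract Sec \<xi> b \<in> carrier Sec" if "\<xi> \<in> carrier Sec" "b \<in> carrier D"
    unfolding Sec_simps(5)
  proof (rule Sec_closedI[of _ "supp \<xi>"])
    fix g assume g: "g \<in> carrier G"
    show "bmult B g \<one> (\<xi> g) b \<in> carrier (fibre B g)"
      using bmult_closed[of g \<one> "\<xi> g" b] that g by simp
    show "bmult B g \<one> (\<xi> g) b = \<zero>\<^bsub>fibre B g\<^esub>" if "g \<notin> supp \<xi>"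
      using bmult_zero_left[of g \<one> b] \<open>b \<in> carrier D\<close> g not_suppD[OF g that] by simp
  qed (use that in simp)
qed

lemma Sec_app_simps [simp]:
  assumes "g \<in> carrier G"
  shows "(\<xi> \<oplus>\<^bsub>Sec\<^esub> \<eta>) g = \<xi> g \<oplus>\<^bsub>fibre B g\<^esub> \<eta> g"
    and "(c \<odot>\<^bsub>Sec\<^esub> \<xi>) g = c \<odot>\<^bsub>fibre B g\<^esub> \<xi> g"
    and "ract Sec \<xi> b g = bmult B g \<one> (\<xi> g) b" and "\<zero>\<^bsub>Sec\<^esub> g = \<zero>\<^bsub>fibre B g\<^esub>"
  using assms by (simp_all add: Sec_simps(2-5))

lemma inner_Sec:
  assumes "\<xi> \<in> carrier Sec" "\<eta> \<in> carrier Sec" "finite S" "supp \<xi> \<subseteq> S" "S \<subseteq> carrier G"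
  shows "inner Sec \<xi> \<eta> = (\<Oplus>\<^bsub>D\<^esub>g\<in>S. ip g (\<xi> g) (\<eta> g))"
  unfolding Sec_simps(6)
  using assms by (intro D.M.add.finprod_mono_neutral_cong_left) (auto simp: subset_iff not_suppD)

lemma inner_Sec_right:
  assumes "\<xi> \<in> carrier Sec" "\<eta> \<in> carrier Sec" "finite S" "supp \<eta> \<subseteq> S" "S \<subseteq> carrier G"
  shows "inner Sec \<xi> \<eta> = (\<Oplus>\<^bsub>D\<^esub>g\<in>S. ip g (\<xi> g) (\<eta> g))"
proof -
  have sub: "supp \<xi> \<union> S \<subseteq> carrier G"
    using assms(5) by (auto simp: supp_def)
  have "inner Sec \<xi> \<eta> = (\<Oplus>\<^bsub>D\<^esub>g\<in>supp \<xi> \<union> S. ip g (\<xi> g) (\<eta> g))"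
    using assms sub by (intro inner_Sec) auto
  also have "\<dots> = (\<Oplus>\<^bsub>D\<^esub>g\<in>S. ip g (\<xi> g) (\<eta> g))"
  proof (rule D.M.add.finprod_mono_neutral_cong_right)
    fix g assume "g \<in> supp \<xi> \<union> S - S"
    then have "g \<in> carrier G" "g \<notin> supp \<eta>"
      using sub assms(4) by auto
    then show "ip g (\<xi> g) (\<eta> g) = \<zero>\<^bsub>D\<^esub>"
      using assms(1) by (simp add: not_suppD)
  qed (use assms sub in auto)
  finally show ?thesis .
qed

lemma supp_subset: "supp \<xi> \<subseteq> carrier G"
  by (auto simp: supp_def)

lemma module_Sec: "module complex_ring Sec"
proof (rule moduleI[OF cring_complex_ring])
  note F = normed_space.axioms(1)[OF normed_fibre]
  note ab = module.axioms(2)[OF F]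
  note mon = abelian_group.axioms(1)[OF ab]
  show "abelian_group Sec"
  proof (rule abelian_groupI)
    show "\<exists>\<eta>\<in>carrier Sec. \<eta> \<oplus>\<^bsub>Sec\<^esub> \<xi> = \<zero>\<^bsub>Sec\<^esub>" if \<xi>: "\<xi> \<in> carrier Sec" for \<xi>
    proof
      show "(- 1) \<odot>\<^bsub>Sec\<^esub> \<xi> \<oplus>\<^bsub>Sec\<^esub> \<xi> = \<zero>\<^bsub>Sec\<^esub>"
      proof (rule Sec_eqI)
        fix g assume g: "g \<in> carrier G"
        show "((- 1) \<odot>\<^bsub>Sec\<^esub> \<xi> \<oplus>\<^bsub>Sec\<^esub> \<xi>) g = \<zero>\<^bsub>Sec\<^esub> g"
          using g \<xi> normed_space.neg_eq_scale[OF normed_fibre[OF g], of "\<xi> g"]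
            abelian_group.l_neg[OF ab[OF g], of "\<xi> g"] by (simp add: Sec_simps(2-4))
      qed (use \<xi> Sec_closed in auto)
    qed (use \<xi> Sec_closed in auto)
  qed (auto intro!: Sec_eqI simp: Sec_closed, auto simp: Sec_simps(2,3) abelian_monoid.a_ac[OF mon]
        abelian_monoid.l_zero[OF mon] abelian_monoid.r_zero[OF mon])
qed (auto intro!: Sec_eqI simp: Sec_closed, auto simp: Sec_simps(3,4) normed_space.scale_add_left[OF normed_fibre]
      normed_space.scale_add_right[OF normed_fibre] normed_space.scale_scale[OF normed_fibre]
      normed_space.scale_one[OF normed_fibre])

lemma pre_hilbert_Sec: "pre_hilbert D Sec"
proof (intro pre_hilbert.intro unital_cstar_D pre_hilbert_axioms.intro module_Sec)
  fix \<xi> \<eta> assume \<xi>: "\<xi> \<in> carrier Sec" and \<eta>: "\<eta> \<in> carrier Sec"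
  let ?S = "supp \<xi>"
  note sup = supp_subset[of \<xi>] and mem = subsetD[OF supp_subset[of \<xi>]]
  have ipc: "(\<lambda>g. ip g (\<xi> g) (\<theta> g)) \<in> ?S \<rightarrow> carrier D" if "\<theta> \<in> carrier Sec" for \<theta>
    using \<xi> that mem by (auto simp: Sec_app)
  show "ract Sec \<xi> a \<in> carrier Sec" if "a \<in> carrier D" for a
    using Sec_ract \<xi> that by simp
  show "inner Sec \<xi> \<eta> \<in> carrier D"
    unfolding Sec_simps(6) by (rule D.M.finsum_closed[OF ipc[OF \<eta>]])
  show "inner Sec \<xi> (c \<odot>\<^bsub>Sec\<^esub> \<eta>) = c \<odot>\<^bsub>D\<^esub> inner Sec \<xi> \<eta>" for c
  proof -
    have "inner Sec \<xi> (c \<odot>\<^bsub>Sec\<^esub> \<eta>) = (\<Oplus>\<^bsub>D\<^esub>g\<in>?S. c \<odot>\<^bsub>D\<^esub> ip g (\<xi> g) (\<eta> g))"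
      unfolding Sec_simps(6) using \<xi> \<eta> mem
      by (intro D.M.finsum_cong') (auto simp: Sec_simps(4) ip_scale_right)
    then show ?thesis
      using D.finsum_smult_ldistr[OF finite_supp[OF \<xi>] _ ipc[OF \<eta>], of c] by (simp add: Sec_simps(6))
  qed
  show "inner Sec \<xi> (ract Sec \<eta> a) = inner Sec \<xi> \<eta> \<otimes>\<^bsub>D\<^esub> a" if a: "a \<in> carrier D" for a
  proof -
    have "inner Sec \<xi> (ract Sec \<eta> a) = (\<Oplus>\<^bsub>D\<^esub>g\<in>?S. ip g (\<xi> g) (\<eta> g) \<otimes>\<^bsub>D\<^esub> a)"
      unfolding Sec_simps(6) using \<xi> \<eta> mem a bmult_closed[of \<one> \<one>]
      by (intro D.M.finsum_cong') (auto simp: Sec_simps(5) bmult_ract_ip)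
    then show ?thesis
      using D.finsum_ldistr[OF finite_supp[OF \<xi>] a ipc[OF \<eta>]] by (simp add: Sec_simps(6))
  qed
  show "adj D (inner Sec \<xi> \<eta>) = inner Sec \<eta> \<xi>"
  proof -
    have "adj D (inner Sec \<xi> \<eta>) = (\<Oplus>\<^bsub>D\<^esub>g\<in>?S. adj D (ip g (\<xi> g) (\<eta> g)))"
      unfolding Sec_simps(6) by (rule D.adj_finsum[OF finite_supp[OF \<xi>] ipc[OF \<eta>]])
    also have "\<dots> = (\<Oplus>\<^bsub>D\<^esub>g\<in>?S. ip g (\<eta> g) (\<xi> g))"
      using \<xi> \<eta> mem by (intro D.M.finsum_cong') (auto simp: bstar_ip)
    also have "\<dots> = inner Sec \<eta> \<xi>"
      using \<xi> \<eta> sup by (intro inner_Sec_right[symmetric]) auto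
    finally show ?thesis .
  qed
  show "D.pos (inner Sec \<xi> \<xi>)"
    unfolding Sec_simps(6) using \<xi> mem by (intro D.pos_finsum) (auto intro: pos_ip)
  show "\<xi> = \<zero>\<^bsub>Sec\<^esub>" if "inner Sec \<xi> \<xi> = \<zero>\<^bsub>D\<^esub>"
  proof (rule Sec_eqI[OF \<xi> Sec_zero])
    fix g assume g: "g \<in> carrier G"
    have "\<xi> g = \<zero>\<^bsub>fibre B g\<^esub>"
    proof (cases "g \<in> ?S")
      case True
      have "nrm D (ip g (\<xi> g) (\<xi> g)) \<le> nrm D (inner Sec \<xi> \<xi>)"
        unfolding Sec_simps(6) using \<xi> mem True
        by (intro D.nrm_le_finsum_pos) (auto intro: pos_ip)
      then have "(nrm (fibre B g) (\<xi> g))\<^sup>2 \<le> 0"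
        using that D.nrm_zero nrm_ip[OF g] \<xi> g by simp
      then show ?thesis
        using normed_space.nrm_eq_0[OF normed_fibre[OF g], of "\<xi> g"] \<xi> g by simp
    qed (use not_suppD g in auto)
    then show "\<xi> g = \<zero>\<^bsub>Sec\<^esub> g"
      using g by (simp add: Sec_simps(2))
  qed
  show "nrm Sec \<xi> = sqrt (nrm D (inner Sec \<xi> \<xi>))"
    by (rule Sec_simps(7))
  fix \<zeta> assume \<zeta>: "\<zeta> \<in> carrier Sec"
  have "inner Sec \<xi> (\<eta> \<oplus>\<^bsub>Sec\<^esub> \<zeta>) = (\<Oplus>\<^bsub>D\<^esub>g\<in>?S. ip g (\<xi> g) (\<eta> g) \<oplus>\<^bsub>D\<^esub> ip g (\<xi> g) (\<zeta> g))"
    unfolding Sec_simps(6) using \<xi> \<eta> \<zeta> mem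
    by (intro D.M.finsum_cong') (auto simp: Sec_simps(3) ip_add_right)
  also have "\<dots> = inner Sec \<xi> \<eta> \<oplus>\<^bsub>D\<^esub> inner Sec \<xi> \<zeta>"
    unfolding Sec_simps(6) by (rule D.M.finsum_addf[OF ipc[OF \<eta>] ipc[OF \<zeta>]])
  finally show "inner Sec \<xi> (\<eta> \<oplus>\<^bsub>Sec\<^esub> \<zeta>) = inner Sec \<xi> \<eta> \<oplus>\<^bsub>D\<^esub> inner Sec \<xi> \<zeta>" .
qed

sublocale Sec: pre_hilbert D Sec by (rule pre_hilbert_Sec)

lemma nrm_Sec_app_le:
  assumes \<xi>: "\<xi> \<in> carrier Sec" and g: "g \<in> carrier G"
  shows "nrm (fibre B g) (\<xi> g) \<le> nrm Sec \<xi>"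
proof (cases "g \<in> supp \<xi>")
  case True
  have "nrm D (ip g (\<xi> g) (\<xi> g)) \<le> nrm D (inner Sec \<xi> \<xi>)"
    unfolding Sec_simps(6) using \<xi> True subsetD[OF supp_subset[of \<xi>]]
    by (intro D.nrm_le_finsum_pos) (auto intro: pos_ip)
  then have "(nrm (fibre B g) (\<xi> g))\<^sup>2 \<le> (nrm Sec \<xi>)\<^sup>2"
    using \<xi> g by (simp add: nrm_ip Sec.nrm_V_square)
  then show ?thesis
    by (rule power2_le_imp_le) (rule Sec.nrm_V_nonneg[OF \<xi>])
next
  case False
  then show ?thesis
    using not_suppD[OF g False] normed_space.nrm_zero[OF normed_fibre[OF g]] Sec.nrm_V_nonneg[OF \<xi>] by simp
qed

text \<open>The section with value \<open>a\<close> at \<open>g\<close> and zero elsewhere.\<close>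

definition single :: "'a \<Rightarrow> 'b \<Rightarrow> 'a \<Rightarrow> 'b" where
  "single g a = (\<lambda>h\<in>carrier G. if h = g then a else \<zero>\<^bsub>fibre B h\<^esub>)"

lemma single_closed [simp]: "g \<in> carrier G \<Longrightarrow> a \<in> carrier (fibre B g) \<Longrightarrow> single g a \<in> carrier Sec"
  unfolding single_def by (rule Sec_closedI[of _ "{g}"]) auto

lemma supp_single: "supp (single g a) \<subseteq> {g}"
  by (auto simp: supp_def single_def)

lemma inner_single:
  assumes "g \<in> carrier G" "a \<in> carrier (fibre B g)" "\<xi> \<in> carrier Sec"
  shows "inner Sec (single g a) \<xi> = ip g a (\<xi> g)"
proof -
  have "inner Sec (single g a) \<xi> = (\<Oplus>\<^bsub>D\<^esub>h\<in>{g}. ip h (single g a h) (\<xi> h))"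
    using assms supp_single by (intro inner_Sec) auto
  then show ?thesis
    using assms D.M.finsum_insert[of "{}" g "\<lambda>h. ip h (single g a h) (\<xi> h)"] D.M.r_zero
    by (simp add: single_def)
qed

lemma nrm_single:
  assumes "g \<in> carrier G" "a \<in> carrier (fibre B g)"
  shows "nrm Sec (single g a) = nrm (fibre B g) a"
  using assms normed_space.nrm_nonneg[OF normed_fibre, of g a]
  by (simp add: Sec_simps(7) inner_single nrm_ip) (simp add: single_def nrm_ip)

text \<open>
  Finitely supported sections are finite sums of sections supported at one point.
\<close>

lemma section_induct [consumes 1, case_names zero add]:
  assumes \<xi>: "\<xi> \<in> carrier Sec" and zero: "P \<zero>\<^bsub>Sec\<^esub>"
    and add: "\<And>g a \<eta>. g \<in> carrier G \<Longrightarrow> a \<in> carrier (fibre B g) \<Longrightarrow> \<eta> \<in> carrier Sec \<Longrightarrow> P \<eta>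
      \<Longrightarrow> P (single g a \<oplus>\<^bsub>Sec\<^esub> \<eta>)"
  shows "P \<xi>"
proof -
  have "\<forall>\<xi>\<in>carrier Sec. supp \<xi> \<subseteq> S \<longrightarrow> P \<xi>" if "finite S" for S
    using that
  proof (induction S rule: finite_induct)
    case empty
    show ?case
    proof (intro ballI impI)
      fix \<xi> assume "\<xi> \<in> carrier Sec" "supp \<xi> \<subseteq> {}"
      then have "\<xi> = \<zero>\<^bsub>Sec\<^esub>"
        by (intro Sec_eqI Sec_zero) (auto simp: Sec_simps(2) not_suppD)
      then show "P \<xi>" using zero by simp
    qed
  next
    case (insert g S)
    show ?case
    proof (intro ballI impI)
      fix \<xi> assume \<xi>: "\<xi> \<in> carrier Sec" "supp \<xi> \<subseteq> insert g S"
      show "P \<xi>"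
      proof (cases "g \<in> carrier G")
        case True
        define \<eta> where "\<eta> = (\<lambda>h\<in>carrier G. if h = g then \<zero>\<^bsub>fibre B h\<^esub> else \<xi> h)"
        have \<eta>: "\<eta> \<in> carrier Sec"
          unfolding \<eta>_def using \<xi> by (intro Sec_closedI[of _ "supp \<xi>"]) (auto simp: not_suppD)
        have "supp \<eta> \<subseteq> S"
          using \<xi>(2) by (auto simp: supp_def \<eta>_def split: if_splits)
        then have "P \<eta>" using insert.IH \<eta> by blast
        then have "P (single g (\<xi> g) \<oplus>\<^bsub>Sec\<^esub> \<eta>)"
          using True \<xi> \<eta> by (intro add) auto
        moreover have "single g (\<xi> g) \<oplus>\<^bsub>Sec\<^esub> \<eta> = \<xi>"
        proof (rule Sec_eqI[OF _ \<xi>(1)])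
          fix h assume h: "h \<in> carrier G"
          have "abelian_monoid (fibre B h)"
            using normed_space.abelian_group_V[OF normed_fibre[OF h]] by (rule abelian_group.axioms(1))
          then show "(single g (\<xi> g) \<oplus>\<^bsub>Sec\<^esub> \<eta>) h = \<xi> h"
            using h \<xi>(1) abelian_monoid.l_zero[of "fibre B h" "\<xi> h"] abelian_monoid.r_zero[of "fibre B h" "\<xi> h"]
            by (auto simp: Sec_simps(3) single_def \<eta>_def)
        qed (use True \<xi> \<eta> in \<open>auto intro: Sec_add\<close>)
        ultimately show ?thesis by simp
      next
        case False
        then have "supp \<xi> \<subseteq> S" using \<xi>(2) supp_subset[of \<xi>] by auto
        then show ?thesis using insert.IH \<xi>(1) by blast
      qed
    qed
  qed
  from this[OF finite_supp[OF \<xi>]] show ?thesis using \<xi> by blast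
qed

section \<open>The regular representation\<close>

text \<open>
  The action of \<open>b \<in> B\<^sub>g\<close> on finitely supported sections, which \<open>reg_rep G B g b\<close> extends to
  \<open>l2 G B\<close>.
\<close>

definition shift :: "'a \<Rightarrow> 'b \<Rightarrow> ('a \<Rightarrow> 'b) \<Rightarrow> 'a \<Rightarrow> 'b" where
  "shift g b \<xi> = (\<lambda>h\<in>carrier G. bmult B g (inv g \<otimes> h) b (\<xi> (inv g \<otimes> h)))"

lemma mult_inv_cancel: "g \<in> carrier G \<Longrightarrow> h \<in> carrier G \<Longrightarrow> g \<otimes> (inv g \<otimes> h) = h"
  by (simp flip: m_assoc)

lemma inv_mult_cancel: "g \<in> carrier G \<Longrightarrow> h \<in> carrier G \<Longrightarrow> inv g \<otimes> (g \<otimes> h) = h"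
  by (simp flip: m_assoc)

lemma shift_closed:
  assumes "g \<in> carrier G" "b \<in> carrier (fibre B g)" "\<xi> \<in> carrier Sec"
  shows "shift g b \<xi> \<in> carrier Sec"
  unfolding shift_def
proof (rule Sec_closedI[of _ "(\<lambda>k. g \<otimes> k) ` supp \<xi>"])
  fix h assume h: "h \<in> carrier G"
  show "bmult B g (inv g \<otimes> h) b (\<xi> (inv g \<otimes> h)) \<in> carrier (fibre B h)"
    using bmult_closed[of g "inv g \<otimes> h" b "\<xi> (inv g \<otimes> h)"] assms h by (simp add: mult_inv_cancel)
  assume "h \<notin> (\<lambda>k. g \<otimes> k) ` supp \<xi>"
  then have "inv g \<otimes> h \<notin> supp \<xi>"
    using mult_inv_cancel[OF assms(1) h] by (metis imageI)
  then have "\<xi> (inv g \<otimes> h) = \<zero>\<^bsub>fibre B (inv g \<otimes> h)\<^esub>"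
    using assms h by (intro not_suppD) auto
  then show "bmult B g (inv g \<otimes> h) b (\<xi> (inv g \<otimes> h)) = \<zero>\<^bsub>fibre B h\<^esub>"
    using bmult_zero_right[of g "inv g \<otimes> h" b] assms h by (simp add: mult_inv_cancel)
qed (use assms in simp)

lemma shift_app:
  "g \<in> carrier G \<Longrightarrow> h \<in> carrier G \<Longrightarrow> shift g b \<xi> (g \<otimes> h) = bmult B g h b (\<xi> h)"
  by (simp add: shift_def inv_mult_cancel)

text \<open>
  Sections may be compared at the points \<open>g h\<close>, where \<open>shift g b\<close> takes a simple form.
\<close>

lemma Sec_eq_translateI:
  assumes "\<xi> \<in> carrier Sec" "\<eta> \<in> carrier Sec" "g \<in> carrier G"
    "\<And>h. h \<in> carrier G \<Longrightarrow> \<xi> (g \<otimes> h) = \<eta> (g \<otimes> h)"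
  shows "\<xi> = \<eta>"
proof (rule Sec_eqI[OF assms(1,2)])
  show "\<xi> h = \<eta> h" if "h \<in> carrier G" for h
    using assms(4)[of "inv g \<otimes> h"] that assms(3) by (simp add: mult_inv_cancel)
qed

lemma linear_shift:
  assumes g: "g \<in> carrier G" "b \<in> carrier (fibre B g)"
  shows "linear_map Sec Sec (shift g b)"
  unfolding linear_map_def
proof (intro conjI ballI allI)
  show "shift g b \<in> carrier Sec \<rightarrow> carrier Sec"
    using shift_closed[OF g] by auto
  fix \<xi> assume \<xi>: "\<xi> \<in> carrier Sec"
  show "shift g b (c \<odot>\<^bsub>Sec\<^esub> \<xi>) = c \<odot>\<^bsub>Sec\<^esub> shift g b \<xi>" for c
    using g \<xi> by (intro Sec_eq_translateI[where g = g])
      (auto simp: shift_closed Sec_closed shift_app bmult_scale_right)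
  fix \<eta> assume \<eta>: "\<eta> \<in> carrier Sec"
  show "shift g b (\<xi> \<oplus>\<^bsub>Sec\<^esub> \<eta>) = shift g b \<xi> \<oplus>\<^bsub>Sec\<^esub> shift g b \<eta>"
    using g \<xi> \<eta> by (intro Sec_eq_translateI[where g = g])
      (auto simp: shift_closed Sec_closed shift_app bmult_add_right)
qed

lemma shift_shift:
  assumes "g \<in> carrier G" "b \<in> carrier (fibre B g)" "h \<in> carrier G" "c \<in> carrier (fibre B h)" "\<xi> \<in> carrier Sec"
  shows "shift g b (shift h c \<xi>) = shift (g \<otimes> h) (bmult B g h b c) \<xi>"
proof (rule Sec_eq_translateI[of _ _ "g \<otimes> h"])
  fix k assume k: "k \<in> carrier G"
  have "shift g b (shift h c \<xi>) (g \<otimes> (h \<otimes> k)) = bmult B g (h \<otimes> k) b (bmult B h k c (\<xi> k))"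
    using assms k by (simp add: shift_app del: m_assoc)
  then show "shift g b (shift h c \<xi>) (g \<otimes> h \<otimes> k) = shift (g \<otimes> h) (bmult B g h b c) \<xi> (g \<otimes> h \<otimes> k)"
    using assms k shift_app[of "g \<otimes> h" k "bmult B g h b c" \<xi>] bmult_assoc[of g h k b c "\<xi> k"]
    by (simp add: m_assoc)
qed (use assms shift_closed bmult_closed in auto)

lemma shift_add_left:
  assumes "g \<in> carrier G" "b \<in> carrier (fibre B g)" "c \<in> carrier (fibre B g)" "\<xi> \<in> carrier Sec"
  shows "shift g (b \<oplus>\<^bsub>fibre B g\<^esub> c) \<xi> = shift g b \<xi> \<oplus>\<^bsub>Sec\<^esub> shift g c \<xi>"
  using assms by (intro Sec_eq_translateI[where g = g])
    (auto simp: shift_closed Sec_closed shift_app bmult_add_left)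

lemma shift_scale_left:
  assumes "g \<in> carrier G" "b \<in> carrier (fibre B g)" "\<xi> \<in> carrier Sec"
  shows "shift g (c \<odot>\<^bsub>fibre B g\<^esub> b) \<xi> = c \<odot>\<^bsub>Sec\<^esub> shift g b \<xi>"
  using assms by (intro Sec_eq_translateI[where g = g])
    (auto simp: shift_closed Sec_closed shift_app bmult_scale_left)

lemma shift_one: "\<xi> \<in> carrier Sec \<Longrightarrow> shift \<one> \<one>\<^bsub>D\<^esub> \<xi> = \<xi>"
  by (rule Sec_eqI) (auto simp: shift_closed, simp add: shift_def one_D_fibre)

lemma shift_single:
  assumes "g \<in> carrier G" "b \<in> carrier (fibre B g)" "h \<in> carrier G" "c \<in> carrier (fibre B h)"
  shows "shift g b (single h c) = single (g \<otimes> h) (bmult B g h b c)"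
  using assms by (intro Sec_eq_translateI[where g = g])
    (auto simp: shift_closed bmult_closed shift_app, auto simp: single_def)

lemma inner_shift:
  assumes g: "g \<in> carrier G" "b \<in> carrier (fibre B g)" and \<xi>: "\<xi> \<in> carrier Sec" and \<eta>: "\<eta> \<in> carrier Sec"
  shows "inner Sec (shift g b \<xi>) \<eta> = inner Sec \<xi> (shift (inv g) (bstar B g b) \<eta>)"
proof -
  let ?f = "\<lambda>k. g \<otimes> k"
  note mem = subsetD[OF supp_subset[of \<xi>]]
  have supp: "supp (shift g b \<xi>) \<subseteq> ?f ` supp \<xi>"
  proof
    fix h assume h: "h \<in> supp (shift g b \<xi>)"
    then have hG: "h \<in> carrier G" by (simp add: supp_def)
    have "inv g \<otimes> h \<in> supp \<xi>"
    proof (rule ccontr)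
      assume "inv g \<otimes> h \<notin> supp \<xi>"
      then have "\<xi> (inv g \<otimes> h) = \<zero>\<^bsub>fibre B (inv g \<otimes> h)\<^esub>"
        using g hG by (intro not_suppD) auto
      then show False
        using h hG g bmult_zero_right[of g "inv g \<otimes> h" b] by (simp add: supp_def shift_def mult_inv_cancel)
    qed
    then show "h \<in> ?f ` supp \<xi>"
      using mult_inv_cancel[OF g(1) hG] by (metis imageI)
  qed
  have inj: "inj_on ?f (supp \<xi>)"
    using g mem by (auto intro!: inj_onI)
  have "inner Sec (shift g b \<xi>) \<eta> = (\<Oplus>\<^bsub>D\<^esub>h\<in>?f ` supp \<xi>. ip h (shift g b \<xi> h) (\<eta> h))"
    using supp \<xi> \<eta> g mem by (intro inner_Sec) (auto simp: shift_closed)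
  also have "\<dots> = (\<Oplus>\<^bsub>D\<^esub>k\<in>supp \<xi>. ip (g \<otimes> k) (shift g b \<xi> (g \<otimes> k)) (\<eta> (g \<otimes> k)))"
    using \<xi> \<eta> g mem by (intro D.M.finsum_reindex[OF _ inj]) (auto simp: shift_closed)
  also have "\<dots> = (\<Oplus>\<^bsub>D\<^esub>k\<in>supp \<xi>. ip k (\<xi> k) (shift (inv g) (bstar B g b) \<eta> k))"
  proof (rule D.M.finsum_cong'[OF refl])
    fix k assume "k \<in> supp \<xi>"
    then have k: "k \<in> carrier G" by (rule mem)
    have "ip (g \<otimes> k) (bmult B g k b (\<xi> k)) (\<eta> (g \<otimes> k))
        = bmult B (inv k \<otimes> inv g) (g \<otimes> k) (bmult B (inv k) (inv g) (bstar B k (\<xi> k)) (bstar B g b)) (\<eta> (g \<otimes> k))"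
      using g k \<xi> by (simp add: ip_def bstar_bmult inv_mult_group)
    also have "\<dots> = bmult B (inv k) (inv g \<otimes> (g \<otimes> k)) (bstar B k (\<xi> k))
        (bmult B (inv g) (g \<otimes> k) (bstar B g b) (\<eta> (g \<otimes> k)))"
      using g k \<xi> \<eta> by (intro bmult_assoc) (auto simp: bstar_closed)
    also have "\<dots> = ip k (\<xi> k) (shift (inv g) (bstar B g b) \<eta> k)"
      using g k by (simp add: ip_def shift_def inv_mult_cancel)
    finally show "ip (g \<otimes> k) (shift g b \<xi> (g \<otimes> k)) (\<eta> (g \<otimes> k)) = ip k (\<xi> k) (shift (inv g) (bstar B g b) \<eta> k)"
      using g k by (simp add: shift_app)
  qed (use \<xi> \<eta> g mem in \<open>auto simp: shift_closed bstar_closed\<close>)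
  also have "\<dots> = inner Sec \<xi> (shift (inv g) (bstar B g b) \<eta>)"
    by (simp add: Sec_simps(6))
  finally show ?thesis .
qed

text \<open>With \<open>v\<^sup>* v = \<parallel>b\<^sup>* b\<parallel> - b\<^sup>* b\<close> one has
  \<open>\<parallel>b\<parallel>\<^sup>2 \<langle>\<xi>, \<xi>\<rangle> - \<langle>b \<xi>, b \<xi>\<rangle> = \<langle>v \<xi>, v \<xi>\<rangle>\<close>.\<close>

lemma nrm_shift_le:
  assumes g: "g \<in> carrier G" "b \<in> carrier (fibre B g)" and \<xi>: "\<xi> \<in> carrier Sec"
  shows "nrm Sec (shift g b \<xi>) \<le> nrm (fibre B g) b * nrm Sec \<xi>"
proof -
  define p N where "p = ip g b b" and "N = nrm D p"
  have p: "p \<in> carrier D" "D.pos p" and N: "N = (nrm (fibre B g) b)\<^sup>2"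
    using g by (auto simp: p_def N_def pos_ip nrm_ip)
  have "D.pos (complex_of_real N \<odot>\<^bsub>D\<^esub> \<one>\<^bsub>D\<^esub> \<ominus>\<^bsub>D\<^esub> p)"
    using p D.pos_adj[OF p(2)] by (intro D.pos_scalar_minus) (auto simp: N_def)
  then obtain v where v: "v \<in> carrier D" "complex_of_real N \<odot>\<^bsub>D\<^esub> \<one>\<^bsub>D\<^esub> \<ominus>\<^bsub>D\<^esub> p = adj D v \<otimes>\<^bsub>D\<^esub> v"
    using D.positive_iff_pos unfolding positive_def by blast
  have sq: "inner Sec (shift h c \<xi>) (shift h c \<xi>) = inner Sec \<xi> (shift \<one> (ip h c c) \<xi>)"
    if "h \<in> carrier G" "c \<in> carrier (fibre B h)" for h c
    using that \<xi> by (simp add: inner_shift shift_closed shift_shift bstar_closed ip_def)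
  define X where "X = inner Sec \<xi> \<xi>"
  have X: "X \<in> carrier D" using Sec.inner_closed \<xi> by (simp add: X_def)
  have "complex_of_real N \<odot>\<^bsub>D\<^esub> \<one>\<^bsub>D\<^esub> = (complex_of_real N \<odot>\<^bsub>D\<^esub> \<one>\<^bsub>D\<^esub> \<ominus>\<^bsub>D\<^esub> p) \<oplus>\<^bsub>D\<^esub> p"
    using p by (intro D.minus_add_cancel[symmetric]) auto
  then have "complex_of_real N \<odot>\<^bsub>fibre B \<one>\<^esub> \<one>\<^bsub>D\<^esub> = ip \<one> v v \<oplus>\<^bsub>fibre B \<one>\<^esub> p"
    unfolding v(2) by (simp add: ip_def)
  then have "complex_of_real N \<odot>\<^bsub>Sec\<^esub> \<xi> = shift \<one> (ip \<one> v v) \<xi> \<oplus>\<^bsub>Sec\<^esub> shift \<one> p \<xi>"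
    using shift_scale_left[of \<one> "\<one>\<^bsub>D\<^esub>" \<xi> "complex_of_real N"] shift_add_left[of \<one> "ip \<one> v v" p \<xi>] v(1) p \<xi>
    by (simp add: shift_one)
  then have "complex_of_real N \<odot>\<^bsub>D\<^esub> X = inner Sec (shift \<one> v \<xi>) (shift \<one> v \<xi>) \<oplus>\<^bsub>D\<^esub> inner Sec (shift g b \<xi>) (shift g b \<xi>)"
    using Sec.inner_scale_right[OF \<xi> \<xi>, of "complex_of_real N"] sq[of \<one> v] sq[of g b] g v(1) p \<xi>
      Sec.inner_add_right[OF \<xi> shift_closed[of \<one> "ip \<one> v v" \<xi>] shift_closed[of \<one> p \<xi>]]
    by (simp add: X_def p_def)
  then have "complex_of_real N \<odot>\<^bsub>D\<^esub> X \<ominus>\<^bsub>D\<^esub> inner Sec (shift g b \<xi>) (shift g b \<xi>)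
      = inner Sec (shift \<one> v \<xi>) (shift \<one> v \<xi>)"
    using D.add_minus_cancel Sec.inner_closed shift_closed g v(1) \<xi> by simp
  then have "nrm D (inner Sec (shift g b \<xi>) (shift g b \<xi>)) \<le> nrm D (complex_of_real N \<odot>\<^bsub>D\<^esub> X)"
    using g v(1) \<xi> X by (intro D.nrm_mono) (auto intro!: Sec.pos_inner shift_closed simp del: D_simps, auto)
  also have "\<dots> = N * nrm D X"
    using D.nrm_smult[OF X] by (simp add: N norm_power)
  finally have "(nrm Sec (shift g b \<xi>))\<^sup>2 \<le> (nrm (fibre B g) b * nrm Sec \<xi>)\<^sup>2"
    using shift_closed[OF g \<xi>] \<xi> by (simp add: Sec.nrm_V_square power_mult_distrib N X_def)
  then show ?thesis
    by (rule power2_le_imp_le)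
      (use Sec.nrm_V_nonneg[OF \<xi>] normed_space.nrm_nonneg[OF normed_fibre[OF g(1)] g(2)] in simp)
qed

end

section \<open>The reduced algebra and its conditional expectation\<close>

context unital_fell_bundle
begin

lemma pre_hilbert_l2: "pre_hilbert D (l2 G B)"
  unfolding l2_def by (rule Sec.pre_hilbert_completion)

sublocale l2: pre_hilbert D "l2 G B" by (rule pre_hilbert_l2)

abbreviation "emb \<equiv> embed Sec"

lemmas emb_closed [simp] = Sec.embed_closed[folded l2_def]
  and emb_zero = Sec.embed_zero[folded l2_def]
  and emb_add = Sec.embed_add[folded l2_def]
  and emb_scale = Sec.embed_scale[folded l2_def]
  and emb_ract = Sec.embed_ract[folded l2_def]
  and nrm_emb = Sec.nrm_embed[folded l2_def]
  and inner_emb = Sec.inner_embed[folded l2_def]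
  and l2_op_eqI = Sec.C_op_eqI[folded l2_def]
  and l2_eq_by_inner = Sec.completion_eq_by_inner[folded l2_def]

lemma reg_rep:
  assumes g: "g \<in> carrier G" and b: "b \<in> carrier (fibre B g)"
  shows reg_rep_L [simp]: "reg_rep G B g b \<in> carrier l2.L"
    and reg_rep_emb: "\<xi> \<in> carrier Sec \<Longrightarrow> reg_rep G B g b (emb \<xi>) = emb (shift g b \<xi>)"
proof -
  let ?P = "\<lambda>T. T \<in> carrier l2.L \<and> (\<forall>\<xi>\<in>carrier Sec. T (emb \<xi>) = emb (shift g b \<xi>))"
  have "\<exists>T. ?P T"
  proof (rule Sec.extend_adjoint_pair[folded l2_def, of "shift g b" "nrm (fibre B g) b" "shift (inv g) (bstar B g b)"])
    show "nrm Sec (shift (inv g) (bstar B g b) \<xi>) \<le> nrm (fibre B g) b * nrm Sec \<xi>" if "\<xi> \<in> carrier Sec" for \<xi>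
      using nrm_shift_le[of "inv g" "bstar B g b" \<xi>] that g b by (simp add: bstar_closed nrm_bstar)
    show "0 \<le> nrm (fibre B g) b"
      using normed_space.nrm_nonneg[OF normed_fibre[OF g] b] .
  qed (use g b in \<open>auto intro: linear_shift nrm_shift_le bstar_closed inner_shift\<close>)
  then have "\<exists>!T. ?P T"
    by (rule ex_ex1I) (use l2_op_eqI in auto)
  then have "?P (THE T. ?P T)"
    by (rule theI')
  then have "?P (reg_rep G B g b)"
    unfolding reg_rep_def shift_def .
  then show "reg_rep G B g b \<in> carrier l2.L"
    "\<xi> \<in> carrier Sec \<Longrightarrow> reg_rep G B g b (emb \<xi>) = emb (shift g b \<xi>)"
    by auto
qed

lemma reg_rep_eqI:
  assumes "g \<in> carrier G" "b \<in> carrier (fibre B g)" "T \<in> carrier l2.L"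
    and "\<And>\<xi>. \<xi> \<in> carrier Sec \<Longrightarrow> T (emb \<xi>) = emb (shift g b \<xi>)"
  shows "T = reg_rep G B g b"
  using assms by (intro l2_op_eqI) (simp_all add: reg_rep_emb)

lemma reg_rep_mult:
  assumes "g \<in> carrier G" "b \<in> carrier (fibre B g)" "h \<in> carrier G" "c \<in> carrier (fibre B h)"
  shows "reg_rep G B g b \<otimes>\<^bsub>l2.L\<^esub> reg_rep G B h c = reg_rep G B (g \<otimes> h) (bmult B g h b c)"
  using assms by (intro reg_rep_eqI) (simp_all add: bmult_closed l2.mult_L reg_rep_emb shift_closed shift_shift)

lemma reg_rep_add:
  assumes "g \<in> carrier G" "b \<in> carrier (fibre B g)" "c \<in> carrier (fibre B g)"
  shows "reg_rep G B g b \<oplus>\<^bsub>l2.L\<^esub> reg_rep G B g c = reg_rep G B g (b \<oplus>\<^bsub>fibre B g\<^esub> c)"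
  using assms by (intro reg_rep_eqI) (simp_all add: l2.add_L reg_rep_emb shift_closed shift_add_left emb_add)

lemma reg_rep_scale:
  assumes "g \<in> carrier G" "b \<in> carrier (fibre B g)"
  shows "c \<odot>\<^bsub>l2.L\<^esub> reg_rep G B g b = reg_rep G B g (c \<odot>\<^bsub>fibre B g\<^esub> b)"
  using assms by (intro reg_rep_eqI) (simp_all add: l2.scale_L reg_rep_emb shift_closed shift_scale_left emb_scale)

lemma reg_rep_adj:
  assumes g: "g \<in> carrier G" and b: "b \<in> carrier (fibre B g)"
  shows "adj l2.L (reg_rep G B g b) = reg_rep G B (inv g) (bstar B g b)"
proof (rule reg_rep_eqI)
  fix \<xi> assume \<xi>: "\<xi> \<in> carrier Sec"
  show "adj l2.L (reg_rep G B g b) (emb \<xi>) = emb (shift (inv g) (bstar B g b) \<xi>)"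
  proof (rule l2_eq_by_inner)
    fix \<zeta> assume \<zeta>: "\<zeta> \<in> carrier Sec"
    show "inner (l2 G B) (emb \<zeta>) (adj l2.L (reg_rep G B g b) (emb \<xi>))
        = inner (l2 G B) (emb \<zeta>) (emb (shift (inv g) (bstar B g b) \<xi>))"
      using g b \<xi> \<zeta>
      by (simp add: l2.inner_adj_right reg_rep_emb inner_emb shift_closed bstar_closed inner_shift)
  qed (use g b \<xi> l2.adj_L(1) shift_closed bstar_closed in auto)
qed (use g b l2.adj_L(1) bstar_closed in auto)

text \<open>
  The generating set of the reduced algebra, which is already closed under scalars, products and
  adjoints.
\<close>

definition generators :: "(('a, 'b) l2_op) set" where
  "generators = {reg_rep G B g b | g b. g \<in> carrier G \<and> b \<in> carrier (fibre B g)}"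

lemma generators_star_closed:
  shows "generators \<subseteq> carrier l2.L" "\<And>c s. s \<in> generators \<Longrightarrow> c \<odot>\<^bsub>l2.L\<^esub> s \<in> generators"
    "\<And>s t. s \<in> generators \<Longrightarrow> t \<in> generators \<Longrightarrow> s \<otimes>\<^bsub>l2.L\<^esub> t \<in> generators"
    "\<And>s. s \<in> generators \<Longrightarrow> adj l2.L s \<in> generators"
proof -
  show "generators \<subseteq> carrier l2.L"
    by (auto simp: generators_def)
  show "c \<odot>\<^bsub>l2.L\<^esub> s \<in> generators" if "s \<in> generators" for c s
    using that by (auto simp: generators_def reg_rep_scale) (use fibre_scale_closed in blast)
  show "s \<otimes>\<^bsub>l2.L\<^esub> t \<in> generators" if "s \<in> generators" "t \<in> generators" for s t
    using that by (auto simp: generators_def reg_rep_mult) (use m_closed bmult_closed in blast)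
  show "adj l2.L s \<in> generators" if "s \<in> generators" for s
    using that by (auto simp: generators_def reg_rep_adj) (use inv_closed bstar_closed in blast)
qed

abbreviation "A0 \<equiv> cstar_generated l2.L generators"

sublocale red: operator_algebra D "l2 G B" A0
  by (intro operator_algebra.intro pre_hilbert_l2 operator_algebra_axioms.intro
      l2.cstar_subalgebra_generated generators_star_closed)

lemma reduced_algebra_eq: "reduced_algebra G B = red.A"
  by (simp add: reduced_algebra_def generators_def)

lemma reg_rep_A0 [simp]: "g \<in> carrier G \<Longrightarrow> b \<in> carrier (fibre B g) \<Longrightarrow> reg_rep G B g b \<in> A0"
  by (auto simp: cstar_generated_def generators_def)

lemma A0_app [simp]: "x \<in> A0 \<Longrightarrow> v \<in> carrier (l2 G B) \<Longrightarrow> x v \<in> carrier (l2 G B)"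
  using red.A_L by (rule l2.L_app)

lemma A0_agree:
  fixes W :: "('w, 'n) normed_module_scheme"
  assumes "normed_space W" "linear_map red.A W f" "0 \<le> K" "\<And>x. x \<in> A0 \<Longrightarrow> nrm W (f x) \<le> K * nrm l2.L x"
    "linear_map red.A W h" "0 \<le> K'" "\<And>x. x \<in> A0 \<Longrightarrow> nrm W (h x) \<le> K' * nrm l2.L x"
    "\<And>s. s \<in> generators \<Longrightarrow> f s = h s" "x \<in> A0"
  shows "f x = h x"
  by (rule l2.generated_agree[of generators W f K h K' x]) (use assms generators_star_closed in auto)

text \<open>
  The coefficient at \<open>g\<close> of a vector of \<open>l2 G B\<close>: the contractive extension of the evaluation
  \<open>\<xi> \<mapsto> \<xi> g\<close> from finitely supported sections. It is unique by density; only existence is used.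
\<close>

definition coeff :: "'a \<Rightarrow> ('a, 'b) l2_elem \<Rightarrow> 'b" where
  "coeff g = (SOME P. linear_map (l2 G B) (fibre B g) P
     \<and> (\<forall>X\<in>carrier (l2 G B). nrm (fibre B g) (P X) \<le> nrm (l2 G B) X)
     \<and> (\<forall>\<xi>\<in>carrier Sec. P (emb \<xi>) = \<xi> g))"

lemma coeff:
  assumes g: "g \<in> carrier G"
  shows linear_coeff: "linear_map (l2 G B) (fibre B g) (coeff g)"
    and nrm_coeff_le: "X \<in> carrier (l2 G B) \<Longrightarrow> nrm (fibre B g) (coeff g X) \<le> nrm (l2 G B) X"
    and coeff_emb: "\<xi> \<in> carrier Sec \<Longrightarrow> coeff g (emb \<xi>) = \<xi> g"
proof -
  have "linear_map Sec (fibre B g) (\<lambda>\<xi>. \<xi> g)"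
    using g by (auto simp: linear_map_def)
  then obtain P where "linear_map (l2 G B) (fibre B g) P"
    "\<And>X. X \<in> carrier (l2 G B) \<Longrightarrow> nrm (fibre B g) (P X) \<le> 1 * nrm (l2 G B) X"
    "\<And>\<xi>. \<xi> \<in> carrier Sec \<Longrightarrow> P (emb \<xi>) = \<xi> g"
    using Sec.extend_functional[OF banach_fibre[OF g], folded l2_def, of "\<lambda>\<xi>. \<xi> g" 1] nrm_Sec_app_le[OF _ g]
    by auto
  then have "\<exists>P. linear_map (l2 G B) (fibre B g) P
     \<and> (\<forall>X\<in>carrier (l2 G B). nrm (fibre B g) (P X) \<le> nrm (l2 G B) X)
     \<and> (\<forall>\<xi>\<in>carrier Sec. P (emb \<xi>) = \<xi> g)"
    by (intro exI[of _ P]) simp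
  from someI_ex[OF this] show "linear_map (l2 G B) (fibre B g) (coeff g)"
    "X \<in> carrier (l2 G B) \<Longrightarrow> nrm (fibre B g) (coeff g X) \<le> nrm (l2 G B) X"
    "\<xi> \<in> carrier Sec \<Longrightarrow> coeff g (emb \<xi>) = \<xi> g"
    unfolding coeff_def by auto
qed

lemma coeff_closed [simp]: "g \<in> carrier G \<Longrightarrow> X \<in> carrier (l2 G B) \<Longrightarrow> coeff g X \<in> carrier (fibre B g)"
  using linear_mapD(1)[OF linear_coeff] .

lemma linear_ip:
  assumes "g \<in> carrier G" "a \<in> carrier (fibre B g)"
  shows "linear_map (fibre B g) D (ip g a)"
  using assms by (auto simp: linear_map_def ip_add_right ip_scale_right)

lemma nrm_ip_le:
  assumes "g \<in> carrier G" "a \<in> carrier (fibre B g)" "b \<in> carrier (fibre B g)"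
  shows "nrm D (ip g a b) \<le> nrm (fibre B g) a * nrm (fibre B g) b"
  using nrm_bmult[of "inv g" g "bstar B g a" b] assms by (simp add: ip_def bstar_closed nrm_bstar)

lemma fibre_nrm_nonneg: "g \<in> carrier G \<Longrightarrow> a \<in> carrier (fibre B g) \<Longrightarrow> 0 \<le> nrm (fibre B g) a"
  by (rule normed_space.nrm_nonneg[OF normed_fibre])

lemma l2_eq_zeroI:
  assumes X: "X \<in> carrier (l2 G B)"
    and zero: "\<And>g a. g \<in> carrier G \<Longrightarrow> a \<in> carrier (fibre B g) \<Longrightarrow> inner (l2 G B) (emb (single g a)) X = \<zero>\<^bsub>D\<^esub>"
  shows "X = \<zero>\<^bsub>l2 G B\<^esub>"
proof (rule l2_eq_by_inner[OF X l2.V.M.zero_closed])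
  fix \<xi> assume "\<xi> \<in> carrier Sec"
  then have "inner (l2 G B) (emb \<xi>) X = \<zero>\<^bsub>D\<^esub>"
  proof (induction rule: section_induct)
    case zero
    then show ?case using X by (simp add: emb_zero l2.inner_zero_left del: D_simps)
  next
    case (add g a \<eta>)
    then show ?case
      using X zero D.M.l_zero[OF D.M.zero_closed] by (simp add: emb_add l2.inner_add_left)
  qed
  then show "inner (l2 G B) (emb \<xi>) X = inner (l2 G B) (emb \<xi>) \<zero>\<^bsub>l2 G B\<^esub>"
    using \<open>\<xi> \<in> carrier Sec\<close> l2.inner_zero_right[OF emb_closed] by simp
qed

text \<open>The unit section, which plays the role of the vacuum vector: \<open>\<lambda>\<^sub>g(b)\<close> maps it to the section \<open>b\<close> at \<open>g\<close>.\<close>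

definition vac :: "('a, 'b) l2_elem" where
  "vac = emb (single \<one> \<one>\<^bsub>D\<^esub>)"

lemma vac_closed [simp]: "vac \<in> carrier (l2 G B)"
  by (simp add: vac_def)

lemma reg_rep_vac:
  assumes "g \<in> carrier G" "b \<in> carrier (fibre B g)"
  shows "reg_rep G B g b vac = emb (single g b)"
  using assms by (simp add: vac_def reg_rep_emb shift_single one_D_fibre_right)

lemma nrm_vac: "nrm (l2 G B) vac \<le> 1"
  using D.nrm_one_le by (simp add: vac_def nrm_emb nrm_single)

lemma A0_bound: "x \<in> A0 \<Longrightarrow> v \<in> carrier (l2 G B) \<Longrightarrow> nrm (l2 G B) (x v) \<le> nrm l2.L x * nrm (l2 G B) v"
  using red.A_L by (rule l2.L_bound)

lemma linear_A0_app: "v \<in> carrier (l2 G B) \<Longrightarrow> linear_map red.A (l2 G B) (\<lambda>x. x v)"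
  by (auto simp: linear_map_def)

lemma nrm_A0_vac_le: "x \<in> A0 \<Longrightarrow> nrm (l2 G B) (x vac) \<le> nrm l2.L x"
  using A0_bound[of x vac] mult_left_mono[OF nrm_vac l2.nrm_L_nonneg[OF red.A_L], of x] by simp

text \<open>
  The matrix coefficients of \<open>x\<close> are determined by the coefficients of \<open>x\<close> applied to the unit
  section; it suffices to check the generators.
\<close>

lemma matrix_coeff:
  assumes g: "g \<in> carrier G" and a: "a \<in> carrier (fibre B g)" and h: "h \<in> carrier G"
    and c: "c \<in> carrier (fibre B h)" and x: "x \<in> A0"
  shows "inner (l2 G B) (emb (single g a)) (x (emb (single h c)))
    = ip g a (bmult B (g \<otimes> inv h) h (coeff (g \<otimes> inv h) (x vac)) c)"
proof (rule A0_agree[OF D.normed_space_axioms _ _ _ _ _ _ _ x,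
      where K = "nrm (l2 G B) (emb (single g a)) * nrm (l2 G B) (emb (single h c))"
        and K' = "nrm (fibre B g) a * nrm (fibre B h) c"])
  let ?k = "g \<otimes> inv h"
  have k: "?k \<in> carrier G" "?k \<otimes> h = g"
    using g h by (auto simp: m_assoc)
  have ga: "emb (single g a) \<in> carrier (l2 G B)" and hc: "emb (single h c) \<in> carrier (l2 G B)"
    using g a h c by auto
  show "linear_map red.A D (\<lambda>x. inner (l2 G B) (emb (single g a)) (x (emb (single h c))))"
    by (rule linear_map_comp[OF linear_A0_app[OF hc] l2.linear_inner[OF ga]])
  show "linear_map red.A D (\<lambda>x. ip g a (bmult B ?k h (coeff ?k (x vac)) c))"
    using linear_map_comp[OF linear_map_comp[OF linear_map_comp[OF linear_A0_app[OF vac_closed]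
        linear_coeff[OF k(1)]] bmult_linear_left[OF k(1) h c], unfolded k(2)] linear_ip[OF g a]] .
  show "0 \<le> nrm (l2 G B) (emb (single g a)) * nrm (l2 G B) (emb (single h c))"
    using ga hc by (simp add: l2.V.nrm_nonneg)
  show "0 \<le> nrm (fibre B g) a * nrm (fibre B h) c"
    using g a h c by (simp add: fibre_nrm_nonneg)
  show "nrm D (inner (l2 G B) (emb (single g a)) (y (emb (single h c))))
      \<le> nrm (l2 G B) (emb (single g a)) * nrm (l2 G B) (emb (single h c)) * nrm l2.L y" if y: "y \<in> A0" for y
    using l2.cauchy_schwarz[OF ga A0_app[OF y hc]]
      mult_left_mono[OF A0_bound[OF y hc] l2.V.nrm_nonneg[OF ga]] by (simp add: mult_ac)
  show "nrm D (ip g a (bmult B ?k h (coeff ?k (y vac)) c))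
      \<le> nrm (fibre B g) a * nrm (fibre B h) c * nrm l2.L y" if y: "y \<in> A0" for y
  proof -
    let ?w = "coeff ?k (y vac)"
    have w: "?w \<in> carrier (fibre B ?k)" using k y by simp
    have wc: "bmult B ?k h ?w c \<in> carrier (fibre B g)"
      using bmult_closed[OF k(1) h w c] by (simp add: k(2))
    have "nrm (fibre B g) (bmult B ?k h ?w c) \<le> nrm (fibre B ?k) ?w * nrm (fibre B h) c"
      using nrm_bmult[OF k(1) h w c] by (simp add: k(2))
    also have "\<dots> \<le> nrm l2.L y * nrm (fibre B h) c"
      using order_trans[OF nrm_coeff_le[OF k(1) A0_app[OF y vac_closed]] nrm_A0_vac_le[OF y]] h c
      by (intro mult_right_mono fibre_nrm_nonneg)
    finally show ?thesis
      using nrm_ip_le[OF g a wc] mult_left_mono[OF _ fibre_nrm_nonneg[OF g a]]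
      by (fastforce simp: mult_ac)
  qed
  fix s assume "s \<in> generators"
  then obtain l d where l: "l \<in> carrier G" and d: "d \<in> carrier (fibre B l)" and s: "s = reg_rep G B l d"
    by (auto simp: generators_def)
  have dc: "bmult B l h d c \<in> carrier (fibre B (l \<otimes> h))"
    by (rule bmult_closed[OF l h d c])
  have iff: "g = l \<otimes> h \<longleftrightarrow> ?k = l"
    using g h l by (metis inv_closed inv_solve_right m_assoc)
  have "inner (l2 G B) (emb (single g a)) (s (emb (single h c))) = ip g a (single (l \<otimes> h) (bmult B l h d c) g)"
    using g a h c l d dc by (simp add: s reg_rep_emb inner_emb inner_single shift_single)
  also have "\<dots> = ip g a (bmult B ?k h (single l d ?k) c)"
  proof (cases "?k = l")
    case True
    then show ?thesis using g k iff by (simp add: single_def)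
  next
    case False
    then show ?thesis
      using g k iff h c bmult_zero_left[OF k(1) h c] by (simp add: single_def)
  qed
  also have "single l d ?k = coeff ?k (s vac)"
    using k l d by (simp add: s reg_rep_vac coeff_emb)
  finally show "inner (l2 G B) (emb (single g a)) (s (emb (single h c)))
      = ip g a (bmult B ?k h (coeff ?k (s vac)) c)" .
qed

text \<open>
  If \<open>x\<close> annihilates the unit section, then all matrix coefficients of \<open>x\<close> vanish.
\<close>

lemma vac_separating:
  assumes x: "x \<in> A0" and zero: "x vac = \<zero>\<^bsub>l2 G B\<^esub>"
  shows "x = \<zero>\<^bsub>l2.L\<^esub>"
proof (rule l2_op_eqI[OF red.A_L[OF x] l2.zero_L])
  have coeff_zero: "coeff k \<zero>\<^bsub>l2 G B\<^esub> = \<zero>\<^bsub>fibre B k\<^esub>" if "k \<in> carrier G" for k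
    using coeff_emb[OF that Sec_zero] that by (simp add: emb_zero)
  have single: "x (emb (single h c)) = \<zero>\<^bsub>l2 G B\<^esub>" if h: "h \<in> carrier G" "c \<in> carrier (fibre B h)" for h c
  proof (rule l2_eq_zeroI)
    fix g a assume g: "g \<in> carrier G" "a \<in> carrier (fibre B g)"
    have "bmult B (g \<otimes> inv h) h \<zero>\<^bsub>fibre B (g \<otimes> inv h)\<^esub> c = \<zero>\<^bsub>fibre B g\<^esub>"
      using bmult_zero_left[of "g \<otimes> inv h" h c] g h by (simp add: m_assoc)
    then show "inner (l2 G B) (emb (single g a)) (x (emb (single h c))) = \<zero>\<^bsub>D\<^esub>"
      using matrix_coeff[OF g h x] g h by (simp add: zero coeff_zero)
  qed (use x h in simp)
  fix \<xi> assume \<xi>: "\<xi> \<in> carrier Sec"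
  then have "x (emb \<xi>) = \<zero>\<^bsub>l2 G B\<^esub>"
  proof (induction rule: section_induct)
    case zero
    then show ?case using l2.L_zero[OF red.A_L[OF x]] by (simp add: emb_zero)
  next
    case (add g a \<eta>)
    then show ?case
      using l2.L_add[OF red.A_L[OF x]] single by (simp add: emb_add)
  qed
  then show "x (emb \<xi>) = \<zero>\<^bsub>l2.L\<^esub> (emb \<xi>)"
    using \<xi> by simp
qed

text \<open>
  The vector state of the unit section, with values in the unit fibre; it turns out to be the
  conditional expectation. It is restricted to the reduced algebra because \<open>cond_exp\<close> is
  extensional.
\<close>

definition expect :: "('a, 'b) l2_op \<Rightarrow> 'b" where
  "expect = (\<lambda>x\<in>A0. inner (l2 G B) vac (x vac))"

lemma red_A_simps [simp]:
  "carrier red.A = A0" "mult red.A = mult l2.L" "add red.A = add l2.L" "zero red.A = zero l2.L"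
  "smult red.A = smult l2.L" "nrm red.A = nrm l2.L" "adj red.A = adj l2.L"
  by simp_all

lemma expect_adj_mult:
  "x \<in> A0 \<Longrightarrow> y \<in> A0 \<Longrightarrow> expect (adj l2.L x \<otimes>\<^bsub>l2.L\<^esub> y) = inner (l2 G B) (x vac) (y vac)"
  by (simp add: expect_def red.A_mult red.A_adj l2.inner_adj_right red.A_L)

lemma linear_expect: "linear_map red.A D expect"
proof -
  have "linear_map red.A D (\<lambda>x. inner (l2 G B) vac (x vac))"
    by (rule linear_map_comp[OF linear_A0_app[OF vac_closed] l2.linear_inner[OF vac_closed]])
  then show ?thesis
    by (auto simp: linear_map_def expect_def red.A_add red.A_scale simp del: l2.add_L_app l2.scale_L_app)
qed

lemma nrm_expect_le: "x \<in> A0 \<Longrightarrow> nrm D (expect x) \<le> nrm l2.L x"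
  using l2.cauchy_schwarz[OF vac_closed A0_app[OF _ vac_closed], of x] nrm_vac nrm_A0_vac_le[of x]
    mult_mono[OF nrm_vac nrm_A0_vac_le[of x]] l2.V.nrm_nonneg[of "x vac"] by (simp add: expect_def)

lemma expect_reg_rep:
  assumes "g \<in> carrier G" "b \<in> carrier (fibre B g)"
  shows "expect (reg_rep G B g b) = (if g = \<one> then b else \<zero>\<^bsub>D\<^esub>)"
proof -
  have "expect (reg_rep G B g b) = ip \<one> \<one>\<^bsub>D\<^esub> (single g b \<one>)"
    using assms by (simp add: expect_def reg_rep_vac) (simp add: vac_def inner_emb inner_single)
  also have "\<dots> = (if g = \<one> then b else \<zero>\<^bsub>D\<^esub>)"
    using assms D.adj_one one_D_left by (auto simp: single_def) (simp add: ip_def)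
  finally show ?thesis .
qed

lemma reg_rep_one_vac:
  assumes "b \<in> carrier D"
  shows "reg_rep G B \<one> b vac = ract (l2 G B) vac b"
proof -
  have "single \<one> b = ract Sec (single \<one> \<one>\<^bsub>D\<^esub>) b"
  proof (rule Sec_eqI)
    fix g assume "g \<in> carrier G"
    then show "single \<one> b g = ract Sec (single \<one> \<one>\<^bsub>D\<^esub>) b g"
      using assms bmult_zero_left[of g \<one> b] one_D_left by (auto simp: single_def)
  qed (use assms Sec_ract in auto)
  then have "emb (single \<one> b) = ract (l2 G B) vac b"
    using assms by (simp add: emb_ract vac_def)
  then show ?thesis
    using assms by (simp add: reg_rep_vac)
qed

lemma faithful_expect: "faithful_cond_exp G B expect"
  unfolding faithful_cond_exp_def Let_def reduced_algebra_eq
proof (intro conjI ballI impI)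
  show "linear_map red.A D expect" by (rule linear_expect)
  show "nrm D (expect x) \<le> nrm red.A x" if "x \<in> carrier red.A" for x
    using nrm_expect_le that by simp
  show "expect (reg_rep G B \<one> b) = b" if "b \<in> carrier D" for b
    using expect_reg_rep[of \<one> b] that by simp
  have sq: "\<exists>c\<in>A0. x = adj l2.L c \<otimes>\<^bsub>l2.L\<^esub> c" if "positive red.A x" for x
    using that by (simp add: positive_def)
  show "positive D (expect x)" if "positive red.A x" for x
  proof -
    obtain c where "c \<in> A0" "x = adj l2.L c \<otimes>\<^bsub>l2.L\<^esub> c"
      using sq[OF \<open>positive red.A x\<close>] by blast
    then show ?thesis
      using l2.pos_inner[of "c vac"] by (simp add: D.positive_iff_pos expect_adj_mult)
  qed
  show "x = \<zero>\<^bsub>red.A\<^esub>" if x: "positive red.A x \<and> expect x = \<zero>\<^bsub>D\<^esub>" for x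
  proof -
    obtain c where c: "c \<in> A0" "x = adj l2.L c \<otimes>\<^bsub>l2.L\<^esub> c"
      using x sq by blast
    have "c vac = \<zero>\<^bsub>l2 G B\<^esub>"
      using x c l2.inner_definite[OF A0_app[OF c(1) vac_closed]] by (simp add: expect_adj_mult)
    then have "c = \<zero>\<^bsub>l2.L\<^esub>"
      by (rule vac_separating[OF c(1)])
    moreover have "adj l2.L \<zero>\<^bsub>l2.L\<^esub> \<otimes>\<^bsub>l2.L\<^esub> \<zero>\<^bsub>l2.L\<^esub> = \<zero>\<^bsub>l2.L\<^esub>"
      by (rule l2.L_eqI) (auto simp: l2.adj_zero_L l2.zero_L l2.mult_L)
    ultimately show ?thesis
      by (simp add: c(2))
  qed
  fix a b x assume a: "a \<in> carrier D" and b: "b \<in> carrier D" and x: "x \<in> carrier red.A"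
  have xA: "x \<in> A0" using x by simp
  have ab: "reg_rep G B \<one> a \<in> A0" "reg_rep G B \<one> b \<in> A0" "a \<in> carrier (fibre B \<one>)"
    "b \<in> carrier (fibre B \<one>)"
    using a b by auto
  have m: "reg_rep G B \<one> a \<otimes>\<^bsub>l2.L\<^esub> x \<otimes>\<^bsub>l2.L\<^esub> reg_rep G B \<one> b \<in> A0"
    by (intro red.A_mult ab xA)
  have "expect (reg_rep G B \<one> a \<otimes>\<^bsub>l2.L\<^esub> x \<otimes>\<^bsub>l2.L\<^esub> reg_rep G B \<one> b)
      = inner (l2 G B) vac (reg_rep G B \<one> a (x (ract (l2 G B) vac b)))"
    using m ab xA by (simp add: expect_def reg_rep_one_vac)
  also have "x (ract (l2 G B) vac b) = ract (l2 G B) (x vac) b"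
    using l2.L_ract[OF red.A_L[OF xA] vac_closed b] .
  also have "inner (l2 G B) vac (reg_rep G B \<one> a (ract (l2 G B) (x vac) b))
      = inner (l2 G B) (adj l2.L (reg_rep G B \<one> a) vac) (ract (l2 G B) (x vac) b)"
    using l2.inner_adj_left[OF red.A_L[OF ab(1)] vac_closed l2.ract_closed[OF A0_app[OF xA vac_closed] b]]
    by simp
  also have "adj l2.L (reg_rep G B \<one> a) vac = ract (l2 G B) vac (adj D a)"
    using reg_rep_adj[OF one_closed ab(3)] D.adj_closed[OF a] reg_rep_one_vac[of "adj D a"] by simp
  also have "inner (l2 G B) (ract (l2 G B) vac (adj D a)) (ract (l2 G B) (x vac) b)
      = a \<otimes>\<^bsub>D\<^esub> (inner (l2 G B) vac (x vac) \<otimes>\<^bsub>D\<^esub> b)"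
    using l2.inner_ract_left[OF l2.ract_closed[OF A0_app[OF xA vac_closed] b] vac_closed D.adj_closed[OF a]]
      l2.inner_ract_right[OF vac_closed A0_app[OF xA vac_closed] b] D.adj_adj[OF a]
    by simp
  also have "\<dots> = a \<otimes>\<^bsub>D\<^esub> expect x \<otimes>\<^bsub>D\<^esub> b"
    using D.m_assoc[OF a l2.inner_closed[OF vac_closed A0_app[OF xA vac_closed]] b] xA
    by (simp add: expect_def)
  finally show "expect (reg_rep G B \<one> a \<otimes>\<^bsub>red.A\<^esub> x \<otimes>\<^bsub>red.A\<^esub> reg_rep G B \<one> b) = a \<otimes>\<^bsub>D\<^esub> expect x \<otimes>\<^bsub>D\<^esub> b"
    by simp
qed

text \<open>
  Uniqueness of the conditional expectation holds because its values on the generators are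
  prescribed and it is contractive.
\<close>

lemma cond_exp_eq: "cond_exp G B = expect"
  unfolding cond_exp_def
proof (rule the_equality)
  show "expect \<in> extensional (carrier (reduced_algebra G B)) \<and> faithful_cond_exp G B expect \<and>
    (\<forall>g\<in>carrier G. \<forall>b\<in>carrier (fibre B g). expect (reg_rep G B g b) = (if g = \<one> then b else \<zero>\<^bsub>fibre B \<one>\<^esub>))"
    using faithful_expect expect_reg_rep by (simp add: reduced_algebra_eq expect_def)
next
  fix E assume E: "E \<in> extensional (carrier (reduced_algebra G B)) \<and> faithful_cond_exp G B E \<and>
    (\<forall>g\<in>carrier G. \<forall>b\<in>carrier (fibre B g). E (reg_rep G B g b) = (if g = \<one> then b else \<zero>\<^bsub>fibre B \<one>\<^esub>))"
  then have lin: "linear_map red.A D E" and bd: "\<And>x. x \<in> A0 \<Longrightarrow> nrm D (E x) \<le> nrm l2.L x"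
    by (simp_all add: faithful_cond_exp_def Let_def reduced_algebra_eq)
  have "E x = expect x" if x: "x \<in> A0" for x
  proof (rule A0_agree[OF D.normed_space_axioms lin _ _ linear_expect _ _ _ x, of 1 1])
    fix s assume "s \<in> generators"
    then show "E s = expect s"
      using E expect_reg_rep by (auto simp: generators_def)
  qed (use bd nrm_expect_le in auto)
  then show "E = expect"
    using E by (intro extensionalityI[of _ A0]) (auto simp: reduced_algebra_eq expect_def)
qed

lemma exp_module_simps [simp]:
  "carrier (exp_module G B) = A0" "zero (exp_module G B) = zero l2.L" "add (exp_module G B) = add l2.L"
  "smult (exp_module G B) = smult l2.L"
  "ract (exp_module G B) x b = x \<otimes>\<^bsub>l2.L\<^esub> reg_rep G B \<one> b"
  "inner (exp_module G B) x y = expect (adj l2.L x \<otimes>\<^bsub>l2.L\<^esub> y)"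
  "nrm (exp_module G B) x = sqrt (nrm (fibre B \<one>) (expect (adj l2.L x \<otimes>\<^bsub>l2.L\<^esub> x)))"
  by (simp_all add: exp_module_def Let_def reduced_algebra_eq cond_exp_eq)

lemma nrm_exp_module: "x \<in> A0 \<Longrightarrow> nrm (exp_module G B) x = nrm (l2 G B) (x vac)"
  using l2.nrm_inner[of "x vac"] by (simp add: expect_adj_mult)

lemma pre_hilbert_exp: "pre_hilbert D (exp_module G B)"
proof (intro pre_hilbert.intro unital_cstar_D pre_hilbert_axioms.intro)
  show "module complex_ring (exp_module G B)"
  proof (rule moduleI[OF cring_complex_ring])
    show "abelian_group (exp_module G B)"
    proof (rule abelian_groupI)
      show "\<exists>y\<in>carrier (exp_module G B). y \<oplus>\<^bsub>exp_module G B\<^esub> x = \<zero>\<^bsub>exp_module G B\<^esub>"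
        if "x \<in> carrier (exp_module G B)" for x
        using that red.A.M.l_neg[of x] red.A.M.a_inv_closed[of x] by auto
    qed (use red.A.M.a_assoc red.A.M.a_comm red.A.M.l_zero red.A_add red.A_zero in auto)
  qed (use red.A_scale red.A.scale_add_left red.A.scale_add_right red.A.scale_scale red.A.scale_one in auto)
  fix x y assume x: "x \<in> carrier (exp_module G B)" and y: "y \<in> carrier (exp_module G B)"
  then have xy: "x \<in> A0" "y \<in> A0" by auto
  note [simp] = expect_adj_mult red.A_add red.A_scale red.A_mult
  show "ract (exp_module G B) x a \<in> carrier (exp_module G B)" if "a \<in> carrier D" for a
    using xy that by simp
  show "inner (exp_module G B) x y \<in> carrier D"
    using xy l2.inner_closed by simp
  show "inner (exp_module G B) x (c \<odot>\<^bsub>exp_module G B\<^esub> y) = c \<odot>\<^bsub>D\<^esub> inner (exp_module G B) x y" for c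
    using xy l2.inner_scale_right[of "x vac" "y vac" c] by simp
  show "inner (exp_module G B) x (ract (exp_module G B) y a) = inner (exp_module G B) x y \<otimes>\<^bsub>D\<^esub> a"
    if a: "a \<in> carrier D" for a
    using xy a l2.inner_ract_right[of "x vac" "y vac" a] l2.L_ract[OF red.A_L[OF xy(2)] vac_closed a]
    by (simp add: reg_rep_one_vac)
  show "adj D (inner (exp_module G B) x y) = inner (exp_module G B) y x"
    using xy l2.adj_inner[of "x vac" "y vac"] by simp
  show "D.pos (inner (exp_module G B) x x)"
    using xy l2.pos_inner[of "x vac"] by simp
  show "x = \<zero>\<^bsub>exp_module G B\<^esub>" if "inner (exp_module G B) x x = \<zero>\<^bsub>D\<^esub>"
    using xy that l2.inner_definite[of "x vac"] vac_separating[of x] by simp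
  show "nrm (exp_module G B) x = sqrt (nrm D (inner (exp_module G B) x x))"
    by simp
  fix z assume "z \<in> carrier (exp_module G B)"
  then show "inner (exp_module G B) x (y \<oplus>\<^bsub>exp_module G B\<^esub> z)
      = inner (exp_module G B) x y \<oplus>\<^bsub>D\<^esub> inner (exp_module G B) x z"
    using xy l2.inner_add_right[of "x vac" "y vac" "z vac"] by simp
qed

end

section \<open>From the module Haagerup property to the PD-approximation property\<close>

context unital_fell_bundle
begin

sublocale Exp: pre_hilbert D "exp_module G B" by (rule pre_hilbert_exp)

lemma pre_hilbert_H: "pre_hilbert D (H_module G B)"
  unfolding H_module_def by (rule Exp.pre_hilbert_completion)

sublocale H: pre_hilbert D "H_module G B" by (rule pre_hilbert_H)

text \<open>
  The embedding of the reduced algebra into its Hilbert module completion.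
\<close>

abbreviation "hemb \<equiv> embed (exp_module G B)"

lemma hemb_closed [simp]: "x \<in> A0 \<Longrightarrow> hemb x \<in> carrier (H_module G B)"
  unfolding H_module_def by (rule Exp.embed_closed) simp

lemma nrm_hemb: "x \<in> A0 \<Longrightarrow> nrm (H_module G B) (hemb x) = nrm (l2 G B) (x vac)"
  unfolding H_module_def using Exp.nrm_embed[of x] nrm_exp_module[of x] by simp

lemma inner_hemb:
  "x \<in> A0 \<Longrightarrow> y \<in> A0 \<Longrightarrow> inner (H_module G B) (hemb x) (hemb y) = inner (l2 G B) (x vac) (y vac)"
  unfolding H_module_def using Exp.inner_embed[of x y] by (simp add: expect_adj_mult)

lemma hemb_diff:
  assumes "x \<in> A0" "y \<in> A0"
  shows "hemb x \<ominus>\<^bsub>H_module G B\<^esub> hemb y = hemb (x \<ominus>\<^bsub>red.A\<^esub> y)"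
proof -
  have "x \<ominus>\<^bsub>exp_module G B\<^esub> y = x \<ominus>\<^bsub>red.A\<^esub> y"
    using assms by (simp add: a_minus_def Exp.V.neg_eq_scale red.A.neg_eq_scale)
  then show ?thesis
    using Exp.embed_diff[of x y] assms by (simp add: H_module_def)
qed

lemma nrm_hemb_reg_rep:
  "g \<in> carrier G \<Longrightarrow> b \<in> carrier (fibre B g) \<Longrightarrow> nrm (H_module G B) (hemb (reg_rep G B g b)) = nrm (fibre B g) b"
  by (simp add: nrm_hemb reg_rep_vac nrm_emb nrm_single)

text \<open>
  The bundle map which sends \<open>b \<in> B\<^sub>g\<close> to the coefficient at \<open>g\<close> of \<open>\<Phi>(\<lambda>\<^sub>g(b))\<close> applied to the unit
  section.
\<close>

definition multiplier :: "(('a, 'b) l2_op \<Rightarrow> ('a, 'b) l2_op) \<Rightarrow> 'a \<Rightarrow> 'b \<Rightarrow> 'b" where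
  "multiplier \<Phi> g b = coeff g (\<Phi> (reg_rep G B g b) vac)"

context
  fixes \<Phi> \<Phi>'
  assumes \<Phi>: "linear_map red.A red.A \<Phi>" and ind: "induces G B \<Phi> \<Phi>'"
begin

lemma \<Phi>_closed: "x \<in> A0 \<Longrightarrow> \<Phi> x \<in> A0"
  using linear_mapD(1)[OF \<Phi>] by simp

lemma \<Phi>'_hemb: "x \<in> A0 \<Longrightarrow> \<Phi>' (hemb x) = hemb (\<Phi> x)"
  using ind by (simp add: induces_def reduced_algebra_eq)

lemma bounded_\<Phi>': "bounded_map (H_module G B) (H_module G B) \<Phi>'"
  using ind by (simp add: induces_def)

lemma linear_multiplier:
  assumes g: "g \<in> carrier G"
  shows "linear_map (fibre B g) (fibre B g) (multiplier \<Phi> g)"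
proof -
  have "linear_map (fibre B g) red.A (reg_rep G B g)"
    using g by (auto simp: linear_map_def reg_rep_add reg_rep_scale)
  then show ?thesis
    unfolding multiplier_def
    using linear_map_comp[OF linear_map_comp[OF linear_map_comp[OF _ \<Phi>] linear_A0_app[OF vac_closed]]
        linear_coeff[OF g]] by blast
qed

lemma nrm_multiplier_le_hemb:
  assumes g: "g \<in> carrier G" and b: "b \<in> carrier (fibre B g)"
  shows "nrm (fibre B g) (multiplier \<Phi> g b) \<le> nrm (H_module G B) (\<Phi>' (hemb (reg_rep G B g b)))"
  using nrm_coeff_le[OF g, of "\<Phi> (reg_rep G B g b) vac"] g b
  by (simp add: multiplier_def \<Phi>'_hemb nrm_hemb \<Phi>_closed)

lemma nrm_multiplier_le:
  assumes g: "g \<in> carrier G" and b: "b \<in> carrier (fibre B g)"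
  shows "nrm (fibre B g) (multiplier \<Phi> g b) \<le> op_norm (H_module G B) (H_module G B) \<Phi>' * nrm (fibre B g) b"
  using nrm_multiplier_le_hemb[OF g b]
    op_norm_bound[OF H.V.normed_space_axioms H.V.normed_space_axioms bounded_\<Phi>', of "hemb (reg_rep G B g b)"]
    g b by (simp add: nrm_hemb_reg_rep)

lemma bounded_multiplier:
  "g \<in> carrier G \<Longrightarrow> bounded_map (fibre B g) (fibre B g) (multiplier \<Phi> g)"
  unfolding bounded_map_def using linear_multiplier nrm_multiplier_le by blast

lemma op_norm_multiplier_le:
  assumes g: "g \<in> carrier G"
  shows "op_norm (fibre B g) (fibre B g) (multiplier \<Phi> g) \<le> op_norm (H_module G B) (H_module G B) \<Phi>'"
proof (rule op_norm_least[OF normed_fibre[OF g]])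
  fix b assume b: "b \<in> carrier (fibre B g)" "nrm (fibre B g) b \<le> 1"
  then show "nrm (fibre B g) (multiplier \<Phi> g b) \<le> op_norm (H_module G B) (H_module G B) \<Phi>'"
    using nrm_multiplier_le[OF g b(1)] mult_left_mono[OF b(2)
        op_norm_nonneg[OF H.V.normed_space_axioms H.V.normed_space_axioms bounded_\<Phi>']] by simp
qed

lemma nrm_multiplier_diff_le:
  assumes g: "g \<in> carrier G" and b: "b \<in> carrier (fibre B g)"
  shows "nrm (fibre B g) (multiplier \<Phi> g b \<ominus>\<^bsub>fibre B g\<^esub> b)
    \<le> nrm (H_module G B) (\<Phi>' (hemb (reg_rep G B g b)) \<ominus>\<^bsub>H_module G B\<^esub> hemb (reg_rep G B g b))"
proof -
  let ?x = "reg_rep G B g b"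
  have x: "?x \<in> A0" "\<Phi> ?x \<in> A0" using g b \<Phi>_closed by auto
  have "coeff g (?x vac) = b"
    using g b by (simp add: reg_rep_vac coeff_emb) (simp add: single_def)
  then have "multiplier \<Phi> g b \<ominus>\<^bsub>fibre B g\<^esub> b = coeff g (\<Phi> ?x vac) \<ominus>\<^bsub>fibre B g\<^esub> coeff g (?x vac)"
    by (simp add: multiplier_def)
  also have "\<dots> = coeff g ((\<Phi> ?x \<ominus>\<^bsub>red.A\<^esub> ?x) vac)"
    using x linear_map_diff[OF l2.V.normed_space_axioms normed_fibre[OF g] linear_coeff[OF g],
        of "\<Phi> ?x vac" "?x vac"] by (simp add: red.A_diff_app)
  finally have eq: "multiplier \<Phi> g b \<ominus>\<^bsub>fibre B g\<^esub> b = coeff g ((\<Phi> ?x \<ominus>\<^bsub>red.A\<^esub> ?x) vac)" .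
  have d: "\<Phi> ?x \<ominus>\<^bsub>red.A\<^esub> ?x \<in> A0"
    using red.A.M.minus_closed[of "\<Phi> ?x" ?x] x by simp
  show ?thesis
    unfolding eq using nrm_coeff_le[OF g A0_app[OF d vac_closed]] x d
    by (simp add: \<Phi>'_hemb hemb_diff nrm_hemb)
qed

text \<open>
  Writing \<open>\<eta>\<^sub>i\<close> for the section with value \<open>b\<^sub>i\<^sup>*\<close> at \<open>g\<^sub>i\<^sup>-\<^sup>1\<close>, the sum in the definition of positive
  definiteness is \<open>\<Sum> \<langle>\<eta>\<^sub>i, \<Phi>(\<lambda>(a\<^sub>i)\<^sup>* \<lambda>(a\<^sub>j)) \<eta>\<^sub>j\<rangle>\<close>.
\<close>

lemma positive_definite_multiplier:
  assumes cp: "completely_positive red.A \<Phi>"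
  shows "positive_definite G B (multiplier \<Phi>)"
  unfolding positive_definite_def Let_def
proof (intro allI impI)
  fix n :: nat and g a b
  assume "\<forall>i<n. g i \<in> carrier G \<and> a i \<in> carrier (fibre B (g i)) \<and> b i \<in> carrier (fibre B (g i))"
  then have g: "\<And>i. i < n \<Longrightarrow> g i \<in> carrier G" and a: "\<And>i. i < n \<Longrightarrow> a i \<in> carrier (fibre B (g i))"
    and b: "\<And>i. i < n \<Longrightarrow> b i \<in> carrier (fibre B (g i))" by auto
  define m where "m i j = adj l2.L (reg_rep G B (g i) (a i)) \<otimes>\<^bsub>l2.L\<^esub> reg_rep G B (g j) (a j)" for i j
  define k where "k i j = inv (g i) \<otimes> g j" for i j
  define aa where "aa i j = bmult B (inv (g i)) (g j) (bstar B (g i) (a i)) (a j)" for i j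
  define \<eta> where "\<eta> i = emb (single (inv (g i)) (bstar B (g i) (b i)))" for i
  have k: "k i j \<in> carrier G" and aa: "aa i j \<in> carrier (fibre B (k i j))"
    and m_eq: "m i j = reg_rep G B (k i j) (aa i j)" if "i < n" "j < n" for i j
    using that g a bstar_closed bmult_closed[of "inv (g i)" "g j" "bstar B (g i) (a i)" "a j"]
    by (auto simp: k_def aa_def m_def reg_rep_adj reg_rep_mult)
  have \<eta>: "\<eta> i \<in> carrier (l2 G B)" if "i < n" for i
    using that g b bstar_closed by (simp add: \<eta>_def)
  have "positive_matrix red.A n m"
  proof -
    \<comment> \<open>The first row of \<open>c\<close> is \<open>\<lambda>(a\<^sub>0), \<dots>, \<lambda>(a\<^sub>n\<^sub>-\<^sub>1)\<close>, so that \<open>c\<^sup>* c = m\<close>; the other rows vanish.\<close>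
    define c where "c p i = (if p = 0 then reg_rep G B (g i) (a i) else \<zero>\<^bsub>l2.L\<^esub>)" for p i :: nat
    have c: "c p i \<in> A0" if "i < n" for p i
      using that g a red.A_zero by (simp add: c_def)
    have "m i j = (\<Oplus>\<^bsub>red.A\<^esub>p\<in>{..<n}. adj red.A (c p i) \<otimes>\<^bsub>red.A\<^esub> c p j)" if ij: "i < n" "j < n" for i j
    proof -
      have mA: "m i j \<in> A0" using ij m_eq k aa by simp
      have zz: "adj l2.L \<zero>\<^bsub>l2.L\<^esub> \<otimes>\<^bsub>l2.L\<^esub> \<zero>\<^bsub>l2.L\<^esub> = \<zero>\<^bsub>l2.L\<^esub>"
        by (rule l2.L_eqI) (auto simp: l2.adj_zero_L l2.zero_L l2.mult_L)
      have "(\<Oplus>\<^bsub>red.A\<^esub>p\<in>{..<n}. adj red.A (c p i) \<otimes>\<^bsub>red.A\<^esub> c p j)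
          = (\<Oplus>\<^bsub>red.A\<^esub>p\<in>{..<n}. if 0 = p then m i j else \<zero>\<^bsub>red.A\<^esub>)"
        using mA red.A_zero zz by (intro red.A.M.finsum_cong') (auto simp: c_def m_def)
      also have "\<dots> = m i j"
        using ij mA red.A.M.finsum_singleton[of 0 "{..<n}" "\<lambda>p. m i j"] by auto
      finally show ?thesis by simp
    qed
    then show ?thesis
      unfolding positive_matrix_def using c by (intro exI[of _ c]) simp
  qed
  then have "positive_matrix red.A n (\<lambda>i j. \<Phi> (m i j))"
    using cp by (simp add: completely_positive_def)
  then have pos: "D.pos (\<Oplus>\<^bsub>D\<^esub>i\<in>{..<n}. \<Oplus>\<^bsub>D\<^esub>j\<in>{..<n}. inner (l2 G B) (\<eta> i) (\<Phi> (m i j) (\<eta> j)))"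
    using \<eta> by (rule red.positive_matrix_form)
  have entry: "inner (l2 G B) (\<eta> i) (\<Phi> (m i j) (\<eta> j))
      = bmult B (g j) (inv (g j)) (bmult B (g i) (k i j) (b i) (multiplier \<Phi> (k i j) (aa i j))) (bstar B (g j) (b j))"
    if ij: "i < n" "j < n" for i j
  proof -
    note gi = g[OF ij(1)] and gj = g[OF ij(2)] and bi = b[OF ij(1)] and bj = b[OF ij(2)]
    have x: "\<Phi> (m i j) \<in> A0" using ij k aa by (simp add: m_eq \<Phi>_closed)
    have kj: "inv (g i) \<otimes> inv (inv (g j)) = k i j" "k i j \<otimes> inv (g j) = inv (g i)" "g i \<otimes> k i j = g j"
      using gi gj by (simp_all add: k_def m_assoc mult_inv_cancel)
    have t: "multiplier \<Phi> (k i j) (aa i j) \<in> carrier (fibre B (k i j))"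
      using linear_mapD(1)[OF linear_multiplier[OF k[OF ij]] aa[OF ij]] .
    have "inner (l2 G B) (\<eta> i) (\<Phi> (m i j) (\<eta> j))
        = ip (inv (g i)) (bstar B (g i) (b i))
           (bmult B (k i j) (inv (g j)) (multiplier \<Phi> (k i j) (aa i j)) (bstar B (g j) (b j)))"
      using matrix_coeff[OF inv_closed[OF gi] bstar_closed[OF gi bi] inv_closed[OF gj] bstar_closed[OF gj bj] x]
      by (simp only: \<eta>_def kj(1) multiplier_def m_eq[OF ij])
    also have "\<dots> = bmult B (g i) (k i j \<otimes> inv (g j)) (b i)
           (bmult B (k i j) (inv (g j)) (multiplier \<Phi> (k i j) (aa i j)) (bstar B (g j) (b j)))"
      using gi bi by (simp add: ip_def bstar_bstar kj(2))
    also have "\<dots> = bmult B (g i \<otimes> k i j) (inv (g j)) (bmult B (g i) (k i j) (b i) (multiplier \<Phi> (k i j) (aa i j)))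
        (bstar B (g j) (b j))"
      by (rule bmult_assoc[symmetric]) (use gi gj bi bj t k[OF ij] bstar_closed in auto)
    finally show ?thesis by (simp only: kj(3))
  qed
  have "(\<Oplus>\<^bsub>D\<^esub>i\<in>{..<n}. \<Oplus>\<^bsub>D\<^esub>j\<in>{..<n}. inner (l2 G B) (\<eta> i) (\<Phi> (m i j) (\<eta> j)))
    = (\<Oplus>\<^bsub>D\<^esub>i\<in>{..<n}. \<Oplus>\<^bsub>D\<^esub>j\<in>{..<n}.
        bmult B (g j) (inv (g j)) (bmult B (g i) (k i j) (b i) (multiplier \<Phi> (k i j) (aa i j))) (bstar B (g j) (b j)))"
  proof -
    have cl: "inner (l2 G B) (\<eta> i) (\<Phi> (m i j) (\<eta> j)) \<in> carrier D" if "i < n" "j < n" for i j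
    proof (rule l2.inner_closed[OF \<eta>[OF that(1)] A0_app[OF \<Phi>_closed \<eta>[OF that(2)]]])
      show "m i j \<in> A0"
        using that k aa by (simp add: m_eq)
    qed
    have "(\<Oplus>\<^bsub>D\<^esub>j\<in>{..<n}. inner (l2 G B) (\<eta> i) (\<Phi> (m i j) (\<eta> j)))
      = (\<Oplus>\<^bsub>D\<^esub>j\<in>{..<n}.
        bmult B (g j) (inv (g j)) (bmult B (g i) (k i j) (b i) (multiplier \<Phi> (k i j) (aa i j))) (bstar B (g j) (b j)))"
      if i: "i < n" for i
      using cl[OF i] entry[OF i] by (intro D.M.finsum_cong') (auto simp del: D_simps)
    then show ?thesis
      using cl by (intro D.M.finsum_cong') (auto simp del: D_simps intro!: D.M.finsum_closed simp flip: entry)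
  qed
  then show "positive D (\<Oplus>\<^bsub>D\<^esub>i\<in>{..<n}. \<Oplus>\<^bsub>D\<^esub>j\<in>{..<n}.
      bmult B (g j) (inv (g j)) (bmult B (g i) (inv (g i) \<otimes> g j) (b i)
        (multiplier \<Phi> (inv (g i) \<otimes> g j) (bmult B (inv (g i)) (g j) (bstar B (g i) (a i)) (a j))))
        (bstar B (g j) (b j)))"
    using pos by (simp add: D.positive_iff_pos k_def aa_def)
qed

end

text \<open>
  The functionals \<open>b \<mapsto> \<langle>\<eta>, \<lambda>\<^sub>g(b)\<rangle>\<close> vanish at infinity for each fixed \<open>\<eta>\<close>: approximate \<open>\<eta>\<close> by an
  element \<open>y\<close> of the reduced algebra and \<open>y\<close> applied to the unit section by a finitely supported
  section \<open>f\<close>; then only the error terms remain for \<open>g\<close> outside the support of \<open>f\<close>.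
\<close>

lemma inner_H_vanishes:
  assumes \<eta>: "\<eta> \<in> carrier (H_module G B)" and \<delta>: "\<delta> > 0"
  obtains F where "finite F" "\<And>g b. g \<in> carrier G \<Longrightarrow> g \<notin> F \<Longrightarrow> b \<in> carrier (fibre B g)
    \<Longrightarrow> nrm D (inner (H_module G B) \<eta> (hemb (reg_rep G B g b))) \<le> \<delta> * nrm (fibre B g) b"
proof -
  obtain y where y: "y \<in> A0" "nrm (H_module G B) (hemb y \<ominus>\<^bsub>H_module G B\<^esub> \<eta>) < \<delta> / 2"
    using Exp.embed_dense_eps[of \<eta> "\<delta> / 2"] \<eta> \<delta> by (auto simp: H_module_def)
  obtain f where f: "f \<in> carrier Sec" "nrm (l2 G B) (emb f \<ominus>\<^bsub>l2 G B\<^esub> y vac) < \<delta> / 2"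
    using Sec.embed_dense_eps[of "y vac" "\<delta> / 2"] A0_app[OF y(1) vac_closed] \<delta> by (auto simp: l2_def)
  show thesis
  proof (rule that[of "supp f"])
    fix g b assume g: "g \<in> carrier G" "g \<notin> supp f" and b: "b \<in> carrier (fibre B g)"
    let ?x = "reg_rep G B g b" and ?s = "emb (single g b)"
    have x: "?x \<in> A0" "hemb ?x \<in> carrier (H_module G B)" using g b by auto
    have s: "?s \<in> carrier (l2 G B)" "?x vac = ?s" using g b by (auto simp: reg_rep_vac)
    have hy: "hemb y \<in> carrier (H_module G B)" "y vac \<in> carrier (l2 G B)" using y by auto
    have nb: "0 \<le> nrm (fibre B g) b" using g b by (simp add: fibre_nrm_nonneg)
    have "inner (l2 G B) (emb f) ?s = inner Sec f (single g b)"
      using f g b by (simp add: inner_emb)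
    also have "\<dots> = adj D (inner Sec (single g b) f)"
      using Sec.adj_inner[of "single g b" f] f g b by simp
    also have "\<dots> = \<zero>\<^bsub>D\<^esub>"
      using inner_single[OF g(1) b f(1)] not_suppD[OF g] g b D.adj_zero by simp
    finally have "inner (l2 G B) (y vac) ?s = inner (l2 G B) (y vac) ?s \<ominus>\<^bsub>D\<^esub> inner (l2 G B) (emb f) ?s"
      using D.minus_zero_right[OF l2.inner_closed[OF hy(2) s(1)]] by simp
    also have "\<dots> = inner (l2 G B) (y vac \<ominus>\<^bsub>l2 G B\<^esub> emb f) ?s"
      using l2.inner_diff_left[OF s(1) hy(2) emb_closed[OF f(1)]] by simp
    finally have "nrm D (inner (l2 G B) (y vac) ?s) \<le> nrm (l2 G B) (y vac \<ominus>\<^bsub>l2 G B\<^esub> emb f) * nrm (l2 G B) ?s"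
      using l2.cauchy_schwarz[OF l2.V.M.minus_closed[OF hy(2) emb_closed[OF f(1)]] s(1)] by simp
    also have "\<dots> \<le> \<delta> / 2 * nrm (fibre B g) b"
    proof -
      have "nrm (l2 G B) (y vac \<ominus>\<^bsub>l2 G B\<^esub> emb f) \<le> \<delta> / 2"
        using f(2) l2.V.nrm_diff_commute[OF hy(2) emb_closed[OF f(1)]] by simp
      moreover have "nrm (l2 G B) ?s = nrm (fibre B g) b"
        using g b by (simp add: nrm_emb nrm_single)
      ultimately show ?thesis
        using nb by (metis mult_right_mono)
    qed
    finally have 1: "nrm D (inner (H_module G B) (hemb y) (hemb ?x)) \<le> \<delta> / 2 * nrm (fibre B g) b"
      using x y s by (simp add: inner_hemb)
    have "nrm D (inner (H_module G B) (\<eta> \<ominus>\<^bsub>H_module G B\<^esub> hemb y) (hemb ?x))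
        \<le> nrm (H_module G B) (\<eta> \<ominus>\<^bsub>H_module G B\<^esub> hemb y) * nrm (H_module G B) (hemb ?x)"
      by (rule H.cauchy_schwarz[OF H.V.M.minus_closed[OF \<eta> hy(1)] x(2)])
    also have "\<dots> \<le> \<delta> / 2 * nrm (fibre B g) b"
    proof -
      have "nrm (H_module G B) (\<eta> \<ominus>\<^bsub>H_module G B\<^esub> hemb y) \<le> \<delta> / 2"
        using y(2) H.V.nrm_diff_commute[OF \<eta> hy(1)] by simp
      then show ?thesis
        unfolding nrm_hemb_reg_rep[OF g(1) b] using nb by (rule mult_right_mono)
    qed
    finally have 2: "nrm D (inner (H_module G B) \<eta> (hemb ?x) \<ominus>\<^bsub>D\<^esub> inner (H_module G B) (hemb y) (hemb ?x))
        \<le> \<delta> / 2 * nrm (fibre B g) b"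
      using H.inner_diff_left[OF x(2) \<eta> hy(1)] by simp
    show "nrm D (inner (H_module G B) \<eta> (hemb ?x)) \<le> \<delta> * nrm (fibre B g) b"
      using D.nrm_le_diff_add[OF H.inner_closed[OF \<eta> x(2)] H.inner_closed[OF hy(1) x(2)]] 1 2
      by (simp add: algebra_simps)
  qed (use f in simp)
qed

lemma finite_rank_vanishes:
  assumes F: "finite_rank (H_module G B) F" and \<delta>: "\<delta> > 0"
  shows "\<exists>S. finite S \<and> (\<forall>g\<in>carrier G - S. \<forall>b\<in>carrier (fibre B g).
    nrm (H_module G B) (F (hemb (reg_rep G B g b))) \<le> \<delta> * nrm (fibre B g) b)"
proof -
  let ?H = "H_module G B"
  obtain n :: nat and \<xi> \<eta> where \<xi>\<eta>: "\<forall>k<n. \<xi> k \<in> carrier ?H \<and> \<eta> k \<in> carrier ?H"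
    and "\<forall>x\<in>carrier ?H. F x = (\<Oplus>\<^bsub>?H\<^esub>k\<in>{..<n}. ract ?H (\<xi> k) (inner ?H (\<eta> k) x))"
    using F unfolding finite_rank_def by blast
  then have F_eq: "F x = (\<Oplus>\<^bsub>?H\<^esub>k\<in>{..<n}. ract ?H (\<xi> k) (inner ?H (\<eta> k) x))"
    if "x \<in> carrier ?H" for x
    using that by simp
  have \<xi>: "\<xi> k \<in> carrier ?H" and \<eta>: "\<eta> k \<in> carrier ?H" if "k < n" for k
    using \<xi>\<eta> that by auto
  define M where "M = (\<Sum>k<n. nrm ?H (\<xi> k))"
  have M: "0 \<le> M"
    unfolding M_def using \<xi> by (intro sum_nonneg H.V.nrm_nonneg) auto
  define \<epsilon> where "\<epsilon> = \<delta> / (M + 1)"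
  have \<epsilon>: "\<epsilon> > 0" using \<delta> M by (simp add: \<epsilon>_def)
  have "\<exists>S. finite S \<and> (\<forall>g b. g \<in> carrier G \<longrightarrow> g \<notin> S \<longrightarrow> b \<in> carrier (fibre B g) \<longrightarrow>
      nrm D (inner ?H (\<eta> k) (hemb (reg_rep G B g b))) \<le> \<epsilon> * nrm (fibre B g) b)" if "k < n" for k
    using inner_H_vanishes[OF \<eta>[OF that] \<epsilon>] by metis
  then obtain S where S: "\<And>k. k < n \<Longrightarrow> finite (S k)"
    and small: "\<And>k g b. k < n \<Longrightarrow> g \<in> carrier G \<Longrightarrow> g \<notin> S k \<Longrightarrow> b \<in> carrier (fibre B g) \<Longrightarrow>
      nrm D (inner ?H (\<eta> k) (hemb (reg_rep G B g b))) \<le> \<epsilon> * nrm (fibre B g) b"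
    by metis
  show ?thesis
  proof (intro exI[of _ "\<Union>k<n. S k"] conjI ballI)
    fix g b assume g: "g \<in> carrier G - (\<Union>k<n. S k)" and b: "b \<in> carrier (fibre B g)"
    let ?x = "hemb (reg_rep G B g b)"
    have x: "?x \<in> carrier ?H" using g b by simp
    have r: "ract ?H (\<xi> k) (inner ?H (\<eta> k) ?x) \<in> carrier ?H" if "k < n" for k
      using \<xi>[OF that] H.inner_closed[OF \<eta>[OF that] x] by (rule H.ract_closed)
    have nb: "0 \<le> nrm (fibre B g) b" using g b by (simp add: fibre_nrm_nonneg)
    have "nrm ?H (F ?x) \<le> (\<Sum>k<n. nrm ?H (ract ?H (\<xi> k) (inner ?H (\<eta> k) ?x)))"
      unfolding F_eq[OF x] using r by (intro H.V.nrm_finsum_le) auto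
    also have "\<dots> \<le> (\<Sum>k<n. nrm ?H (\<xi> k) * (\<epsilon> * nrm (fibre B g) b))"
    proof (rule sum_mono)
      fix k assume "k \<in> {..<n}"
      then have k: "k < n" by simp
      have "nrm ?H (ract ?H (\<xi> k) (inner ?H (\<eta> k) ?x)) \<le> nrm ?H (\<xi> k) * nrm D (inner ?H (\<eta> k) ?x)"
        by (rule H.nrm_ract_le[OF \<xi>[OF k] H.inner_closed[OF \<eta>[OF k] x]])
      also have "\<dots> \<le> nrm ?H (\<xi> k) * (\<epsilon> * nrm (fibre B g) b)"
        using g b k small[of k g b] by (intro mult_left_mono H.V.nrm_nonneg \<xi>) auto
      finally show "nrm ?H (ract ?H (\<xi> k) (inner ?H (\<eta> k) ?x)) \<le> nrm ?H (\<xi> k) * (\<epsilon> * nrm (fibre B g) b)" .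
    qed
    also have "\<dots> = M * \<epsilon> * nrm (fibre B g) b"
      by (simp add: M_def sum_distrib_right mult.assoc)
    also have "\<dots> \<le> \<delta> * nrm (fibre B g) b"
      using mult_div_add_one_le[OF M \<delta>] nb by (intro mult_right_mono) (simp_all add: \<epsilon>_def)
    finally show "nrm ?H (F ?x) \<le> \<delta> * nrm (fibre B g) b" .
  qed (use S in auto)
qed

text \<open>
  Approximate the compact map by one of finite rank up to \<open>\<epsilon> / 4\<close>; outside a finite subset of the
  group the finite rank map contributes at most another \<open>\<epsilon> / 4\<close>.
\<close>

lemma vanishes_multiplier:
  assumes \<Phi>: "linear_map red.A red.A \<Phi>" and ind: "induces G B \<Phi> \<Phi>'"
    and cpt: "compact_map (H_module G B) \<Phi>'"
  shows "vanishes_at_infinity G (\<lambda>g. op_norm (fibre B g) (fibre B g) (multiplier \<Phi> g))"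
  unfolding vanishes_at_infinity_def
proof (intro allI impI)
  let ?H = "H_module G B"
  fix \<epsilon> :: real assume \<epsilon>: "\<epsilon> > 0"
  obtain F where F: "\<And>n. finite_rank ?H (F n)"
    and lim: "(\<lambda>n. op_norm ?H ?H (\<lambda>x. \<Phi>' x \<ominus>\<^bsub>?H\<^esub> F n x)) \<longlonglongrightarrow> 0"
    using cpt unfolding compact_map_def by blast
  have "\<forall>\<^sub>F n in sequentially. op_norm ?H ?H (\<lambda>x. \<Phi>' x \<ominus>\<^bsub>?H\<^esub> F n x) < \<epsilon> / 4"
    using lim \<epsilon> by (intro order_tendstoD(2)[OF lim]) simp
  then obtain n where n: "op_norm ?H ?H (\<lambda>x. \<Phi>' x \<ominus>\<^bsub>?H\<^esub> F n x) < \<epsilon> / 4"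
    by (auto simp: eventually_sequentially)
  obtain S where S: "finite S" "\<And>g b. g \<in> carrier G \<Longrightarrow> g \<notin> S \<Longrightarrow> b \<in> carrier (fibre B g) \<Longrightarrow>
      nrm ?H (F n (hemb (reg_rep G B g b))) \<le> \<epsilon> / 4 * nrm (fibre B g) b"
    using finite_rank_vanishes[OF F[of n], of "\<epsilon> / 4"] \<epsilon> by fastforce
  obtain N :: nat and \<xi> \<eta> where \<xi>\<eta>: "\<forall>k<N. \<xi> k \<in> carrier ?H \<and> \<eta> k \<in> carrier ?H"
    and "\<forall>x\<in>carrier ?H. F n x = (\<Oplus>\<^bsub>?H\<^esub>k\<in>{..<N}. ract ?H (\<xi> k) (inner ?H (\<eta> k) x))"
    using F[of n] unfolding finite_rank_def by blast
  then have F_eq: "F n x = (\<Oplus>\<^bsub>?H\<^esub>k\<in>{..<N}. ract ?H (\<xi> k) (inner ?H (\<eta> k) x))"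
    if "x \<in> carrier ?H" for x
    using that by simp
  have \<xi>: "\<xi> k \<in> carrier ?H" and \<eta>: "\<eta> k \<in> carrier ?H" if "k < N" for k
    using \<xi>\<eta> that by auto
  have r: "ract ?H (\<xi> k) (inner ?H (\<eta> k) x) \<in> carrier ?H" if "k < N" "x \<in> carrier ?H" for k x
    using \<xi>[OF that(1)] H.inner_closed[OF \<eta>[OF that(1)] that(2)] by (rule H.ract_closed)
  have Fc: "F n x \<in> carrier ?H" if "x \<in> carrier ?H" for x
    unfolding F_eq[OF that] using r that by (intro H.V.M.finsum_closed) auto
  \<comment> \<open>The difference must be bounded for its operator norm, a supremum of reals, to be an upper bound.\<close>
  define K where "K = op_norm ?H ?H \<Phi>' + (\<Sum>k<N. nrm ?H (\<xi> k) * nrm ?H (\<eta> k))"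
  have \<Phi>'b: "bounded_map ?H ?H \<Phi>'"
    using ind by (simp add: induces_def)
  have \<Phi>'c: "\<Phi>' x \<in> carrier ?H" if "x \<in> carrier ?H" for x
    using \<Phi>'b linear_mapD(1)[OF _ that] by (auto simp: bounded_map_def)
  have bd: "nrm ?H (\<Phi>' x \<ominus>\<^bsub>?H\<^esub> F n x) \<le> K * nrm ?H x" if x: "x \<in> carrier ?H" for x
  proof -
    have "nrm ?H (F n x) \<le> (\<Sum>k<N. nrm ?H (ract ?H (\<xi> k) (inner ?H (\<eta> k) x)))"
      unfolding F_eq[OF x] using r[OF _ x] by (intro H.V.nrm_finsum_le) auto
    also have "\<dots> \<le> (\<Sum>k<N. nrm ?H (\<xi> k) * (nrm ?H (\<eta> k) * nrm ?H x))"
    proof (rule sum_mono)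
      fix k assume "k \<in> {..<N}"
      then have k: "k < N" by simp
      show "nrm ?H (ract ?H (\<xi> k) (inner ?H (\<eta> k) x)) \<le> nrm ?H (\<xi> k) * (nrm ?H (\<eta> k) * nrm ?H x)"
        using H.nrm_ract_le[OF \<xi>[OF k] H.inner_closed[OF \<eta>[OF k] x]]
          mult_left_mono[OF H.cauchy_schwarz[OF \<eta>[OF k] x] H.V.nrm_nonneg[OF \<xi>[OF k]]] by simp
    qed
    also have "\<dots> = (\<Sum>k<N. nrm ?H (\<xi> k) * nrm ?H (\<eta> k)) * nrm ?H x"
      by (simp add: sum_distrib_right mult.assoc)
    finally show ?thesis
      using H.V.nrm_diff_le[OF \<Phi>'c[OF x] Fc[OF x]]
        op_norm_bound[OF H.V.normed_space_axioms H.V.normed_space_axioms \<Phi>'b x]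
      by (simp add: K_def distrib_right)
  qed
  have small: "op_norm (fibre B g) (fibre B g) (multiplier \<Phi> g) \<le> \<epsilon> / 2" if g: "g \<in> carrier G" "g \<notin> S" for g
  proof (rule op_norm_least[OF normed_fibre[OF g(1)]])
    fix b assume b: "b \<in> carrier (fibre B g)" "nrm (fibre B g) b \<le> 1"
    let ?x = "hemb (reg_rep G B g b)"
    have x: "?x \<in> carrier ?H" using g b by simp
    have "nrm ?H (\<Phi>' ?x \<ominus>\<^bsub>?H\<^esub> F n ?x) \<le> op_norm ?H ?H (\<lambda>x. \<Phi>' x \<ominus>\<^bsub>?H\<^esub> F n x)"
      using g b by (intro op_norm_upper_unit[OF bd x]) (auto simp: nrm_hemb_reg_rep H.V.nrm_nonneg)
    moreover have "nrm ?H (F n ?x) \<le> \<epsilon> / 4"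
      using order_trans[OF S(2)[OF g b(1)] mult_left_mono[OF b(2), of "\<epsilon> / 4"]] \<epsilon> by simp
    ultimately have "nrm ?H (\<Phi>' ?x) \<le> \<epsilon> / 2"
      using n H.V.nrm_le_diff_add[OF \<Phi>'c[OF x] Fc[OF x]] by simp
    then show "nrm (fibre B g) (multiplier \<Phi> g b) \<le> \<epsilon> / 2"
      using nrm_multiplier_le_hemb[OF \<Phi> ind g(1) b(1)] by simp
  qed
  have nonneg: "0 \<le> op_norm (fibre B g) (fibre B g) (multiplier \<Phi> g)" if "g \<in> carrier G" for g
    using that by (intro op_norm_nonneg normed_fibre bounded_multiplier[OF \<Phi> ind])
  have "{g \<in> carrier G. \<epsilon> \<le> \<bar>op_norm (fibre B g) (fibre B g) (multiplier \<Phi> g)\<bar>} \<subseteq> S"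
    using small nonneg \<epsilon> by fastforce
  then show "finite {g \<in> carrier G. \<epsilon> \<le> \<bar>op_norm (fibre B g) (fibre B g) (multiplier \<Phi> g)\<bar>}"
    using S(1) by (rule finite_subset)
qed

lemma haagerup_PD_if_module_haagerup:
  assumes "module_haagerup TYPE('i) G B"
  shows "haagerup_PD TYPE('i) G B"
proof -
  let ?H = "H_module G B"
  obtain I :: "'i set" and R \<Phi> \<Phi>' where dir: "directed_set I R"
    and cp': "\<forall>i\<in>I. completely_positive red.A (\<Phi> i) \<and> bimodule_map G B (\<Phi> i)"
    and ind': "\<forall>i\<in>I. induces G B (\<Phi> i) (\<Phi>' i)"
    and bdd: "bdd_above ((\<lambda>i. op_norm ?H ?H (\<Phi>' i)) ` I)"
    and cpt': "\<forall>i\<in>I. compact_map ?H (\<Phi>' i)"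
    and lim': "\<forall>x\<in>carrier red.A. ((\<lambda>i. nrm ?H (\<Phi>' i (hemb x) \<ominus>\<^bsub>?H\<^esub> hemb x)) \<longlongrightarrow> 0) (tail_filter I R)"
    using assms unfolding module_haagerup_def Let_def reduced_algebra_eq by blast
  note cp = cp'[rule_format, THEN conjunct1] and ind = ind'[rule_format] and cpt = cpt'[rule_format]
  have lim: "((\<lambda>i. nrm ?H (\<Phi>' i (hemb x) \<ominus>\<^bsub>?H\<^esub> hemb x)) \<longlongrightarrow> 0) (tail_filter I R)" if "x \<in> A0" for x
    using lim' that by simp
  have lin: "linear_map red.A red.A (\<Phi> i)" if "i \<in> I" for i
    using cp[OF that] by (simp add: completely_positive_def)
  have in_I: "\<forall>\<^sub>F i in tail_filter I R. i \<in> I"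
  proof -
    obtain i0 where "i0 \<in> I" using dir by (auto simp: directed_set_def)
    then have "tail_filter I R \<le> principal {j \<in> I. R i0 j}"
      unfolding tail_filter_def by (rule INF_lower)
    moreover have "\<forall>\<^sub>F i in principal {j \<in> I. R i0 j}. i \<in> I"
      by (simp add: eventually_principal)
    ultimately show ?thesis by (rule filter_leD)
  qed
  show ?thesis
    unfolding haagerup_PD_def
  proof (intro exI[of _ I] exI[of _ R] exI[of _ "\<lambda>i. multiplier (\<Phi> i)"] conjI ballI dir)
    fix i assume i: "i \<in> I"
    show "bundle_map G B (multiplier (\<Phi> i))"
      using bounded_multiplier[OF lin[OF i] ind[OF i]] by (simp add: bundle_map_def)
    show "positive_definite G B (multiplier (\<Phi> i))"
      by (rule positive_definite_multiplier[OF lin[OF i] ind[OF i] cp[OF i]])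
    show "vanishes_at_infinity G (\<lambda>g. op_norm (fibre B g) (fibre B g) (multiplier (\<Phi> i) g))"
      by (rule vanishes_multiplier[OF lin[OF i] ind[OF i] cpt[OF i]])
  next
    obtain M where M: "\<And>i. i \<in> I \<Longrightarrow> op_norm ?H ?H (\<Phi>' i) \<le> M"
      using bdd by (auto simp: bdd_above_def)
    show "bdd_above ((\<lambda>i. op_norm (fibre B \<one>) (fibre B \<one>) (multiplier (\<Phi> i) \<one>)) ` I)"
      using order_trans[OF op_norm_multiplier_le[OF lin ind one_closed] M] by (intro bdd_aboveI2)
  next
    fix g b assume g: "g \<in> carrier G" and b: "b \<in> carrier (fibre B g)"
    show "((\<lambda>i. nrm (fibre B g) (multiplier (\<Phi> i) g b \<ominus>\<^bsub>fibre B g\<^esub> b)) \<longlongrightarrow> 0) (tail_filter I R)"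
    proof (rule tendsto_sandwich[OF _ _ tendsto_const lim[OF reg_rep_A0[OF g b]]])
      show "\<forall>\<^sub>F i in tail_filter I R. 0 \<le> nrm (fibre B g) (multiplier (\<Phi> i) g b \<ominus>\<^bsub>fibre B g\<^esub> b)"
        using in_I
      proof (rule eventually_mono)
        fix i assume i: "i \<in> I"
        interpret F: normed_space "fibre B g" by (rule normed_fibre[OF g])
        show "0 \<le> nrm (fibre B g) (multiplier (\<Phi> i) g b \<ominus>\<^bsub>fibre B g\<^esub> b)"
          using linear_mapD(1)[OF linear_multiplier[OF lin[OF i] ind[OF i] g] b] b
          by (intro F.nrm_nonneg F.M.minus_closed)
      qed
      show "\<forall>\<^sub>F i in tail_filter I R. nrm (fibre B g) (multiplier (\<Phi> i) g b \<ominus>\<^bsub>fibre B g\<^esub> b)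
          \<le> nrm ?H (\<Phi>' i (hemb (reg_rep G B g b)) \<ominus>\<^bsub>?H\<^esub> hemb (reg_rep G B g b))"
        using in_I by (rule eventually_mono) (rule nrm_multiplier_diff_le[OF lin ind g b])
    qed
  qed
qed

end

theorem theorem6p8:
  fixes G :: "'g monoid" and B :: "('g, 'b) bundle_data"
  assumes "unital_fell_bundle G B"
    and "module_haagerup TYPE('i) G B"
  shows "haagerup_PD TYPE('i) G B"
  using assms by (rule unital_fell_bundle.haagerup_PD_if_module_haagerup)

end
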